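(* There is an algorithm ($\mathsf{Closure}$) that, given a trace $t$ of length $n$ and a partial order $P$ over a feasible set $X\subseteq\mathcal{E}(t)$ such that $P$ respects $t$, correctly computes the closure of $P$ (that is, it returns the closure of $P$ if it exists, and $\bot$ otherwise) and requires $O(n^2\cdot\log n)$ time.
   Context: **Events.** There are $k$ processes, a set of global variables and a set of locks. Each event $e$ belongs to one process $p(e)$, accesses one location $\mathsf{loc}(e)$, and is of exactly one of four types: a write $w(x)$ or read $r(x)$ of a global variable $x$, or an acquire $\mathsf{acq}(\ell)$ or release $\mathsf{rel}(\ell)$ of a lock $\ell$. Two distinct events are *conflicting*, written $e_1\Join e_2$, if they access the same location and either both are read/write events and at least one is a write, or both are lock events. **Event sequences.** Let $t$ be a finite sequence of distinct events. $\mathcal{E}(t)$ is its set of events; $e_1<_t e_2$ means that $e_1$ appears before $e_2$ in $t$; $e_1<_{\mathsf{PO}}e_2$ means $e_1<_t e_2$ and $p(e_1)=p(e_2)$; $\le_{\mathsf{PO}}$ is its reflexive closure. For an acquire event $a$ of $t$, $\mathsf{match}_t(a)$ is the earliest release event $\rho$ of $t$ on the same lock with $a<_t\rho$ ($\bot$ if there is none); if it exists it is required to belong to $p(a)$. For a release event $\rho$, $\mathsf{match}_t(\rho)$ is the acquire event $a$ with $\mathsf{match}_t(a)=\rho$, which is required to exist. **Traces.** $t$ is a *trace* if (1) for every read $r$ of $t$ there is a write $w$ of $t$ with $\mathsf{loc}(w)=\mathsf{loc}(r)$ and $w<_t r$; and (2) for any two acquires $a_1<_t a_2$ of $t$ on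 the same lock, $\mathsf{match}_t(a_1)$ exists in $t$ and $\mathsf{match}_t(a_1)<_t a_2$. The *observation function* $\mathcal{O}_t$ maps each read $r$ of $t$ to the last write to $\mathsf{loc}(r)$ preceding $r$ in $t$. **Feasible sets.** $X\subseteq\mathcal{E}(t)$ is *feasible* for $t$ if: $e_1\le_{\mathsf{PO}}e_2\in X$ implies $e_1\in X$; $\mathcal{O}_t(r)\in X$ for every read $r\in X$; $\mathsf{match}_t(\rho)\in X$ for every release $\rho\in X$; and any two distinct acquires $a_1,a_2\in X$ whose matching releases are not in $X$ access different locks. **Partial orders.** A partial order $P$ over $X$ is a reflexive, antisymmetric, transitive relation $\le_P$ on $X$; $<_P$ is its strict part. $Q\sqsubseteq P$ ($Q$ refines $P$) means that $e_1\le_P e_2$ implies $e_1\le_Q e_2$. $P|Y$ denotes restriction. $P$ over a feasible set $X$ *respects* $t$ if (1) $P\sqsubseteq\mathsf{PO}|X$; (2) $\mathcal{O}_t(r)<_P r$ for every read $r\in X$; (3) for every acquire $a\in X$ with $\mathsf{match}_t(a)\notin X$ (including $\mathsf{match}_t(a)=\bot$) and every release $\rho\in X$ on the same lock, $\rho<_P a$. $P$ is *closed* (trace-closed) if it respects $t$ and is - *observation-closed*: for every read $r\in X$ with $w=\mathcal{O}_t(r)$ and every write $w'\in X\setminus\{w\}$ with $w'\Join r$: if $w'<_P r$ then $w'<_P w$, and if $w<_P w'$ then $r<_P w'$; and - *lock-closed*: for any two distinct releases $\rho_1,\rho_2\in X$ on the same lock, with $a_i=\mathsf{match}_t(\rho_i)$: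 if $a_1\le_P\rho_2$ then $\rho_1\le_P a_2$. The *closure* of $P$ is the smallest (weakest, i.e. least with respect to inclusion of relations) partial order $Q$ over $X$ such that $Q\sqsubseteq P$ and $Q$ is closed; it is undefined if no closed $Q\sqsubseteq P$ exists. **Complexity conventions.** The number of processes $k$ and the number of variables and locks are treated as constants in the $O$-notation (the hidden dependency on them is polynomial). The partial order $P$ (of width at most $k$, since it contains the program order) is given as a directed acyclic graph consisting of the $k$ chains formed by the events of each process in $X$, with, for each event and each other chain, at most one stored outgoing edge into that chain (an $O(n)$-size representation whose reachability relation is $P$); the output is represented likewise. *)

theory Defs
  imports Complex_Main
begin

section \<open>Events, traces and closed partial orders\<close>

datatype location = Variable nat | Lock nat

datatype operation = Write nat | Read nat | Acquire nat | Release nat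

text \<open>The identifier makes several occurrences of the same operation by the same process
  distinct events.\<close>

datatype event = Event (ident: nat) (proc: nat) (oper: operation)

primrec op_loc :: "operation \<Rightarrow> location" where
  "op_loc (Write x) = Variable x"
| "op_loc (Read x) = Variable x"
| "op_loc (Acquire l) = Lock l"
| "op_loc (Release l) = Lock l"

definition loc :: "event \<Rightarrow> location" where
  "loc e = op_loc (oper e)"

definition is_write :: "event \<Rightarrow> bool" where
  "is_write e \<longleftrightarrow> (\<exists>x. oper e = Write x)"

definition is_read :: "event \<Rightarrow> bool" where
  "is_read e \<longleftrightarrow> (\<exists>x. oper e = Read x)"

definition is_acquire :: "event \<Rightarrow> bool" where
  "is_acquire e \<longleftrightarrow> (\<exists>l. oper e = Acquire l)"

definition is_release :: "event \<Rightarrow> bool" where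
  "is_release e \<longleftrightarrow> (\<exists>l. oper e = Release l)"

text \<open>For lock locations no further condition is needed: only acquires and releases access
  a lock.\<close>

definition conflicting :: "event \<Rightarrow> event \<Rightarrow> bool" where
  "conflicting e1 e2 \<longleftrightarrow> e1 \<noteq> e2 \<and> loc e1 = loc e2 \<and>
     ((\<exists>x. loc e1 = Variable x) \<longrightarrow> is_write e1 \<or> is_write e2)"

definition before :: "event list \<Rightarrow> event \<Rightarrow> event \<Rightarrow> bool" where
  "before t e1 e2 \<longleftrightarrow> (\<exists>i j. i < j \<and> j < length t \<and> t ! i = e1 \<and> t ! j = e2)"

text \<open>The reflexive program order on the events of a sequence.\<close>

definition program_order :: "event list \<Rightarrow> event rel" where
  "program_order t = {(e1, e2). before t e1 e2 \<and> proc e1 = proc e2} \<union> Id_on (set t)"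

definition later_releases :: "event list \<Rightarrow> event \<Rightarrow> event set" where
  "later_releases t a = {\<rho> \<in> set t. is_release \<rho> \<and> loc \<rho> = loc a \<and> before t a \<rho>}"

definition match_acquire :: "event list \<Rightarrow> event \<Rightarrow> event option" where
  "match_acquire t a =
     (if later_releases t a = {} then None
      else Some (THE \<rho>. \<rho> \<in> later_releases t a \<and>
                        (\<forall>\<rho>' \<in> later_releases t a - {\<rho>}. before t \<rho> \<rho>')))"

definition match_release :: "event list \<Rightarrow> event \<Rightarrow> event" where
  "match_release t \<rho> = (THE a. a \<in> set t \<and> is_acquire a \<and> match_acquire t a = Some \<rho>)"

definition event_sequence :: "event list \<Rightarrow> bool" where
  "event_sequence t \<longleftrightarrow>
     distinct t \<and>
     (\<forall>a \<in> set t. is_acquire a \<longrightarrow>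
        (\<forall>\<rho>. match_acquire t a = Some \<rho> \<longrightarrow> proc \<rho> = proc a)) \<and>
     (\<forall>\<rho> \<in> set t. is_release \<rho> \<longrightarrow>
        (\<exists>a \<in> set t. is_acquire a \<and> match_acquire t a = Some \<rho>))"

definition trace :: "event list \<Rightarrow> bool" where
  "trace t \<longleftrightarrow>
     event_sequence t \<and>
     (\<forall>r \<in> set t. is_read r \<longrightarrow>
        (\<exists>w \<in> set t. is_write w \<and> loc w = loc r \<and> before t w r)) \<and>
     (\<forall>a1 \<in> set t. \<forall>a2 \<in> set t.
        is_acquire a1 \<and> is_acquire a2 \<and> loc a1 = loc a2 \<and> before t a1 a2 \<longrightarrow>
        (\<exists>\<rho>. match_acquire t a1 = Some \<rho> \<and> before t \<rho> a2))"

definition earlier_writes :: "event list \<Rightarrow> event \<Rightarrow> event set" where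
  "earlier_writes t r = {w \<in> set t. is_write w \<and> loc w = loc r \<and> before t w r}"

definition observation :: "event list \<Rightarrow> event \<Rightarrow> event" where
  "observation t r = (THE w. w \<in> earlier_writes t r \<and>
                             (\<forall>w' \<in> earlier_writes t r - {w}. before t w' w))"

text \<open>The matching release of \<open>a\<close> is not in \<open>X\<close>, or \<open>a\<close> has none.\<close>

definition unmatched_in :: "event list \<Rightarrow> event set \<Rightarrow> event \<Rightarrow> bool" where
  "unmatched_in t X a \<longleftrightarrow> (\<forall>\<rho>. match_acquire t a = Some \<rho> \<longrightarrow> \<rho> \<notin> X)"

definition feasible :: "event list \<Rightarrow> event set \<Rightarrow> bool" where
  "feasible t X \<longleftrightarrow>
     X \<subseteq> set t \<and>
     (\<forall>e1 e2. (e1, e2) \<in> program_order t \<and> e2 \<in> X \<longrightarrow> e1 \<in> X) \<and>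
     (\<forall>r \<in> X. is_read r \<longrightarrow> observation t r \<in> X) \<and>
     (\<forall>\<rho> \<in> X. is_release \<rho> \<longrightarrow> match_release t \<rho> \<in> X) \<and>
     (\<forall>a1 \<in> X. \<forall>a2 \<in> X.
        is_acquire a1 \<and> is_acquire a2 \<and> a1 \<noteq> a2 \<and> unmatched_in t X a1 \<and> unmatched_in t X a2
        \<longrightarrow> loc a1 \<noteq> loc a2)"

definition slt :: "event rel \<Rightarrow> event \<Rightarrow> event \<Rightarrow> bool" where
  "slt P e1 e2 \<longleftrightarrow> (e1, e2) \<in> P \<and> e1 \<noteq> e2"

definition refines :: "event rel \<Rightarrow> event rel \<Rightarrow> bool" where
  "refines Q P \<longleftrightarrow> (\<forall>e1 e2. (e1, e2) \<in> P \<longrightarrow> (e1, e2) \<in> Q)"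

definition respects_trace :: "event list \<Rightarrow> event set \<Rightarrow> event rel \<Rightarrow> bool" where
  "respects_trace t X P \<longleftrightarrow>
     refines P (program_order t \<inter> X \<times> X) \<and>
     (\<forall>r \<in> X. is_read r \<longrightarrow> slt P (observation t r) r) \<and>
     (\<forall>a \<in> X. \<forall>\<rho> \<in> X.
        is_acquire a \<and> unmatched_in t X a \<and> is_release \<rho> \<and> loc \<rho> = loc a \<longrightarrow> slt P \<rho> a)"

definition observation_closed :: "event list \<Rightarrow> event set \<Rightarrow> event rel \<Rightarrow> bool" where
  "observation_closed t X P \<longleftrightarrow>
     (\<forall>r \<in> X. is_read r \<longrightarrow>
        (let w = observation t r in
         \<forall>w' \<in> X - {w}. is_write w' \<and> conflicting w' r \<longrightarrow>
           (slt P w' r \<longrightarrow> slt P w' w) \<and> (slt P w w' \<longrightarrow> slt P r w')))"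

definition lock_closed :: "event list \<Rightarrow> event set \<Rightarrow> event rel \<Rightarrow> bool" where
  "lock_closed t X P \<longleftrightarrow>
     (\<forall>\<rho>1 \<in> X. \<forall>\<rho>2 \<in> X.
        is_release \<rho>1 \<and> is_release \<rho>2 \<and> \<rho>1 \<noteq> \<rho>2 \<and> loc \<rho>1 = loc \<rho>2 \<longrightarrow>
        (match_release t \<rho>1, \<rho>2) \<in> P \<longrightarrow> (\<rho>1, match_release t \<rho>2) \<in> P)"

definition trace_closed :: "event list \<Rightarrow> event set \<Rightarrow> event rel \<Rightarrow> bool" where
  "trace_closed t X P \<longleftrightarrow>
     respects_trace t X P \<and> observation_closed t X P \<and> lock_closed t X P"

definition closed_refinement ::
  "event list \<Rightarrow> event set \<Rightarrow> event rel \<Rightarrow> event rel \<Rightarrow> bool" where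
  "closed_refinement t X P Q \<longleftrightarrow> partial_order_on X Q \<and> refines Q P \<and> trace_closed t X Q"

definition is_closure :: "event list \<Rightarrow> event set \<Rightarrow> event rel \<Rightarrow> event rel \<Rightarrow> bool" where
  "is_closure t X P Q \<longleftrightarrow>
     closed_refinement t X P Q \<and> (\<forall>Q'. closed_refinement t X P Q' \<longrightarrow> Q \<subseteq> Q')"

section \<open>Chain representation of partial orders\<close>

text \<open>\<open>E e j = Some f\<close> is the stored edge from \<open>e\<close> into the chain of process \<open>j\<close>;
  the edges inside a chain are implicit.\<close>

type_synonym edges = "event \<Rightarrow> nat \<Rightarrow> event option"

definition chain_edges :: "event list \<Rightarrow> event set \<Rightarrow> event rel" where
  "chain_edges t X =
     {(e, f) \<in> X \<times> X. slt (program_order t) e f \<and>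
        \<not> (\<exists>g \<in> X. slt (program_order t) e g \<and> slt (program_order t) g f)}"

definition stored_edges :: "edges \<Rightarrow> event rel" where
  "stored_edges E = {(e, f). \<exists>j. E e j = Some f}"

definition represents ::
  "nat \<Rightarrow> event list \<Rightarrow> event set \<Rightarrow> edges \<Rightarrow> event rel \<Rightarrow> bool" where
  "represents k t X E P \<longleftrightarrow>
     (\<forall>e j f. E e j = Some f \<longrightarrow>
        e \<in> X \<and> j < k \<and> j \<noteq> proc e \<and> f \<in> X \<and> proc f = j) \<and>
     acyclic (chain_edges t X \<union> stored_edges E) \<and>
     P = (chain_edges t X \<union> stored_edges E)\<^sup>* \<inter> (X \<times> X)"

section \<open>Machine model\<close>

text \<open>A structured program for a word RAM. A memory consists of named arrays of words, a
  scalar variable being cell 0 of its array. A program mentions finitely many names. An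
  execution with word bound \<open>W\<close> exists only if every intermediate value, and hence every
  address, is at most \<open>W\<close>; this rules out packing large data into a single number.\<close>

type_synonym memory = "string \<Rightarrow> nat \<Rightarrow> nat"

datatype aexp =
    Const nat
  | Cell string aexp
  | Plus aexp aexp
  | Minus aexp aexp
  | Times aexp aexp
  | Div aexp aexp

datatype bexp = Less aexp aexp | Equal aexp aexp | Not bexp | And bexp bexp

datatype com =
    Skip
  | Store string aexp aexp
  | Seq com com
  | If bexp com com
  | While bexp com

primrec aval :: "aexp \<Rightarrow> memory \<Rightarrow> nat" where
  "aval (Const c) s = c"
| "aval (Cell x a) s = s x (aval a s)"
| "aval (Plus a b) s = aval a s + aval b s"
| "aval (Minus a b) s = aval a s - aval b s"
| "aval (Times a b) s = aval a s * aval b s"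
| "aval (Div a b) s = aval a s div aval b s"

primrec bval :: "bexp \<Rightarrow> memory \<Rightarrow> bool" where
  "bval (Less a b) s \<longleftrightarrow> aval a s < aval b s"
| "bval (Equal a b) s \<longleftrightarrow> aval a s = aval b s"
| "bval (Not b) s \<longleftrightarrow> \<not> bval b s"
| "bval (And b c) s \<longleftrightarrow> bval b s \<and> bval c s"

primrec afits :: "nat \<Rightarrow> aexp \<Rightarrow> memory \<Rightarrow> bool" where
  "afits W (Const c) s \<longleftrightarrow> c \<le> W"
| "afits W (Cell x a) s \<longleftrightarrow> afits W a s \<and> aval (Cell x a) s \<le> W"
| "afits W (Plus a b) s \<longleftrightarrow> afits W a s \<and> afits W b s \<and> aval (Plus a b) s \<le> W"
| "afits W (Minus a b) s \<longleftrightarrow> afits W a s \<and> afits W b s"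
| "afits W (Times a b) s \<longleftrightarrow> afits W a s \<and> afits W b s \<and> aval (Times a b) s \<le> W"
| "afits W (Div a b) s \<longleftrightarrow> afits W a s \<and> afits W b s"

primrec bfits :: "nat \<Rightarrow> bexp \<Rightarrow> memory \<Rightarrow> bool" where
  "bfits W (Less a b) s \<longleftrightarrow> afits W a s \<and> afits W b s"
| "bfits W (Equal a b) s \<longleftrightarrow> afits W a s \<and> afits W b s"
| "bfits W (Not b) s \<longleftrightarrow> bfits W b s"
| "bfits W (And b c) s \<longleftrightarrow> bfits W b s \<and> bfits W c s"

text \<open>\<open>exec W c s T s'\<close>: started in memory \<open>s\<close>, the program \<open>c\<close> terminates in memory \<open>s'\<close>
  after \<open>T\<close> steps. Every executed store and every evaluated test is one step; since the
  expressions of a fixed program have fixed size, counting the individual operations in them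
  changes \<open>T\<close> by a constant factor only.\<close>

inductive exec :: "nat \<Rightarrow> com \<Rightarrow> memory \<Rightarrow> nat \<Rightarrow> memory \<Rightarrow> bool" for W where
  Skip: "exec W Skip s 1 s"
| Store: "afits W i s \<Longrightarrow> afits W a s \<Longrightarrow>
    exec W (Store x i a) s 1 (s(x := (s x)(aval i s := aval a s)))"
| Seq: "exec W c1 s T1 s1 \<Longrightarrow> exec W c2 s1 T2 s2 \<Longrightarrow> exec W (Seq c1 c2) s (T1 + T2) s2"
| IfTrue: "bfits W b s \<Longrightarrow> bval b s \<Longrightarrow> exec W c1 s T s1 \<Longrightarrow>
    exec W (If b c1 c2) s (T + 1) s1"
| IfFalse: "bfits W b s \<Longrightarrow> \<not> bval b s \<Longrightarrow> exec W c2 s T s1 \<Longrightarrow>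
    exec W (If b c1 c2) s (T + 1) s1"
| WhileFalse: "bfits W b s \<Longrightarrow> \<not> bval b s \<Longrightarrow> exec W (While b c) s 1 s"
| WhileTrue: "bfits W b s \<Longrightarrow> bval b s \<Longrightarrow> exec W c s T1 s1 \<Longrightarrow>
    exec W (While b c) s1 T2 s2 \<Longrightarrow> exec W (While b c) s (T1 + T2 + 1) s2"

text \<open>Executions are deterministic, so the run time and the result of a program on a given
  memory are well defined.\<close>

lemma exec_deterministic:
  "exec W c s T s1 \<Longrightarrow> exec W c s T' s2 \<Longrightarrow> T = T' \<and> s1 = s2"
proof (induction arbitrary: T' s2 rule: exec.induct)
  case (Seq c1 s T1 s1 c2 T2 s2)
  from Seq.prems show ?case
    by (cases rule: exec.cases) (use Seq.IH in blast)+
next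
  case (WhileTrue b s c T1 s1 T2 s2)
  from WhileTrue.prems show ?case
    by (cases rule: exec.cases) (use WhileTrue.hyps WhileTrue.IH in blast)+
qed (erule exec.cases; auto)+

section \<open>Input and output encoding\<close>

primrec op_code :: "operation \<Rightarrow> nat" where
  "op_code (Write x) = 0"
| "op_code (Read x) = 1"
| "op_code (Acquire l) = 2"
| "op_code (Release l) = 3"

primrec op_arg :: "operation \<Rightarrow> nat" where
  "op_arg (Write x) = x"
| "op_arg (Read x) = x"
| "op_arg (Acquire l) = l"
| "op_arg (Release l) = l"

definition position :: "event list \<Rightarrow> event \<Rightarrow> nat" where
  "position t e = (THE i. i < length t \<and> t ! i = e)"

text \<open>An event is encoded by its position in \<open>t\<close>, an absent edge by 0.\<close>

definition edge_code :: "event list \<Rightarrow> event option \<Rightarrow> nat" where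
  "edge_code t f = (case f of None \<Rightarrow> 0 | Some f' \<Rightarrow> position t f' + 1)"

definition scalar :: "nat \<Rightarrow> nat \<Rightarrow> nat" where
  "scalar v = (\<lambda>i. if i = 0 then v else 0)"

definition array :: "nat \<Rightarrow> (nat \<Rightarrow> nat) \<Rightarrow> nat \<Rightarrow> nat" where
  "array m f = (\<lambda>i. if i < m then f i else 0)"

definition bounded_names :: "nat \<Rightarrow> nat \<Rightarrow> nat \<Rightarrow> event list \<Rightarrow> bool" where
  "bounded_names k nv nl t \<longleftrightarrow>
     (\<forall>e \<in> set t. proc e < k \<and>
        (case loc e of Variable x \<Rightarrow> x < nv | Lock l \<Rightarrow> l < nl))"

text \<open>Edges are stored row by row, one row of length \<open>k\<close> per event of \<open>t\<close>.\<close>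

definition input_memory ::
  "nat \<Rightarrow> nat \<Rightarrow> nat \<Rightarrow> event list \<Rightarrow> event set \<Rightarrow> edges \<Rightarrow> memory" where
  "input_memory k nv nl t X E =
     (\<lambda>_ _. 0)
       (''length'' := scalar (length t),
        ''processes'' := scalar k,
        ''variables'' := scalar nv,
        ''locks'' := scalar nl,
        ''proc'' := array (length t) (\<lambda>i. proc (t ! i)),
        ''op'' := array (length t) (\<lambda>i. op_code (oper (t ! i))),
        ''loc'' := array (length t) (\<lambda>i. op_arg (oper (t ! i))),
        ''member'' := array (length t) (\<lambda>i. of_bool (t ! i \<in> X)),
        ''edge'' := array (length t * k)
           (\<lambda>m. edge_code t (E (t ! (m div k)) (m mod k))))"

definition outputs_bottom :: "memory \<Rightarrow> bool" where
  "outputs_bottom s \<longleftrightarrow> s ''defined'' 0 = 0"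

definition outputs_edges :: "nat \<Rightarrow> event list \<Rightarrow> memory \<Rightarrow> edges \<Rightarrow> bool" where
  "outputs_edges k t s E \<longleftrightarrow>
     s ''defined'' 0 = 1 \<and>
     (\<forall>i < length t. \<forall>j < k. s ''result'' (i * k + j) = edge_code t (E (t ! i) j))"

text \<open>The word bound \<open>(N + 2) ^ b\<close> for inputs of size \<open>N\<close> amounts to words of
  \<open>O(log N)\<close> bits.\<close>

definition word_bound :: "nat \<Rightarrow> nat \<Rightarrow> nat \<Rightarrow> nat \<Rightarrow> nat \<Rightarrow> nat" where
  "word_bound b k nv nl n = (n + k + nv + nl + 2) ^ b"

end

theory Submission
  imports Defs
begin

text \<open>
  All orderings that the closure conditions force are collected in a Boolean matrix over pairs
  of events, together with a queue of the pairs that still have to be propagated. A pair is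
  enqueued at most once, so there are at most \<open>n\<^sup>2\<close> iterations, and processing a pair
  \<open>(e, f)\<close> takes \<open>O(k)\<close> steps because only extremal events matter. By monotonicity along the
  chains it suffices for transitivity to combine \<open>(e, f)\<close> with the earliest known successor
  of \<open>f\<close> and the latest known predecessor of \<open>e\<close> in every chain. If \<open>e\<close> is a write that is
  ordered before a conflicting write \<open>f\<close>, the last read of each chain observing \<open>e\<close> must
  precede \<open>f\<close>; if \<open>f\<close> is a read, \<open>e\<close> must precede the write it observes; and an acquire \<open>e\<close>
  before a release \<open>f\<close> puts the release of \<open>e\<close> before the acquire of \<open>f\<close>. Every pair found is
  forced in all closed refinements. Hence a pair found in both directions refutes their
  existence, and otherwise the saturated matrix is the closure. No logarithmic factor arises.
\<close>

section \<open>Codes of events and the tables of a trace\<close>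

text \<open>The delicate point is transitivity. Pairs (u, v) and (v, w) are combined only when the
  later of the two leaves the queue, and then only through an extremal partner. Saturation can
  therefore promise just one of two alternatives: an earlier target in the chain of w or a later
  source in the chain of u. Either one gives (u, w) by moving along a chain, while a pair inside one
  chain is controlled by antisymmetry. Hence transitivity is derived at the end, from saturation
  together with antisymmetry. Soundness is a separate invariant: every entry lies in the
  intersection of all closed refinements. This intersection is the full relation when there are
  none, so the invariant survives a contradiction and the loop simply runs to its end. The table of
  earliest successors that drives the propagation is also the output, because one edge to the
  earliest successor in each foreign chain, together with the chains, generates the order. Words: a
  queue pointer can reach \<open>n * n\<close>, so cells are bounded by a square of the input size,
  and all intermediate values by a fixed power of that.\<close>

primrec latest :: "(nat \<Rightarrow> bool) \<Rightarrow> nat \<Rightarrow> nat" where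
  "latest P 0 = 0"
| "latest P (Suc i) = (if P (Suc i) then Suc i else latest P i)"

lemma latest_le: "latest P i \<le> i"
  by (induction i) auto

lemma latest_sat: "latest P i \<noteq> 0 \<Longrightarrow> P (latest P i)"
  by (induction i) (auto split: if_splits)

lemma latest_ge: "P u \<Longrightarrow> 0 < u \<Longrightarrow> u \<le> i \<Longrightarrow> u \<le> latest P i"
  by (induction i) (auto simp: le_Suc_eq)

lemma latest_eqI:
  assumes "P u" "0 < u" "u \<le> i" "\<And>v. u < v \<Longrightarrow> v \<le> i \<Longrightarrow> \<not> P v"
  shows "latest P i = u"
proof (rule ccontr)
  assume "latest P i \<noteq> u"
  moreover have "u \<le> latest P i"
    using assms by (intro latest_ge) auto
  ultimately have "u < latest P i" by simp
  moreover from this have "P (latest P i)" by (intro latest_sat[of P i]) auto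
  ultimately show False using assms(4) latest_le by blast
qed

lemma op_code_iff:
  "op_code (oper e) = 0 \<longleftrightarrow> is_write e"
  "op_code (oper e) = Suc 0 \<longleftrightarrow> is_read e"
  "op_code (oper e) = 2 \<longleftrightarrow> is_acquire e"
  "op_code (oper e) = 3 \<longleftrightarrow> is_release e"
  by (cases "oper e"; simp add: is_write_def is_read_def is_acquire_def is_release_def)+

lemma loc_eq_iff:
  "is_write e \<or> is_read e \<Longrightarrow> is_write f \<or> is_read f \<Longrightarrow>
     loc e = loc f \<longleftrightarrow> op_arg (oper e) = op_arg (oper f)"
  "is_acquire e \<or> is_release e \<Longrightarrow> is_acquire f \<or> is_release f \<Longrightarrow>
     loc e = loc f \<longleftrightarrow> op_arg (oper e) = op_arg (oper f)"
  by (auto simp: is_write_def is_read_def is_acquire_def is_release_def loc_def)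

locale closure_input =
  fixes k nv nl :: nat and t :: "event list" and X :: "event set" and P :: "event rel"
    and E :: edges
  assumes trace: "trace t" and bounded: "bounded_names k nv nl t" and feasible: "feasible t X"
    and order: "partial_order_on X P" and respects: "respects_trace t X P"
    and repr: "represents k t X E P"
begin

abbreviation n :: nat where "n \<equiv> length t"

text \<open>The code of an event is its position plus one; 0 is no event.\<close>

definition ev :: "nat \<Rightarrow> event" where
  "ev u = t ! (u - 1)"

definition pr :: "nat \<Rightarrow> nat" where "pr u = proc (ev u)"
definition opc :: "nat \<Rightarrow> nat" where "opc u = op_code (oper (ev u))"
definition arg :: "nat \<Rightarrow> nat" where "arg u = op_arg (oper (ev u))"

definition XC :: "nat set" where
  "XC = {u. 1 \<le> u \<and> u \<le> n \<and> ev u \<in> X}"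

text \<open>All tables are values of \<open>latest\<close>, because such a value is what a
  left-to-right scan maintains: a further event overwrites the entry exactly if it satisfies the
  predicate. The value 0 for a failed search agrees with code 0 for no event.\<close>

definition chain_prev :: "nat \<Rightarrow> nat" where
  "chain_prev u = latest (\<lambda>v. v \<in> XC \<and> pr v = pr u) (u - 1)"

definition chain_next :: "nat \<Rightarrow> nat" where
  "chain_next u = latest (\<lambda>v. v \<in> XC \<and> chain_prev v = u) n"

definition observed :: "nat \<Rightarrow> nat" where
  "observed u = latest (\<lambda>w. opc w = 0 \<and> arg w = arg u) (u - 1)"

definition last_reader :: "nat \<Rightarrow> nat \<Rightarrow> nat" where
  "last_reader w m = latest (\<lambda>r. r \<in> XC \<and> opc r = 1 \<and> pr r = m \<and> observed r = w) n"

text \<open>Matching is specified forwards, from an acquire to its earliest later release. The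
  backward search gives the same partner in a trace, where critical sections on one lock do not
  overlap; it can be answered during a single scan.\<close>

definition acquire_of :: "nat \<Rightarrow> nat" where
  "acquire_of u = latest (\<lambda>a. opc a = 2 \<and> arg a = arg u) (u - 1)"

text \<open>Only releases in \<open>X\<close> count, so the value is 0 for an acquire that is
  unmatched in \<open>X\<close>; lock-closedness says nothing about such an acquire.\<close>

definition release_of :: "nat \<Rightarrow> nat" where
  "release_of a = latest (\<lambda>r. r \<in> XC \<and> opc r = 3 \<and> acquire_of r = a) n"

lemma opc_iff:
  "opc u = 0 \<longleftrightarrow> is_write (ev u)"
  "opc u = Suc 0 \<longleftrightarrow> is_read (ev u)"
  "opc u = 2 \<longleftrightarrow> is_acquire (ev u)"
  "opc u = 3 \<longleftrightarrow> is_release (ev u)"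
  by (simp_all add: opc_def op_code_iff)

lemma distinct: "distinct t"
  using trace by (simp add: trace_def event_sequence_def)

lemma ev_inj: "u \<in> {1..n} \<Longrightarrow> v \<in> {1..n} \<Longrightarrow> ev u = ev v \<longleftrightarrow> u = v"
  using distinct by (auto simp: ev_def nth_eq_iff_index_eq)

lemma ev_in_set: "u \<in> {1..n} \<Longrightarrow> ev u \<in> set t"
  by (auto simp: ev_def)

lemma ev_surj:
  assumes "e \<in> set t"
  obtains u where "u \<in> {1..n}" "e = ev u"
proof -
  from assms obtain i where "i < n" "t ! i = e" by (auto simp: in_set_conv_nth)
  then show ?thesis by (intro that[of "Suc i"]) (auto simp: ev_def)
qed

lemma XC_range: "u \<in> XC \<Longrightarrow> u \<in> {1..n}"
  by (simp add: XC_def)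

lemma XC_iff: "u \<in> {1..n} \<Longrightarrow> u \<in> XC \<longleftrightarrow> ev u \<in> X"
  by (simp add: XC_def)

lemma X_subset: "X \<subseteq> set t"
  using feasible by (simp add: feasible_def)

lemma X_surj:
  assumes "e \<in> X"
  obtains u where "u \<in> XC" "e = ev u"
  using assms X_subset ev_surj XC_iff by (metis subsetD)

lemma before_ev:
  assumes "u \<in> {1..n}" "v \<in> {1..n}"
  shows "before t (ev u) (ev v) \<longleftrightarrow> u < v"
proof
  assume "before t (ev u) (ev v)"
  then obtain i j where "i < j" "j < n" "t ! i = ev u" "t ! j = ev v"
    by (auto simp: before_def)
  then have "ev (Suc i) = ev u" "ev (Suc j) = ev v" by (simp_all add: ev_def)
  then have "Suc i = u" "Suc j = v" using assms ev_inj[of "Suc i" u] ev_inj[of "Suc j" v]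
    \<open>i < j\<close> \<open>j < n\<close> by auto
  then show "u < v" using \<open>i < j\<close> by simp
next
  assume "u < v"
  then show "before t (ev u) (ev v)" using assms
    unfolding before_def ev_def by (intro exI[of _ "u - 1"] exI[of _ "v - 1"]) auto
qed

lemma program_order_ev:
  assumes "u \<in> {1..n}" "v \<in> {1..n}"
  shows "(ev u, ev v) \<in> program_order t \<longleftrightarrow> u \<le> v \<and> pr u = pr v"
  using assms by (auto simp: program_order_def before_ev pr_def ev_inj ev_in_set Id_on_iff)

lemma pr_less: "u \<in> {1..n} \<Longrightarrow> pr u < k"
  using bounded ev_in_set unfolding bounded_names_def pr_def by blast

lemma chain_prev_XC: "chain_prev u \<noteq> 0 \<Longrightarrow> chain_prev u \<in> XC \<and> pr (chain_prev u) = pr u \<and> chain_prev u < u"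
  using latest_sat[of "\<lambda>v. v \<in> XC \<and> pr v = pr u" "u - 1"]
    latest_le[of "\<lambda>v. v \<in> XC \<and> pr v = pr u" "u - 1"]
  by (auto simp: chain_prev_def)

lemma chain_prev_ge: "v \<in> XC \<Longrightarrow> pr v = pr u \<Longrightarrow> v < u \<Longrightarrow> v \<le> chain_prev u"
  unfolding chain_prev_def by (intro latest_ge) (auto simp: XC_def)

text \<open>\<open>chain_prev\<close> is injective where it is nonzero: for \<open>u < v\<close> in
  one chain, \<open>chain_prev v\<close> is at least \<open>u\<close> and hence above
  \<open>chain_prev u\<close>. So the search in \<open>chain_next\<close> has a single
  candidate.\<close>

lemma nxt_chain_prev:
  assumes "u \<in> XC" "chain_prev u \<noteq> 0"
  shows "chain_next (chain_prev u) = u"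
  unfolding chain_next_def
proof (rule latest_eqI)
  show "u \<in> XC \<and> chain_prev u = chain_prev u" using assms by simp
  show "0 < u" "u \<le> n" using assms by (auto simp: XC_def)
  fix v assume v: "u < v" "v \<le> n"
  show "\<not> (v \<in> XC \<and> chain_prev v = chain_prev u)"
  proof
    assume a: "v \<in> XC \<and> chain_prev v = chain_prev u"
    then have "pr u = pr v" using chain_prev_XC assms by metis
    then have "u \<le> chain_prev v" using assms v by (intro chain_prev_ge)
    moreover have "chain_prev u < u" using assms chain_prev_XC by blast
    ultimately show False using a by simp
  qed
qed

lemma chain_next_XC:
  assumes "chain_next u \<noteq> 0" "u \<noteq> 0"
  shows "chain_next u \<in> XC \<and> pr (chain_next u) = pr u \<and> u < chain_next u"
  using latest_sat[of "\<lambda>v. v \<in> XC \<and> chain_prev v = u" n] assms chain_prev_XC[of "chain_next u"]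
  by (auto simp: chain_next_def)

text \<open>The first trace condition makes the search succeed, and the maximality of
  \<open>latest\<close> then identifies its result with the definite description in
  \<open>observation\<close>.\<close>

lemma read_observed:
  assumes r: "r \<in> {1..n}" "opc r = 1"
  shows "observed r \<in> {1..n}" "observed r < r" "opc (observed r) = 0" "arg (observed r) = arg r"
    and "observation t (ev r) = ev (observed r)"
proof -
  have rd: "is_read (ev r)" using r by (simp add: opc_iff)
  from trace rd r obtain w where w: "w \<in> set t" "is_write w" "loc w = loc (ev r)"
    "before t w (ev r)" unfolding trace_def using ev_in_set by blast
  from w obtain u where u: "u \<in> {1..n}" "w = ev u" using ev_surj by blast
  then have "u < r" "opc u = 0" "arg u = arg r"
    using w r rd by (auto simp: before_ev opc_iff arg_def loc_eq_iff)
  then have "u \<le> observed r" using u unfolding observed_def by (intro latest_ge) auto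
  then have nz: "observed r \<noteq> 0" using u by auto
  show lt: "observed r < r" using latest_le[of _ "r - 1"] r
    unfolding observed_def by (metis (no_types, lifting) atLeastAtMost_iff diff_less le_trans less_one not_le)
  then show rg: "observed r \<in> {1..n}" using nz r by auto
  show op: "opc (observed r) = 0" "arg (observed r) = arg r"
    using nz latest_sat[of "\<lambda>w. opc w = 0 \<and> arg w = arg r" "r - 1"] by (auto simp: observed_def)
  have ew: "ev u \<in> earlier_writes t (ev r) \<longleftrightarrow> u < r \<and> opc u = 0 \<and> arg u = arg r"
    if "u \<in> {1..n}" for u
    using that r rd by (auto simp: earlier_writes_def before_ev opc_iff arg_def loc_eq_iff ev_in_set)
  have last: "before t w' (ev (observed r))"
    if w': "w' \<in> earlier_writes t (ev r)" "w' \<noteq> ev (observed r)" for w'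
  proof -
    obtain v where v: "v \<in> {1..n}" "w' = ev v"
      using w' ev_surj[of w'] unfolding earlier_writes_def by (metis (lifting) mem_Collect_eq)
    then have "v \<le> observed r" using w' ew unfolding observed_def by (intro latest_ge) auto
    then have "v < observed r" using v w' by (cases "v = observed r") auto
    then show ?thesis using v rg by (simp add: before_ev)
  qed
  show "observation t (ev r) = ev (observed r)"
    unfolding observation_def
  proof (rule the_equality)
    show "ev (observed r) \<in> earlier_writes t (ev r) \<and>
      (\<forall>w'\<in>earlier_writes t (ev r) - {ev (observed r)}. before t w' (ev (observed r)))"
      using ew[OF rg] lt op last by auto
  next
    fix w assume w: "w \<in> earlier_writes t (ev r) \<and>
      (\<forall>w'\<in>earlier_writes t (ev r) - {w}. before t w' w)"
    then obtain v where v: "v \<in> {1..n}" "w = ev v"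
      using ev_surj unfolding earlier_writes_def by blast
    show "w = ev (observed r)"
    proof (rule ccontr)
      assume ne: "w \<noteq> ev (observed r)"
      then have "before t w (ev (observed r))" using last w by blast
      moreover have "before t (ev (observed r)) w" using w ne ew[OF rg] lt op by auto
      ultimately show False using v rg by (auto simp: before_ev)
    qed
  qed
qed

lemma observed_XC: "r \<in> XC \<Longrightarrow> opc r = 1 \<Longrightarrow> observed r \<in> XC"
  using read_observed[OF XC_range, of r] feasible XC_iff[of "observed r"]
  unfolding feasible_def XC_def opc_iff by (metis (lifting) One_nat_def mem_Collect_eq opc_iff(2))

lemma last_reader_props:
  assumes "last_reader w m \<noteq> 0"
  shows "last_reader w m \<in> XC" "opc (last_reader w m) = 1" "pr (last_reader w m) = m" "observed (last_reader w m) = w"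
  using latest_sat[of "\<lambda>r. r \<in> XC \<and> opc r = 1 \<and> pr r = m \<and> observed r = w" n] assms
  by (auto simp: last_reader_def)

lemma last_reader_ge: "r \<in> XC \<Longrightarrow> opc r = 1 \<Longrightarrow> r \<le> last_reader (observed r) (pr r)"
  unfolding last_reader_def by (intro latest_ge) (auto simp: XC_def)

text \<open>On codes the earliest later release is the minimum of a finite set of numbers, which
  evaluates the definite description.\<close>

lemma match_acquire_ev:
  assumes a: "a \<in> {1..n}" "opc a = 2" and r: "r \<in> {1..n}"
    and m: "match_acquire t (ev a) = Some (ev r)"
  shows "opc r = 3 \<and> arg r = arg a \<and> a < r"
proof -
  have acq: "is_acquire (ev a)" using a by (simp add: opc_iff)
  let ?L = "later_releases t (ev a)"
  define S where "S = {r \<in> {1..n}. opc r = 3 \<and> arg r = arg a \<and> a < r}"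
  have L: "ev r \<in> ?L \<longleftrightarrow> r \<in> S" if "r \<in> {1..n}" for r
    using that a acq
    by (auto simp: later_releases_def S_def before_ev opc_iff arg_def loc_eq_iff ev_in_set)
  have L2: "\<exists>u. u \<in> S \<and> e = ev u" if "e \<in> ?L" for e
    using that L ev_surj unfolding later_releases_def by (metis (lifting) mem_Collect_eq)
  have ne: "?L \<noteq> {}" using m by (auto simp: match_acquire_def)
  then have Sne: "S \<noteq> {}" using L2 by blast
  have fin: "finite S" by (simp add: S_def)
  define r0 where "r0 = Min S"
  have r0: "r0 \<in> S" using fin Sne by (simp add: r0_def)
  have r0': "r0 \<in> {1..n}" using r0 by (simp add: S_def)
  have min: "r0 \<le> r" if "r \<in> S" for r using that fin by (simp add: r0_def)
  have first: "before t (ev r0) \<rho>" if "\<rho> \<in> ?L" "\<rho> \<noteq> ev r0" for \<rho>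
  proof -
    obtain u where u: "u \<in> S" "\<rho> = ev u" using L2 \<open>\<rho> \<in> ?L\<close> by blast
    then have "r0 < u" using min[OF u(1)] that by (cases "u = r0") auto
    then show ?thesis using u r0' by (auto simp: before_ev S_def)
  qed
  have the: "(THE \<rho>. \<rho> \<in> ?L \<and> (\<forall>\<rho>' \<in> ?L - {\<rho>}. before t \<rho> \<rho>')) = ev r0"
  proof (rule the_equality)
    show "ev r0 \<in> ?L \<and> (\<forall>\<rho>' \<in> ?L - {ev r0}. before t (ev r0) \<rho>')"
      using r0 r0' L first by auto
    fix \<rho> assume \<rho>: "\<rho> \<in> ?L \<and> (\<forall>\<rho>' \<in> ?L - {\<rho>}. before t \<rho> \<rho>')"
    show "\<rho> = ev r0"
    proof (rule ccontr)
      assume n: "\<rho> \<noteq> ev r0"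
      then have 1: "before t (ev r0) \<rho>" using first \<rho> by blast
      have 2: "before t \<rho> (ev r0)" using \<rho> n r0 r0' L by blast
      obtain v where "v \<in> {1..n}" "\<rho> = ev v" using \<rho> L2 S_def by blast
      then show False using 1 2 r0' by (auto simp: before_ev)
    qed
  qed
  then have "ev r0 = ev r" using m ne by (simp add: match_acquire_def)
  then have "r0 = r" using r0' r ev_inj by blast
  then show ?thesis using r0 by (auto simp: S_def)
qed

text \<open>Another acquire of the same lock strictly between \<open>a\<close> and \<open>r\<close>
  would, by the second trace condition, have to come after the match of \<open>a\<close>, which is
  \<open>r\<close> itself.\<close>

lemma matched_acquire_of:
  assumes a: "a \<in> {1..n}" "opc a = 2" and r: "r \<in> {1..n}"
    and m: "match_acquire t (ev a) = Some (ev r)"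
  shows "acquire_of r = a"
  unfolding acquire_of_def
proof (rule latest_eqI)
  have *: "opc r = 3 \<and> arg r = arg a \<and> a < r" using match_acquire_ev assms by blast
  show "opc a = 2 \<and> arg a = arg r" "0 < a" "a \<le> r - 1" using a * by auto
  fix v assume v: "a < v" "v \<le> r - 1"
  have vr: "v \<in> {1..n}" "v < r" using v r by auto
  show "\<not> (opc v = 2 \<and> arg v = arg r)"
  proof
    assume "opc v = 2 \<and> arg v = arg r"
    then have "is_acquire (ev v)" "is_acquire (ev a)" "loc (ev a) = loc (ev v)"
      "before t (ev a) (ev v)"
      using a * vr v by (auto simp: opc_iff arg_def loc_eq_iff before_ev)
    then obtain \<rho> where "match_acquire t (ev a) = Some \<rho>" "before t \<rho> (ev v)"
      using trace ev_in_set a vr unfolding trace_def by blast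
    then show False using m vr r by (auto simp: before_ev)
  qed
qed

lemma release_acquire_of:
  assumes r: "r \<in> {1..n}" "opc r = 3"
  shows "acquire_of r \<in> {1..n}" "opc (acquire_of r) = 2" "match_release t (ev r) = ev (acquire_of r)"
    "match_acquire t (ev (acquire_of r)) = Some (ev r)"
proof -
  have "\<exists>a \<in> set t. is_acquire a \<and> match_acquire t a = Some (ev r)"
    using trace r ev_in_set unfolding trace_def event_sequence_def opc_iff by blast
  then obtain a where "a \<in> {1..n}" "is_acquire (ev a)" "match_acquire t (ev a) = Some (ev r)"
    using ev_surj by metis
  then have a: "a \<in> {1..n}" "opc a = 2" "match_acquire t (ev a) = Some (ev r)"
    by (auto simp: opc_iff)
  then have eq: "acquire_of r = a" using matched_acquire_of r by blast
  show "acquire_of r \<in> {1..n}" "opc (acquire_of r) = 2" "match_acquire t (ev (acquire_of r)) = Some (ev r)"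
    using a eq by auto
  show "match_release t (ev r) = ev (acquire_of r)"
    unfolding match_release_def
  proof (rule the_equality)
    show "ev (acquire_of r) \<in> set t \<and> is_acquire (ev (acquire_of r)) \<and> match_acquire t (ev (acquire_of r)) = Some (ev r)"
      using a eq ev_in_set by (auto simp: opc_iff)
    fix b assume b: "b \<in> set t \<and> is_acquire b \<and> match_acquire t b = Some (ev r)"
    then obtain u where u: "u \<in> {1..n}" "b = ev u" using ev_surj by blast
    then have "acquire_of r = u" using matched_acquire_of[of u r] r b by (auto simp: opc_iff)
    then show "b = ev (acquire_of r)" using u by simp
  qed
qed

lemma acquire_of_XC: "r \<in> XC \<Longrightarrow> opc r = 3 \<Longrightarrow> acquire_of r \<in> XC"
  using release_acquire_of[OF XC_range, of r] feasible XC_iff[of "acquire_of r"]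
  unfolding feasible_def XC_def opc_iff(4) by (metis (lifting) mem_Collect_eq opc_iff(4))

lemma release_of_props:
  assumes "release_of a \<noteq> 0"
  shows "release_of a \<in> XC" "opc (release_of a) = 3" "acquire_of (release_of a) = a"
  using latest_sat[of "\<lambda>r. r \<in> XC \<and> opc r = 3 \<and> acquire_of r = a" n] assms
  by (auto simp: release_of_def)

text \<open>\<open>match_acquire\<close> is a function, so two releases with the same acquire
  coincide.\<close>

lemma mr_acquire_of:
  assumes r: "r \<in> XC" "opc r = 3"
  shows "release_of (acquire_of r) = r"
  unfolding release_of_def
proof (rule latest_eqI)
  show "r \<in> XC \<and> opc r = 3 \<and> acquire_of r = acquire_of r" "0 < r" "r \<le> n" using r by (auto simp: XC_def)
  fix v assume "r < v" "v \<le> n"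
  show "\<not> (v \<in> XC \<and> opc v = 3 \<and> acquire_of v = acquire_of r)"
  proof
    assume "v \<in> XC \<and> opc v = 3 \<and> acquire_of v = acquire_of r"
    then have "ev v = ev r"
      using release_acquire_of(4)[of v] release_acquire_of(4)[of r] r XC_range by auto
    then show False using ev_inj[of v r] \<open>r < v\<close> r \<open>v \<le> n\<close> XC_range by auto
  qed
qed

section \<open>Saturated relations on codes\<close>

text \<open>All pairs are forced if \<open>P\<close> has no closed refinement.\<close>

definition forced :: "nat rel" where
  "forced = {(u, v) \<in> XC \<times> XC. \<forall>Q. closed_refinement t X P Q \<longrightarrow> (ev u, ev v) \<in> Q}"

lemma forced_XC: "(u, v) \<in> forced \<Longrightarrow> u \<in> XC \<and> v \<in> XC"
  by (auto simp: forced_def)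

lemma forced_refl: "u \<in> XC \<Longrightarrow> (u, u) \<in> forced"
  unfolding forced_def closed_refinement_def partial_order_on_def preorder_on_def refl_on_def
  by (auto simp: XC_def)

lemma forced_trans: "(u, v) \<in> forced \<Longrightarrow> (v, w) \<in> forced \<Longrightarrow> (u, w) \<in> forced"
  unfolding forced_def closed_refinement_def partial_order_on_def preorder_on_def
  by (auto dest: transD)

lemma forced_po:
  assumes "u \<in> XC" "v \<in> XC" "u \<le> v" "pr u = pr v"
  shows "(u, v) \<in> forced"
proof -
  have "(ev u, ev v) \<in> program_order t \<inter> X \<times> X"
    using assms XC_range[of u] XC_range[of v] program_order_ev[of u v] by (simp add: XC_def)
  then show ?thesis using assms
    unfolding forced_def closed_refinement_def trace_closed_def respects_trace_def refines_def
    by auto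
qed

lemma forced_P:
  "u \<in> XC \<Longrightarrow> v \<in> XC \<Longrightarrow> (ev u, ev v) \<in> P \<Longrightarrow> (u, v) \<in> forced"
  unfolding forced_def closed_refinement_def refines_def by auto

text \<open>First half of observation-closedness. That condition excludes the observed write itself,
  and for it the claim is reflexivity.\<close>

lemma forced_observed:
  assumes wr: "(w, r) \<in> forced" "opc w = 0" "opc r = 1" "arg w = arg r"
  shows "(w, observed r) \<in> forced"
proof (cases "w = observed r")
  case True
  then show ?thesis using forced_refl forced_XC wr by blast
next
  case False
  have X: "w \<in> XC" "r \<in> XC" "observed r \<in> XC" using forced_XC wr observed_XC by auto
  have o: "observation t (ev r) = ev (observed r)" using read_observed X XC_range wr by blast
  have c: "conflicting (ev w) (ev r)" "is_write (ev w)" "is_read (ev r)" "ev w \<noteq> ev r"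
    using wr X XC_range by (auto simp: conflicting_def opc_iff arg_def loc_eq_iff
       is_write_def is_read_def)
  have ne: "ev w \<noteq> ev (observed r)" using False ev_inj[OF XC_range XC_range] X by blast
  have "(ev w, ev (observed r)) \<in> Q" if Q: "closed_refinement t X P Q" for Q
  proof -
    have "slt Q (ev w) (ev r)" using Q wr c by (auto simp: slt_def forced_def)
    moreover have "observation_closed t X Q"
      using Q by (auto simp: closed_refinement_def trace_closed_def)
    ultimately have "slt Q (ev w) (ev (observed r))"
      using X c ne o XC_iff XC_range unfolding observation_closed_def Let_def
      by (metis Diff_iff singletonD)
    then show ?thesis by (simp add: slt_def)
  qed
  then show ?thesis using X by (auto simp: forced_def)
qed

text \<open>Second half of observation-closedness, applied to a single reader per chain; earlier
  readers in the chain follow by program order.\<close>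

lemma forced_last_reader:
  assumes ww: "(w, w') \<in> forced" "opc w = 0" "opc w' = 0" "arg w = arg w'" "w \<noteq> w'"
    and nz: "last_reader w m \<noteq> 0"
  shows "(last_reader w m, w') \<in> forced"
proof -
  define r where "r = last_reader w m"
  have r: "r \<in> XC" "opc r = 1" "observed r = w" using last_reader_props[OF nz] by (auto simp: r_def)
  have X: "w \<in> XC" "w' \<in> XC" using forced_XC ww by auto
  have o: "observation t (ev r) = ev w" "arg w = arg r" using read_observed XC_range r by blast+
  have c: "conflicting (ev w') (ev r)" "is_write (ev w')" "is_read (ev r)" "ev w' \<noteq> ev r"
    using ww o r X XC_range by (auto simp: conflicting_def opc_iff arg_def loc_eq_iff
       is_write_def is_read_def)
  have ne: "ev w \<noteq> ev w'" using ww ev_inj[OF XC_range XC_range] X by blast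
  have "(ev r, ev w') \<in> Q" if Q: "closed_refinement t X P Q" for Q
  proof -
    have "slt Q (ev w) (ev w')" using Q ww ne by (auto simp: slt_def forced_def)
    moreover have "observation_closed t X Q"
      using Q by (auto simp: closed_refinement_def trace_closed_def)
    ultimately have "slt Q (ev r) (ev w')"
      using X c ne o r XC_iff XC_range unfolding observation_closed_def Let_def
      by (metis Diff_iff singletonD)
    then show ?thesis by (simp add: slt_def)
  qed
  then show ?thesis using X r by (auto simp: forced_def r_def)
qed

text \<open>The two inequalities on \<open>release_of a\<close> say that the matching release lies
  in \<open>X\<close> and differs from \<open>r\<close>, which is what lock-closedness asks of its
  two releases.\<close>

lemma forced_lock:
  assumes ar: "(a, r) \<in> forced" "opc a = 2" "opc r = 3" "arg a = arg r"
    and nz: "release_of a \<noteq> 0" "release_of a \<noteq> r"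
  shows "(release_of a, acquire_of r) \<in> forced"
proof -
  define r1 where "r1 = release_of a"
  have r1: "r1 \<in> XC" "opc r1 = 3" "acquire_of r1 = a" using release_of_props[OF nz(1)] by (auto simp: r1_def)
  have X: "a \<in> XC" "r \<in> XC" "acquire_of r \<in> XC" using forced_XC ar acquire_of_XC by auto
  have m: "match_release t (ev r) = ev (acquire_of r)" "match_release t (ev r1) = ev a"
    using release_acquire_of XC_range r1 X ar by auto
  have "arg r1 = arg a" using match_acquire_ev[of a r1] release_acquire_of(4)[of r1] r1 X ar XC_range by auto
  then have c: "is_release (ev r)" "is_release (ev r1)" "loc (ev r1) = loc (ev r)" "ev r1 \<noteq> ev r"
    using ar r1 X nz ev_inj[OF XC_range XC_range, of r1 r]
    by (auto simp: opc_iff arg_def loc_eq_iff r1_def)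
  have "(ev r1, ev (acquire_of r)) \<in> Q" if Q: "closed_refinement t X P Q" for Q
  proof -
    have "lock_closed t X Q" "(ev a, ev r) \<in> Q"
      using Q ar by (auto simp: closed_refinement_def trace_closed_def forced_def)
    then show ?thesis using X r1 c m XC_iff XC_range unfolding lock_closed_def by metis
  qed
  then show ?thesis using X r1 by (auto simp: forced_def r1_def)
qed

text \<open>These are the properties that the queue can guarantee when it is empty. The clause on
  (u, v) and (v, w) is a disjunction because it depends on which of the two pairs was processed
  last. It is limited to changes of chain; the remaining cases are left to the chain clauses and
  antisymmetry.\<close>

definition saturated :: "nat rel \<Rightarrow> bool" where
  "saturated M \<longleftrightarrow>
     M \<subseteq> XC \<times> XC \<and>
     (\<forall>u \<in> XC. (u, u) \<in> M) \<and>
     (\<forall>u \<in> XC. \<forall>j<k. \<forall>f. E (ev u) j = Some f \<longrightarrow> (\<exists>v. f = ev v \<and> (u, v) \<in> M)) \<and>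
     (\<forall>u v. (u, v) \<in> M \<longrightarrow> chain_prev u \<noteq> 0 \<longrightarrow> (chain_prev u, v) \<in> M) \<and>
     (\<forall>u v. (u, v) \<in> M \<longrightarrow> chain_next v \<noteq> 0 \<longrightarrow> (u, chain_next v) \<in> M) \<and>
     (\<forall>u v w. (u, v) \<in> M \<longrightarrow> (v, w) \<in> M \<longrightarrow> pr u \<noteq> pr v \<longrightarrow> pr v \<noteq> pr w \<longrightarrow>
        (\<exists>w'\<le>w. pr w' = pr w \<and> (u, w') \<in> M) \<or> (\<exists>u'\<ge>u. pr u' = pr u \<and> (u', w) \<in> M)) \<and>
     (\<forall>w r. (w, r) \<in> M \<longrightarrow> opc w = 0 \<longrightarrow> opc r = 1 \<longrightarrow> arg w = arg r \<longrightarrow> (w, observed r) \<in> M) \<and>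
     (\<forall>w w' m. (w, w') \<in> M \<longrightarrow> opc w = 0 \<longrightarrow> opc w' = 0 \<longrightarrow> arg w = arg w' \<longrightarrow> w \<noteq> w' \<longrightarrow>
        m < k \<longrightarrow> last_reader w m \<noteq> 0 \<longrightarrow> (last_reader w m, w') \<in> M) \<and>
     (\<forall>a r. (a, r) \<in> M \<longrightarrow> opc a = 2 \<longrightarrow> opc r = 3 \<longrightarrow> arg a = arg r \<longrightarrow> release_of a \<noteq> 0 \<longrightarrow>
        release_of a \<noteq> r \<longrightarrow> (release_of a, acquire_of r) \<in> M)"

definition decode :: "nat rel \<Rightarrow> event rel" where
  "decode M = {(ev u, ev v) |u v. (u, v) \<in> M}"

lemma decode_iff:
  assumes "M \<subseteq> XC \<times> XC" "u \<in> XC" "v \<in> XC"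
  shows "(ev u, ev v) \<in> decode M \<longleftrightarrow> (u, v) \<in> M"
proof
  assume "(ev u, ev v) \<in> decode M"
  then obtain u' v' where *: "ev u = ev u'" "ev v = ev v'" "(u', v') \<in> M"
    by (auto simp: decode_def)
  then have "u' \<in> XC" "v' \<in> XC" using assms(1) by auto
  then have "u = u'" "v = v'" using * assms ev_inj XC_range by blast+
  then show "(u, v) \<in> M" using * by simp
qed (auto simp: decode_def)

lemma no_closed_refinement:
  assumes "M \<subseteq> forced" "(u, v) \<in> M" "(v, u) \<in> M" "u \<noteq> v"
  shows "\<not> closed_refinement t X P Q"
proof
  assume Q: "closed_refinement t X P Q"
  then have "(ev u, ev v) \<in> Q" "(ev v, ev u) \<in> Q" "ev u \<noteq> ev v"
    using assms ev_inj[OF XC_range XC_range] by (auto simp: forced_def)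
  moreover have "antisym Q"
    using Q by (simp add: closed_refinement_def partial_order_on_def)
  ultimately show False by (auto dest: antisymD)
qed

text \<open>Walks back from \<open>v\<close> along \<open>chain_prev\<close>. Each step is a
  covering edge, since an event strictly between would be a later candidate for
  \<open>chain_prev\<close>.\<close>

lemma chain_path:
  assumes "u \<in> XC" "v \<in> XC" "u \<le> v" "pr u = pr v"
  shows "(ev u, ev v) \<in> (chain_edges t X)\<^sup>*"
  using assms(2-)
proof (induction v rule: less_induct)
  case (less v)
  show ?case
  proof (cases "u = v")
    case False
    then have le: "u \<le> chain_prev v" using chain_prev_ge less assms(1) by auto
    then have "chain_prev v \<noteq> 0" using assms(1) by (auto simp: XC_def)
    then have p: "chain_prev v \<in> XC" "pr (chain_prev v) = pr v" "chain_prev v < v" using chain_prev_XC by auto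
    then have "(ev u, ev (chain_prev v)) \<in> (chain_edges t X)\<^sup>*" using less le by auto
    moreover have "(ev (chain_prev v), ev v) \<in> chain_edges t X"
    proof -
      have "slt (program_order t) (ev (chain_prev v)) (ev v)"
        using p less.prems XC_range[of v] XC_range[of "chain_prev v"]
        by (auto simp: slt_def program_order_ev ev_inj)
      moreover have False
        if "g \<in> X" "slt (program_order t) (ev (chain_prev v)) g" "slt (program_order t) g (ev v)" for g
      proof -
        obtain x where x: "x \<in> XC" "g = ev x" using X_surj[OF \<open>g \<in> X\<close>] by metis
        have r: "x \<in> {1..n}" "v \<in> {1..n}" "chain_prev v \<in> {1..n}" using x p less.prems XC_range by auto
        have "chain_prev v < x" "x < v" "pr x = pr v"
          using that x(2) r by (auto simp: slt_def program_order_ev ev_inj nat_less_le)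
        then show False using chain_prev_ge x by fastforce
      qed
      ultimately show ?thesis
        using p less.prems by (auto simp: chain_edges_def XC_def)
    qed
    ultimately show ?thesis by simp
  qed auto
qed

section \<open>A saturated antisymmetric relation represents a closed refinement\<close>

context
  fixes M :: "nat rel"
  assumes sat: "saturated M" and anti: "antisym M"
begin

lemma M_XC: "(u, v) \<in> M \<Longrightarrow> u \<in> XC \<and> v \<in> XC"
  using sat by (auto simp: saturated_def)

lemma M_sub: "M \<subseteq> XC \<times> XC"
  using M_XC by auto

lemma M_refl: "u \<in> XC \<Longrightarrow> (u, u) \<in> M"
  using sat by (auto simp: saturated_def)

lemma M_chain_prev: "(u, v) \<in> M \<Longrightarrow> chain_prev u \<noteq> 0 \<Longrightarrow> (chain_prev u, v) \<in> M"
  using sat unfolding saturated_def by presburger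

lemma M_chain_next: "(u, v) \<in> M \<Longrightarrow> chain_next v \<noteq> 0 \<Longrightarrow> (u, chain_next v) \<in> M"
  using sat unfolding saturated_def by presburger

lemma M_observed:
  "(w, r) \<in> M \<Longrightarrow> opc w = 0 \<Longrightarrow> opc r = 1 \<Longrightarrow> arg w = arg r \<Longrightarrow> (w, observed r) \<in> M"
  using sat unfolding saturated_def by presburger

lemma M_last_reader:
  "(w, w') \<in> M \<Longrightarrow> opc w = 0 \<Longrightarrow> opc w' = 0 \<Longrightarrow> arg w = arg w' \<Longrightarrow> w \<noteq> w' \<Longrightarrow>
     m < k \<Longrightarrow> last_reader w m \<noteq> 0 \<Longrightarrow> (last_reader w m, w') \<in> M"
  using sat unfolding saturated_def by presburger

lemma M_lock:
  "(a, r) \<in> M \<Longrightarrow> opc a = 2 \<Longrightarrow> opc r = 3 \<Longrightarrow> arg a = arg r \<Longrightarrow> release_of a \<noteq> 0 \<Longrightarrow>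
     release_of a \<noteq> r \<Longrightarrow> (release_of a, acquire_of r) \<in> M"
  using sat unfolding saturated_def by presburger

text \<open>Saturation offers only single steps to the next event of a chain; the induction iterates
  them, going back from \<open>w\<close> to \<open>v\<close>.\<close>

lemma M_right:
  assumes "(u, v) \<in> M" "w \<in> XC" "v \<le> w" "pr v = pr w"
  shows "(u, w) \<in> M"
  using assms(2-)
proof (induction w rule: less_induct)
  case (less w)
  show ?case
  proof (cases "v = w")
    case False
    then have le: "v \<le> chain_prev w" using chain_prev_ge less M_XC assms(1) by auto
    then have nz: "chain_prev w \<noteq> 0" using assms(1) M_XC[of u v] by (auto simp: XC_def)
    then have "(u, chain_prev w) \<in> M" using less le chain_prev_XC[OF nz] by auto
    moreover have "w \<noteq> 0" using less.prems by (auto simp: XC_def)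
    ultimately show ?thesis using M_chain_next[of u "chain_prev w"] nxt_chain_prev[OF less.prems(1) nz] by simp
  qed (use assms in auto)
qed

lemma M_left:
  assumes "(v, w) \<in> M" "u \<in> XC" "u \<le> v" "pr u = pr v"
  shows "(u, w) \<in> M"
  using assms(1,3-)
proof (induction v rule: less_induct)
  case (less v)
  show ?case
  proof (cases "u = v")
    case False
    then have le: "u \<le> chain_prev v" using chain_prev_ge less assms(2) by auto
    then have nz: "chain_prev v \<noteq> 0" using assms(2) by (auto simp: XC_def)
    then have "(chain_prev v, w) \<in> M" using less M_chain_prev by blast
    then show ?thesis using less le chain_prev_XC[OF nz] by auto
  qed (use less in auto)
qed

lemma M_po: "u \<in> XC \<Longrightarrow> v \<in> XC \<Longrightarrow> u \<le> v \<Longrightarrow> pr u = pr v \<Longrightarrow> (u, v) \<in> M"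
  using M_right M_refl by blast

text \<open>If \<open>v\<close> were earlier, program order would also put (v, u) into
  \<open>M\<close>, and antisymmetry would identify the two.\<close>

lemma M_same_chain: "(u, v) \<in> M \<Longrightarrow> pr u = pr v \<Longrightarrow> u \<le> v"
  using M_po M_XC anti by (metis antisymD linorder_linear)

lemma M_trans:
  assumes "(u, v) \<in> M" "(v, w) \<in> M"
  shows "(u, w) \<in> M"
proof -
  consider "pr u = pr v" | "pr v = pr w" | "pr u \<noteq> pr v" "pr v \<noteq> pr w" by blast
  then show ?thesis
  proof cases
    case 1
    then show ?thesis using assms M_same_chain M_left M_XC by blast
  next
    case 2
    then show ?thesis using assms M_same_chain M_right M_XC by blast
  next
    case 3
    \<comment> \<open>Both alternatives are at least as strong as the goal: (u, w') is moved forward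
      to \<open>w\<close> along its chain, and (u', w) is moved back to \<open>u\<close>.\<close>
    then have "(\<exists>w'\<le>w. pr w' = pr w \<and> (u, w') \<in> M) \<or> (\<exists>u'\<ge>u. pr u' = pr u \<and> (u', w) \<in> M)"
      using sat assms unfolding saturated_def by blast
    then show ?thesis using M_left M_right M_XC assms by metis
  qed
qed

lemma decode_order: "partial_order_on X (decode M)"
proof -
  have sub: "decode M \<subseteq> X \<times> X" using M_XC by (auto simp: decode_def XC_def)
  have "refl_on X (decode M)"
    unfolding refl_on_def
  proof
    fix e assume "e \<in> X"
    then obtain u where "u \<in> XC" "e = ev u" by (rule X_surj)
    then show "(e, e) \<in> decode M" using M_refl by (auto simp: decode_def)
  qed
  moreover have "trans (decode M)"
  proof (rule transI)
    fix x y z assume "(x, y) \<in> decode M" "(y, z) \<in> decode M"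
    then obtain u v v' w where "x = ev u" "y = ev v" "y = ev v'" "z = ev w"
      "(u, v) \<in> M" "(v', w) \<in> M" by (auto simp: decode_def)
    moreover from this have "v = v'" using ev_inj[OF XC_range XC_range] M_XC by metis
    ultimately show "(x, z) \<in> decode M" using M_trans[of u v w] by (auto simp: decode_def)
  qed
  moreover have "antisym (decode M)"
  proof (rule antisymI)
    fix x y assume xy: "(x, y) \<in> decode M" and yx: "(y, x) \<in> decode M"
    from xy obtain u v where "x = ev u" "y = ev v" "(u, v) \<in> M" by (auto simp: decode_def)
    moreover from yx obtain v' u' where "y = ev v'" "x = ev u'" "(v', u') \<in> M"
      by (auto simp: decode_def)
    moreover from calculation have "v = v'" "u = u'" using ev_inj[OF XC_range XC_range] M_XC by metis+
    ultimately show "x = y" using anti by (metis antisymD)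
  qed
  ultimately show ?thesis using sub by (simp add: partial_order_on_def preorder_on_def)
qed

lemma chain_edges_decode: "chain_edges t X \<subseteq> decode M"
proof
  fix p assume "p \<in> chain_edges t X"
  then obtain e f where ef: "p = (e, f)" "e \<in> X" "f \<in> X" "(e, f) \<in> program_order t"
    by (auto simp: chain_edges_def slt_def)
  from ef(2) obtain u where "u \<in> XC" "e = ev u" by (rule X_surj)
  moreover from ef(3) obtain v where "v \<in> XC" "f = ev v" by (rule X_surj)
  ultimately show "p \<in> decode M" using ef decode_iff[OF M_sub] M_po program_order_ev XC_range by metis
qed

text \<open>\<open>P\<close> is reachability over chain edges and stored edges. Both lie in
  \<open>decode M\<close>, which is already reflexive on \<open>X\<close> and transitive.\<close>

lemma P_decode: "P \<subseteq> decode M"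
proof
  fix p assume p: "p \<in> P"
  have P: "P = (chain_edges t X \<union> stored_edges E)\<^sup>* \<inter> (X \<times> X)"
    using repr by (simp add: represents_def)
  have "stored_edges E \<subseteq> decode M"
  proof
    fix q assume "q \<in> stored_edges E"
    then obtain e f j where q: "q = (e, f)" "E e j = Some f" by (auto simp: stored_edges_def)
    then have "e \<in> X" "j < k" using repr unfolding represents_def by blast+
    from \<open>e \<in> X\<close> obtain u where u: "u \<in> XC" "e = ev u" by (rule X_surj)
    have "\<forall>u \<in> XC. \<forall>j<k. \<forall>f. E (ev u) j = Some f \<longrightarrow> (\<exists>v. f = ev v \<and> (u, v) \<in> M)"
      using sat by (simp add: saturated_def)
    then obtain v where "f = ev v" "(u, v) \<in> M" using q u \<open>j < k\<close> by blast
    then show "q \<in> decode M" using q u by (auto simp: decode_def)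
  qed
  then have "(chain_edges t X \<union> stored_edges E)\<^sup>* \<subseteq> (decode M)\<^sup>*"
    using chain_edges_decode by (intro rtrancl_mono) auto
  also have "(decode M)\<^sup>* = (decode M)\<^sup>="
    using decode_order trancl_id rtrancl_trancl_reflcl
    unfolding partial_order_on_def preorder_on_def by metis
  finally have "p \<in> (decode M)\<^sup>=" "p \<in> X \<times> X" using p P by auto
  then show "p \<in> decode M"
    using decode_order by (auto simp: partial_order_on_def preorder_on_def refl_on_def)
qed

text \<open>Respecting a trace only demands the presence of pairs between distinct events, so it
  passes from \<open>P\<close> to every larger relation.\<close>

lemma decode_respects: "respects_trace t X (decode M)"
  using respects P_decode unfolding respects_trace_def refines_def slt_def by blast

lemma decode_observation_closed: "observation_closed t X (decode M)"
  unfolding observation_closed_def Let_def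
proof (intro ballI impI)
  fix e e' assume a: "e \<in> X" "is_read e" "e' \<in> X - {observation t e}"
    "is_write e' \<and> conflicting e' e"
  obtain r where r: "r \<in> XC" "e = ev r" using X_surj[OF a(1)] by metis
  obtain w' where w': "w' \<in> XC" "e' = ev w'" using X_surj[of e'] a(3) by (metis DiffD1)
  have or: "opc r = 1" "opc w' = 0" "arg w' = arg r" "e \<noteq> e'"
    using a r w' by (auto simp: opc_iff conflicting_def arg_def loc_eq_iff)
  define w where "w = observed r"
  have w: "w \<in> XC" "observation t e = ev w" "opc w = 0" "arg w = arg r"
    using observed_XC read_observed[OF XC_range] r or by (auto simp: w_def)
  have ne: "w \<noteq> w'" using a w w' by auto
  note iff = decode_iff[OF M_sub]
  have "slt (decode M) e' (observation t e)" if "slt (decode M) e' e"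
  proof -
    have "(w', w) \<in> M" using that or w' r iff[of w' r] M_observed[of w' r]
      by (simp add: slt_def w_def)
    then show ?thesis using w w' iff a by (auto simp: slt_def)
  qed
  moreover have "slt (decode M) e e'" if "slt (decode M) (observation t e) e'"
  proof -
    have ww: "(w, w') \<in> M" using that w w' iff by (auto simp: slt_def)
    \<comment> \<open>Saturation speaks only about the last reader of \<open>w\<close> in each
      chain; the given read \<open>r\<close> lies before it in its own chain, so
      \<open>M_left\<close> transfers the ordering to \<open>r\<close>.\<close>
    have le: "r \<le> last_reader w (pr r)" using last_reader_ge r or by (simp add: w_def)
    then have nz: "last_reader w (pr r) \<noteq> 0" using r by (auto simp: XC_def)
    have "pr r < k" using pr_less XC_range r by blast
    then have "(last_reader w (pr r), w') \<in> M" using M_last_reader[OF ww] nz w or ne by simp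
    then have "(r, w') \<in> M" using M_left[OF _ r(1) le] last_reader_props[OF nz] by simp
    then show ?thesis using r w' iff or by (auto simp: slt_def)
  qed
  ultimately show "(slt (decode M) e' e \<longrightarrow> slt (decode M) e' (observation t e)) \<and>
     (slt (decode M) (observation t e) e' \<longrightarrow> slt (decode M) e e')" by blast
qed

lemma decode_lock_closed: "lock_closed t X (decode M)"
  unfolding lock_closed_def
proof (intro ballI impI)
  fix e1 e2 assume a: "e1 \<in> X" "e2 \<in> X"
    "is_release e1 \<and> is_release e2 \<and> e1 \<noteq> e2 \<and> loc e1 = loc e2"
    "(match_release t e1, e2) \<in> decode M"
  obtain r1 where r1: "r1 \<in> XC" "e1 = ev r1" using X_surj[OF a(1)] by metis
  obtain r2 where r2: "r2 \<in> XC" "e2 = ev r2" using X_surj[OF a(2)] by metis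
  have o: "opc r1 = 3" "opc r2 = 3" "arg r1 = arg r2" "r1 \<noteq> r2"
    using a r1 r2 by (auto simp: opc_iff arg_def loc_eq_iff)
  have m: "match_release t e1 = ev (acquire_of r1)" "match_release t e2 = ev (acquire_of r2)"
    using release_acquire_of(3)[OF XC_range] r1 r2 o by simp_all
  have X: "acquire_of r1 \<in> XC" "acquire_of r2 \<in> XC" using acquire_of_XC r1 r2 o by simp_all
  have "match_acquire t (ev (acquire_of r1)) = Some (ev r1)" and am2: "opc (acquire_of r1) = 2"
    using release_acquire_of[OF XC_range[OF r1(1)] o(1)] by simp_all
  then have am: "arg (acquire_of r1) = arg r2"
    using match_acquire_ev[OF XC_range[OF X(1)] am2 XC_range[OF r1(1)]] o by simp
  \<comment> \<open>This makes the lock rule, stated for an acquire, produce exactly the given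
    release \<open>r1\<close>.\<close>
  have "release_of (acquire_of r1) = r1" "r1 \<noteq> 0" using mr_acquire_of r1 o by (auto simp: XC_def)
  moreover have "(acquire_of r1, r2) \<in> M" using a m X r2 decode_iff[OF M_sub] by metis
  ultimately have "(r1, acquire_of r2) \<in> M" using M_lock[of "acquire_of r1" r2] o am am2 by simp
  then show "(e1, match_release t e2) \<in> decode M" using m r1 by (auto simp: decode_def)
qed

lemma decode_closed_refinement: "closed_refinement t X P (decode M)"
  unfolding closed_refinement_def trace_closed_def refines_def
  using decode_order decode_respects decode_observation_closed decode_lock_closed P_decode by blast

lemma decode_is_closure: "M \<subseteq> forced \<Longrightarrow> is_closure t X P (decode M)"
  unfolding is_closure_def using decode_closed_refinement
  by (auto simp: decode_def forced_def)

section \<open>Sparse edge representation of the computed order\<close>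

definition edges_of :: "(nat \<Rightarrow> nat \<Rightarrow> nat) \<Rightarrow> edges" where
  "edges_of S e j = (if \<exists>u \<in> XC. e = ev u \<and> j < k \<and> S u j \<noteq> 0
      then Some (ev (S (THE u. u \<in> XC \<and> e = ev u) j)) else None)"

lemma edges_of_ev: "u \<in> XC \<Longrightarrow> edges_of S (ev u) j = (if j < k \<and> S u j \<noteq> 0 then Some (ev (S u j)) else None)"
proof -
  assume u: "u \<in> XC"
  then have "(THE v. v \<in> XC \<and> ev u = ev v) = u"
    using ev_inj[OF XC_range XC_range] by (intro the_equality) auto
  then show ?thesis using u ev_inj[OF XC_range XC_range] by (auto simp: edges_of_def)
qed

text \<open>The hypotheses make \<open>S u j\<close> the earliest successor of \<open>u\<close> in
  the foreign chain \<open>j\<close>, or 0. Any ordering across chains is then one stored edge to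
  that successor followed by a walk along its chain.\<close>

lemma represents_decode:
  assumes S1: "\<And>u j. u \<in> XC \<Longrightarrow> j < k \<Longrightarrow> S u j \<noteq> 0 \<Longrightarrow> (u, S u j) \<in> M \<and> pr (S u j) = j \<and> pr u \<noteq> j"
    and S2: "\<And>u v. (u, v) \<in> M \<Longrightarrow> pr u \<noteq> pr v \<Longrightarrow> S u (pr v) \<noteq> 0 \<and> S u (pr v) \<le> v"
  shows "represents k t X (edges_of S) (decode M)"
proof -
  let ?C = "chain_edges t X" let ?T = "stored_edges (edges_of S)"
  have edge: "\<exists>u \<in> XC. e = ev u \<and> j < k \<and> S u j \<noteq> 0 \<and> f = ev (S u j)"
    if "edges_of S e j = Some f" for e j f
  proof -
    from that obtain u where "u \<in> XC" "e = ev u" by (auto simp: edges_of_def split: if_splits)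
    then show ?thesis using that edges_of_ev[of u S j] by (auto split: if_splits)
  qed
  have c1: "e \<in> X \<and> j < k \<and> j \<noteq> proc e \<and> f \<in> X \<and> proc f = j"
    if e: "edges_of S e j = Some f" for e j f
  proof -
    obtain u where u: "u \<in> XC" "e = ev u" "j < k" "S u j \<noteq> 0" "f = ev (S u j)" using edge[OF e] by blast
    then show ?thesis using S1[of u j] M_XC[of u "S u j"] by (auto simp: pr_def XC_def)
  qed
  have T: "?T \<subseteq> decode M"
  proof
    fix p assume "p \<in> ?T"
    then obtain e j f where "p = (e, f)" "edges_of S e j = Some f" by (auto simp: stored_edges_def)
    then show "p \<in> decode M" using edge S1 by (fastforce simp: decode_def)
  qed
  have irr: "(e, e) \<notin> ?C \<union> ?T" for e
    using c1[of e _ e] by (auto simp: chain_edges_def slt_def stored_edges_def)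
  have tr: "trans (decode M)" "antisym (decode M)"
    using decode_order by (simp_all add: partial_order_on_def preorder_on_def)
  \<comment> \<open>The strict part of a partial order is transitive and irreflexive, hence acyclic;
    all edges lie in it, because chain edges and stored edges are never loops.\<close>
  have "acyclic (decode M - Id)"
    using tr by (simp add: acyclic_def trans_diff_Id)
  then have c2: "acyclic (?C \<union> ?T)"
    by (rule acyclic_subset) (use T chain_edges_decode irr in auto)
  have "(?C \<union> ?T)\<^sup>* \<inter> (X \<times> X) \<subseteq> decode M"
  proof -
    have "(?C \<union> ?T)\<^sup>* \<subseteq> (decode M)\<^sup>*" using T chain_edges_decode by (intro rtrancl_mono) auto
    also have "\<dots> = (decode M)\<^sup>=" using tr trancl_id rtrancl_trancl_reflcl by metis
    finally show ?thesis
      using decode_order by (auto simp: partial_order_on_def preorder_on_def refl_on_def)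
  qed
  moreover have "decode M \<subseteq> (?C \<union> ?T)\<^sup>* \<inter> (X \<times> X)"
  proof
    fix p assume "p \<in> decode M"
    then obtain u v where p: "p = (ev u, ev v)" "(u, v) \<in> M" by (auto simp: decode_def)
    then have X: "u \<in> XC" "v \<in> XC" using M_XC by auto
    have mono: "?C\<^sup>* \<subseteq> (?C \<union> ?T)\<^sup>*" by (intro rtrancl_mono) auto
    have "(ev u, ev v) \<in> (?C \<union> ?T)\<^sup>*"
    proof (cases "pr u = pr v")
      case True
      then show ?thesis using chain_path X M_same_chain p mono by blast
    next
      case False
      define w where "w = S u (pr v)"
      have j: "pr v < k" using pr_less XC_range X by blast
      have w: "w \<noteq> 0" "w \<le> v" using S2[OF p(2) False] by (auto simp: w_def)
      then have w2: "w \<in> XC" "pr w = pr v" using S1[OF X(1) j] M_XC by (auto simp: w_def)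
      have "(ev u, ev w) \<in> ?T"
        using edges_of_ev[OF X(1), of S "pr v"] j w by (auto simp: stored_edges_def w_def)
      moreover have "(ev w, ev v) \<in> ?C\<^sup>*" using chain_path w w2 X by simp
      ultimately show ?thesis using mono by (meson UnCI converse_rtrancl_into_rtrancl subsetD)
    qed
    then show "p \<in> (?C \<union> ?T)\<^sup>* \<inter> (X \<times> X)" using p X by (auto simp: XC_def)
  qed
  ultimately show ?thesis
    unfolding represents_def using c1 c2 by blast
qed

end

end

section \<open>Timed total correctness\<close>

text \<open>If all cells are at most \<open>V \<ge> 2\<close>, then \<open>V\<close> to the power \<open>adeg a\<close> bounds every
  value that occurs in the evaluation of \<open>a\<close>.\<close>

primrec adeg :: "aexp \<Rightarrow> nat" where
  "adeg (Const c) = c"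
| "adeg (Cell x a) = adeg a + 1"
| "adeg (Plus a b) = adeg a + adeg b + 1"
| "adeg (Minus a b) = adeg a + adeg b"
| "adeg (Times a b) = adeg a + adeg b"
| "adeg (Div a b) = adeg a + adeg b"

primrec bdeg :: "bexp \<Rightarrow> nat" where
  "bdeg (Less a b) = adeg a + adeg b"
| "bdeg (Equal a b) = adeg a + adeg b"
| "bdeg (Not b) = bdeg b"
| "bdeg (And b c) = max (bdeg b) (bdeg c)"

primrec cdeg :: "com \<Rightarrow> nat" where
  "cdeg Skip = 0"
| "cdeg (Store x a b) = max (adeg a) (adeg b)"
| "cdeg (Seq c d) = max (cdeg c) (cdeg d)"
| "cdeg (If b c d) = max (bdeg b) (max (cdeg c) (cdeg d))"
| "cdeg (While b c) = max (bdeg b) (cdeg c)"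

definition cells_le :: "nat \<Rightarrow> memory \<Rightarrow> bool" where
  "cells_le V s \<longleftrightarrow> (\<forall>x i. s x i \<le> V)"

lemma aval_le:
  assumes "2 \<le> V" "cells_le V s"
  shows "aval a s \<le> V ^ adeg a"
proof (induction a)
  case (Const c)
  \<comment> \<open>This inequality is the reason for giving a constant its own value as
    degree.\<close>
  have "c < 2 ^ c" by (rule less_exp)
  also have "\<dots> \<le> V ^ c" using assms by (intro power_mono) auto
  finally show ?case by simp
next
  case (Cell x a)
  have "aval (Cell x a) s \<le> V" using assms by (simp add: cells_le_def)
  also have "V \<le> V ^ (adeg a + 1)" using assms by (intro self_le_power) auto
  finally show ?case by (simp only: adeg.simps)
next
  case (Plus a b)
  \<comment> \<open>Both summands are raised to a common power; the additional 1 in the degree of a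
    sum pays for the factor 2.\<close>
  have "V ^ adeg a \<le> V ^ (adeg a + adeg b)" "V ^ adeg b \<le> V ^ (adeg a + adeg b)"
    using assms by (intro power_increasing; simp)+
  then have "aval a s + aval b s \<le> 2 * V ^ (adeg a + adeg b)" using Plus by linarith
  also have "\<dots> \<le> V * V ^ (adeg a + adeg b)" using assms by simp
  finally show ?case by simp
next
  case (Minus a b)
  have "V ^ adeg a \<le> V ^ (adeg a + adeg b)" using assms by (intro power_increasing) auto
  then show ?case using Minus by simp
next
  case (Times a b)
  then show ?case by (simp add: power_add mult_le_mono)
next
  case (Div a b)
  have "V ^ adeg a \<le> V ^ (adeg a + adeg b)" using assms by (intro power_increasing) auto
  moreover have "aval a s div aval b s \<le> aval a s" by simp
  ultimately show ?case using Div by (simp del: div_le_dividend)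
qed

lemma aval_le_power: "2 \<le> V \<Longrightarrow> cells_le V s \<Longrightarrow> adeg a \<le> d \<Longrightarrow> aval a s \<le> V ^ d"
  using aval_le[of V s a] power_increasing[of "adeg a" d V] by linarith

lemma afits_power: "2 \<le> V \<Longrightarrow> cells_le V s \<Longrightarrow> adeg a \<le> d \<Longrightarrow> afits (V ^ d) a s"
proof (induction a)
  case (Const c)
  then show ?case using aval_le_power[of V s "Const c" d] by simp
next
  case (Cell x a)
  then show ?case using aval_le_power[of V s "Cell x a" d] by simp
next
  case (Plus a b)
  then show ?case using aval_le_power[of V s "Plus a b" d] by simp
next
  case (Times a b)
  then show ?case using aval_le_power[of V s "Times a b" d] by simp
qed auto

lemma bfits_power: "2 \<le> V \<Longrightarrow> cells_le V s \<Longrightarrow> bdeg b \<le> d \<Longrightarrow> bfits (V ^ d) b s"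
  by (induction b) (auto intro: afits_power)

text \<open>The exponent 20 bounds the degree \<open>cdeg\<close> of the closure program.\<close>

definition runs :: "nat \<Rightarrow> com \<Rightarrow> memory \<Rightarrow> nat \<Rightarrow> (memory \<Rightarrow> bool) \<Rightarrow> bool" where
  "runs V c s B Q \<longleftrightarrow> (2 \<le> V \<longrightarrow> cells_le V s \<longrightarrow> cdeg c \<le> 20 \<longrightarrow>
     (\<exists>T s'. exec (V ^ 20) c s T s' \<and> T \<le> B \<and> cells_le V s' \<and> Q s'))"

lemma runs_mono:
  assumes "runs V c s B Q" "B \<le> B'" "\<And>s'. Q s' \<Longrightarrow> cells_le V s' \<Longrightarrow> Q' s'"
  shows "runs V c s B' Q'"
  using assms unfolding runs_def by (meson le_trans)

lemma runs_Skip: "Q s \<Longrightarrow> 1 \<le> B \<Longrightarrow> runs V Skip s B Q"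
  unfolding runs_def using exec.Skip by blast

text \<open>The degree bound takes care of the address and of all intermediate values, so the only
  overflow obligation left is that the new cell content is at most \<open>V\<close>.\<close>

lemma runs_Store:
  assumes "cells_le V s \<Longrightarrow> aval a s \<le> V"
    and "Q (s(x := (s x)(aval i s := aval a s)))" "1 \<le> B"
  shows "runs V (Store x i a) s B Q"
  unfolding runs_def
proof (intro impI)
  assume "2 \<le> V" "cells_le V s" "cdeg (Store x i a) \<le> 20"
  then have "exec (V ^ 20) (Store x i a) s 1 (s(x := (s x)(aval i s := aval a s)))"
    by (intro exec.Store afits_power) auto
  moreover have "cells_le V (s(x := (s x)(aval i s := aval a s)))"
    using assms(1) \<open>cells_le V s\<close> by (auto simp: cells_le_def)
  ultimately show "\<exists>T s'. exec (V ^ 20) (Store x i a) s T s' \<and> T \<le> B \<and> cells_le V s' \<and> Q s'"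
    using assms by blast
qed

lemma runs_Seq:
  assumes "runs V c s B1 (\<lambda>s'. runs V d s' B2 Q)" "B1 + B2 \<le> B"
  shows "runs V (Seq c d) s B Q"
  unfolding runs_def
proof (intro impI)
  assume a: "2 \<le> V" "cells_le V s" "cdeg (Seq c d) \<le> 20"
  then obtain T1 s1 where 1: "exec (V ^ 20) c s T1 s1" "T1 \<le> B1" "cells_le V s1"
    "runs V d s1 B2 Q" using assms(1) unfolding runs_def by auto
  then obtain T2 s2 where 2: "exec (V ^ 20) d s1 T2 s2" "T2 \<le> B2" "cells_le V s2" "Q s2"
    using a unfolding runs_def by auto
  have "exec (V ^ 20) (Seq c d) s (T1 + T2) s2" using 1 2 by (blast intro: exec.Seq)
  then show "\<exists>T s'. exec (V ^ 20) (Seq c d) s T s' \<and> T \<le> B \<and> cells_le V s' \<and> Q s'"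
    using 1 2 assms(2) by (meson add_mono le_trans)
qed

lemma runs_If:
  assumes "bval b s \<Longrightarrow> runs V c s B Q" "\<not> bval b s \<Longrightarrow> runs V d s B Q" "B + 1 \<le> B'"
  shows "runs V (If b c d) s B' Q"
  unfolding runs_def
proof (intro impI)
  assume a: "2 \<le> V" "cells_le V s" "cdeg (If b c d) \<le> 20"
  then have f: "bfits (V ^ 20) b s" by (intro bfits_power) auto
  have "\<exists>T s'. exec (V ^ 20) (If b c d) s (T + 1) s' \<and> T \<le> B \<and> cells_le V s' \<and> Q s'"
  proof (cases "bval b s")
    case True
    then show ?thesis using a assms(1) exec.IfTrue[OF f] unfolding runs_def by fastforce
  next
    case False
    then show ?thesis using a assms(2) exec.IfFalse[OF f] unfolding runs_def by fastforce
  qed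
  then show "\<exists>T s'. exec (V ^ 20) (If b c d) s T s' \<and> T \<le> B' \<and> cells_le V s' \<and> Q s'"
    using assms(3) by (meson add_le_mono1 le_trans)
qed

text \<open>In the invariant \<open>I m\<close>, \<open>m\<close> bounds the number of remaining iterations.\<close>

lemma runs_While:
  assumes body: "\<And>m s. I m s \<Longrightarrow> bval b s \<Longrightarrow> cells_le V s \<Longrightarrow>
      m > 0 \<and> runs V c s B (I (m - 1))"
    and exit: "\<And>m s. I m s \<Longrightarrow> \<not> bval b s \<Longrightarrow> cells_le V s \<Longrightarrow> Q s"
    and init: "I m s" and bound: "m * (B + 1) + 1 \<le> B'"
  shows "runs V (While b c) s B' Q"
  unfolding runs_def
proof (intro impI)
  assume V: "2 \<le> V" and s: "cells_le V s" and deg: "cdeg (While b c) \<le> 20"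
  have f: "bfits (V ^ 20) b s" if "cells_le V s" for s
    using V deg that by (intro bfits_power) auto
  have "\<exists>T s'. exec (V ^ 20) (While b c) s T s' \<and> T \<le> m * (B + 1) + 1 \<and> cells_le V s' \<and> Q s'"
    using init s
  proof (induction m arbitrary: s)
    case 0
    then have "\<not> bval b s" using body by blast
    then show ?case using 0 exec.WhileFalse[OF f] exit by (metis add_0 le_refl mult_0)
  next
    case (Suc m)
    show ?case
    proof (cases "bval b s")
      case True
      then have "runs V c s B (I m)" using body[of "Suc m" s] Suc.prems by simp
      then obtain T1 s1 where 1: "exec (V ^ 20) c s T1 s1" "T1 \<le> B" "cells_le V s1" "I m s1"
        using V deg Suc.prems unfolding runs_def by auto
      then obtain T2 s2 where 2: "exec (V ^ 20) (While b c) s1 T2 s2" "T2 \<le> m * (B + 1) + 1"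
        "cells_le V s2" "Q s2" using Suc.IH by blast
      have "exec (V ^ 20) (While b c) s (T1 + T2 + 1) s2"
        using True 1 2 Suc.prems f by (blast intro: exec.WhileTrue)
      moreover have "T1 + T2 + 1 \<le> Suc m * (B + 1) + 1" using 1 2 by simp
      ultimately show ?thesis using 2 by blast
    next
      case False
      then have "exec (V ^ 20) (While b c) s 1 s" "Q s"
        using exec.WhileFalse f Suc.prems exit by blast+
      then show ?thesis using Suc.prems by (metis le_add2)
    qed
  qed
  then show "\<exists>T s'. exec (V ^ 20) (While b c) s T s' \<and> T \<le> B' \<and> cells_le V s' \<and> Q s'"
    using bound by (meson le_trans)
qed

abbreviation var :: "string \<Rightarrow> aexp" where
  "var x \<equiv> Cell x (Const 0)"

abbreviation Assign :: "string \<Rightarrow> aexp \<Rightarrow> com" where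
  "Assign x a \<equiv> Store x (Const 0) a"

notation Seq (infixr ";;" 60)

abbreviation When :: "bexp \<Rightarrow> com \<Rightarrow> com" where
  "When b c \<equiv> If b c Skip"

definition For :: "string \<Rightarrow> aexp \<Rightarrow> com \<Rightarrow> com" where
  "For x a c = Assign x (Const 0) ;;
     While (Less (var x) a) (c ;; Assign x (Plus (var x) (Const 1)))"

text \<open>A guarded store is treated as one update that writes either the new or the old value,
  which keeps symbolic execution free of branching.\<close>

lemma runs_When_Store:
  assumes "cells_le V s \<Longrightarrow> bval b s \<Longrightarrow> aval a s \<le> V"
    and "Q (s(x := (s x)(aval i s := if bval b s then aval a s else s x (aval i s))))" "2 \<le> B"
  shows "runs V (When b (Store x i a)) s B Q"
  by (rule runs_If[where B = 1])
    (use assms in \<open>auto intro!: runs_Store runs_Skip\<close>)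

text \<open>Naming the evaluated components keeps the symbolic states small.\<close>

lemma runs_Store_Seq:
  assumes "aval i s = j" "aval a s = v" "s x = g" "v \<le> V"
    and "runs V d (s(x := g(j := v))) B Q" "B + 1 \<le> B'"
  shows "runs V (Store x i a ;; d) s B' Q"
  by (rule runs_Seq[OF runs_Store[where B = 1]]) (use assms in auto)

lemma runs_When_Store_Seq:
  assumes "bval b s = c" "aval i s = j" "aval a s = v" "s x = g" "c \<Longrightarrow> v \<le> V"
    and "runs V d (s(x := g(j := if c then v else g j))) B Q" "B + 2 \<le> B'"
  shows "runs V (When b (Store x i a) ;; d) s B' Q"
  by (rule runs_Seq[OF runs_When_Store[where B = 2]]) (use assms in auto)

lemma runs_When_Store_eq:
  assumes "bval b s = c" "aval i s = j" "aval a s = v" "s x = g" "c \<Longrightarrow> v \<le> V"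
    and "Q (s(x := g(j := if c then v else g j)))" "2 \<le> B"
  shows "runs V (When b (Store x i a)) s B Q"
  by (rule runs_When_Store) (use assms in auto)

text \<open>The counter is incremented after the body, so the body has to establish the next
  invariant for the memory with the counter already updated. The 2 per round pays for test and
  increment, the final 2 for the initialisation and the failing test.\<close>

lemma runs_For:
  assumes inv: "\<And>i s. I i s \<Longrightarrow> s x 0 = i \<and> aval a s = N"
    and body: "\<And>i s. I i s \<Longrightarrow> i < N \<Longrightarrow> cells_le V s \<Longrightarrow>
      runs V c s B (\<lambda>s'. s' x 0 = i \<and> I (Suc i) (s'(x := (s' x)(0 := Suc i))))"
    and init: "I 0 (s(x := (s x)(0 := 0)))" and "N \<le> V" "N * (B + 2) + 2 \<le> B'"
  shows "runs V (For x a c) s B' (I N)"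
  unfolding For_def
proof (rule runs_Seq)
  let ?J = "\<lambda>m s. \<exists>i. I i s \<and> i + m = N"
  let ?w = "While (Less (var x) a) (c ;; Assign x (Plus (var x) (Const 1)))"
  have "runs V ?w s (N * (B + 2) + 1) (I N)" if "I 0 s" for s
  proof (rule runs_While[where I = ?J and m = N])
    show "?J N s" using that by simp
  next
    fix m s assume J: "?J m s" and b: "bval (Less (var x) a) s" and V: "cells_le V s"
    then obtain i where i: "I i s" "i + m = N" by blast
    then have "i < N" using inv[OF i(1)] b by simp
    have "runs V (c ;; Assign x (Plus (var x) (Const 1))) s (B + 1) (?J (m - 1))"
      by (rule runs_Seq[OF runs_mono[OF body[OF i(1) \<open>i < N\<close> V] le_refl]], rule runs_Store[where B = 1])
        (use i \<open>i < N\<close> \<open>N \<le> V\<close> in auto)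
    then show "m > 0 \<and> runs V (c ;; Assign x (Plus (var x) (Const 1))) s (B + 1) (?J (m - 1))"
      using i \<open>i < N\<close> by simp
  next
    fix m s assume "?J m s" "\<not> bval (Less (var x) a) s"
    then show "I N s" using inv by fastforce
  qed (use assms in auto)
  then show "runs V (Assign x (Const 0)) s 1 (\<lambda>s. runs V ?w s (N * (B + 2) + 1) (I N))"
    using init by (intro runs_Store) auto
qed (use assms in auto)

section \<open>The closure program\<close>

abbreviation row :: "aexp \<Rightarrow> aexp \<Rightarrow> aexp" where
  "row a b \<equiv> Plus (Times a (var ''processes'')) b"

abbreviation entry :: "aexp \<Rightarrow> aexp \<Rightarrow> aexp" where
  "entry a b \<equiv> Plus (Times a (Plus (var ''length'') (Const 1))) b"

text \<open>The input arrays and the result are indexed by positions, the auxiliary arrays by codes.\<close>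

abbreviation input :: "string \<Rightarrow> aexp \<Rightarrow> aexp" where
  "input x a \<equiv> Cell x (Minus a (Const 1))"

abbreviation Neq :: "aexp \<Rightarrow> aexp \<Rightarrow> bexp" where
  "Neq a b \<equiv> Not (Equal a b)"

abbreviation succ_idx :: aexp where
  "succ_idx \<equiv> row (Minus (var ''u'') (Const 1)) (input ''proc'' (var ''v''))"

abbreviation pred_idx :: aexp where
  "pred_idx \<equiv> row (var ''v'') (input ''proc'' (var ''u''))"

text \<open>Argument 0 means that there is no event, so callers may pass table entries unchecked. In
  \<open>D\<close> a maximum is kept and an empty entry 0 loses against every code; in
  \<open>result\<close> a minimum is kept, so an empty entry needs its own test.\<close>

definition push :: com where
  "push =
     When (And (Neq (var ''u'') (Const 0)) (And (Neq (var ''v'') (Const 0))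
         (Equal (Cell ''M'' (entry (var ''u'') (var ''v''))) (Const 0))))
      (Store ''M'' (entry (var ''u'') (var ''v'')) (Const 1) ;;
       Store ''QU'' (var ''tail'') (var ''u'') ;;
       Store ''QV'' (var ''tail'') (var ''v'') ;;
       Assign ''tail'' (Plus (var ''tail'') (Const 1)) ;;
       When (And (Neq (input ''proc'' (var ''u'')) (input ''proc'' (var ''v'')))
           (Not (And (Neq (Cell ''result'' succ_idx) (Const 0))
                     (Not (Less (var ''v'') (Cell ''result'' succ_idx))))))
         (Store ''result'' succ_idx (var ''v'')) ;;
       When (And (Neq (input ''proc'' (var ''u'')) (input ''proc'' (var ''v'')))
           (Less (Cell ''D'' pred_idx) (var ''u'')))
         (Store ''D'' pred_idx (var ''u'')))"

definition push_pair :: "aexp \<Rightarrow> aexp \<Rightarrow> com" where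
  "push_pair a b = Assign ''u'' a ;; Assign ''v'' b ;; push"

text \<open>Stores at index 0 (no earlier event of the chain, write or acquire) are never read.\<close>

definition scan :: com where
  "scan = For ''i'' (var ''length'')
     (let u = Plus (var ''i'') (Const 1); p = Cell ''proc'' (var ''i'');
          x = Cell ''loc'' (var ''i''); op = Cell ''op'' (var ''i'');
          mem = Equal (Cell ''member'' (var ''i'')) (Const 1)
      in Store ''prev'' u (Cell ''last'' p) ;;
         Store ''obs'' u (Cell ''lw'' x) ;;
         Store ''acquire_of'' u (Cell ''la'' x) ;;
         When mem (Store ''next'' (Cell ''last'' p) u) ;;
         When mem (Store ''last'' p u) ;;
         When (And mem (Equal op (Const 1))) (Store ''last_reader'' (row (Cell ''lw'' x) p) u) ;;
         When (And mem (Equal op (Const 3))) (Store ''release_of'' (Cell ''la'' x) u) ;;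
         When (Equal op (Const 0)) (Store ''lw'' x u) ;;
         When (Equal op (Const 2)) (Store ''la'' x u))"

text \<open>The input encodes an edge by the position of its target plus one, which is the code of
  the target, and an absent edge by 0, which \<open>push\<close> skips.\<close>

definition start :: com where
  "start = For ''i'' (var ''length'')
     (When (Equal (Cell ''member'' (var ''i'')) (Const 1))
        (push_pair (Plus (var ''i'') (Const 1)) (Plus (var ''i'') (Const 1)) ;;
         For ''m'' (var ''processes'')
           (push_pair (Plus (var ''i'') (Const 1)) (Cell ''edge'' (row (var ''i'') (var ''m''))))))"

definition writes :: bexp where
  "writes = And (Equal (input ''op'' (var ''e'')) (Const 0))
     (And (Equal (input ''op'' (var ''f'')) (Const 0))
     (And (Equal (input ''loc'' (var ''e'')) (input ''loc'' (var ''f'')))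
          (Neq (var ''e'') (var ''f''))))"

definition chains :: com where
  "chains = For ''m'' (var ''processes'')
     (push_pair (var ''e'')
        (Cell ''result'' (row (Minus (var ''f'') (Const 1)) (var ''m''))) ;;
      push_pair (Cell ''D'' (row (var ''e'') (var ''m''))) (var ''f'') ;;
      When writes (push_pair (Cell ''last_reader'' (row (var ''e'') (var ''m''))) (var ''f'')))"

text \<open>If both orientations of a pair are ever known, the one dequeued second finds the other
  in the matrix. Testing at this point therefore misses no contradiction. The flag is only lowered
  and the loop is not aborted.\<close>

definition process :: com where
  "process =
     Assign ''e'' (Cell ''QU'' (var ''head'')) ;;
     Assign ''f'' (Cell ''QV'' (var ''head'')) ;;
     Assign ''head'' (Plus (var ''head'') (Const 1)) ;;
     When (And (Neq (var ''e'') (var ''f''))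
         (Equal (Cell ''M'' (entry (var ''f'') (var ''e''))) (Const 1)))
       (Assign ''defined'' (Const 0)) ;;
     push_pair (Cell ''prev'' (var ''e'')) (var ''f'') ;;
     push_pair (var ''e'') (Cell ''next'' (var ''f'')) ;;
     When (And (Equal (input ''op'' (var ''e'')) (Const 0))
         (And (Equal (input ''op'' (var ''f'')) (Const 1))
              (Equal (input ''loc'' (var ''e'')) (input ''loc'' (var ''f'')))))
       (push_pair (var ''e'') (Cell ''obs'' (var ''f''))) ;;
     When (And (Equal (input ''op'' (var ''e'')) (Const 2))
         (And (Equal (input ''op'' (var ''f'')) (Const 3))
         (And (Equal (input ''loc'' (var ''e'')) (input ''loc'' (var ''f'')))
              (Neq (Cell ''release_of'' (var ''e'')) (var ''f'')))))
       (push_pair (Cell ''release_of'' (var ''e'')) (Cell ''acquire_of'' (var ''f''))) ;;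
     chains"

definition closure_program :: com where
  "closure_program =
     Assign ''defined'' (Const 1) ;; scan ;; start ;;
     While (Less (var ''head'') (var ''tail'')) process"

lemma cdeg_closure_program: "cdeg closure_program \<le> 20"
  by (simp add: closure_program_def scan_def start_def process_def chains_def push_pair_def
      push_def For_def writes_def Let_def)

section \<open>Memory invariants of the queue and its index tables\<close>

context closure_input
begin

definition static :: "memory \<Rightarrow> bool" where
  "static s \<longleftrightarrow> s ''length'' 0 = n \<and> s ''processes'' 0 = k \<and>
     (\<forall>u \<in> {1..n}. s ''proc'' (u - 1) = pr u \<and> s ''op'' (u - 1) = opc u \<and>
        s ''loc'' (u - 1) = arg u \<and> s ''member'' (u - 1) = of_bool (u \<in> XC) \<and>
        (\<forall>j<k. s ''edge'' ((u - 1) * k + j) = edge_code t (E (ev u) j)))"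

definition tables :: "memory \<Rightarrow> bool" where
  "tables s \<longleftrightarrow> (\<forall>u \<in> {1..n}. s ''prev'' u = chain_prev u \<and> s ''next'' u = chain_next u \<and>
     s ''obs'' u = observed u \<and> s ''acquire_of'' u = acquire_of u \<and> s ''release_of'' u = release_of u \<and>
     (\<forall>m<k. s ''last_reader'' (u * k + m) = last_reader u m))"

definition succs :: "memory \<Rightarrow> nat \<Rightarrow> nat \<Rightarrow> nat" where
  "succs s u j = s ''result'' ((u - 1) * k + j)"

definition preds :: "memory \<Rightarrow> nat \<Rightarrow> nat \<Rightarrow> nat" where
  "preds s v j = s ''D'' (v * k + j)"

text \<open>\<open>L\<close> lists the pairs found so far in the order of their insertion into the queue.
  \<open>succs\<close> and \<open>preds\<close> record the extremal neighbours in all foreign chains.\<close>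

definition queue :: "(nat \<times> nat) list \<Rightarrow> memory \<Rightarrow> bool" where
  "queue L s \<longleftrightarrow>
     set L \<subseteq> forced \<and> distinct L \<and> s ''tail'' 0 = length L \<and>
     (\<forall>q<length L. s ''QU'' q = fst (L ! q) \<and> s ''QV'' q = snd (L ! q)) \<and>
     (\<forall>u \<in> {1..n}. \<forall>v \<in> {1..n}. s ''M'' (u * (n + 1) + v) = of_bool ((u, v) \<in> set L)) \<and>
     (\<forall>u \<in> {1..n}. \<forall>j<k. succs s u j \<noteq> 0 \<longrightarrow>
        (u, succs s u j) \<in> set L \<and> pr (succs s u j) = j \<and> pr u \<noteq> j) \<and>
     (\<forall>u v. (u, v) \<in> set L \<longrightarrow> pr u \<noteq> pr v \<longrightarrow>
        succs s u (pr v) \<noteq> 0 \<and> succs s u (pr v) \<le> v) \<and>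
     (\<forall>v \<in> {1..n}. \<forall>j<k. preds s v j \<noteq> 0 \<longrightarrow>
        (preds s v j, v) \<in> set L \<and> pr (preds s v j) = j \<and> pr v \<noteq> j) \<and>
     (\<forall>u v. (u, v) \<in> set L \<longrightarrow> pr u \<noteq> pr v \<longrightarrow> u \<le> preds s v (pr u))"

lemma forced_range: "(u, v) \<in> forced \<Longrightarrow> u \<in> {1..n} \<and> v \<in> {1..n}"
  using forced_XC XC_range by blast

lemma queue_range: "queue L s \<Longrightarrow> (u, v) \<in> set L \<Longrightarrow> u \<in> {1..n} \<and> v \<in> {1..n}"
  using forced_range unfolding queue_def by blast

text \<open>The list has no repetitions and still leaves room for one more pair of codes. This shows
  that the tail pointer fits into a cell after the next insertion.\<close>

lemma length_less:
  assumes "queue L s" "(x, y) \<in> forced" "(x, y) \<notin> set L"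
  shows "length L < n * n"
proof -
  have "length L + 1 = card (insert (x, y) (set L))"
    using assms by (auto simp: queue_def distinct_card)
  also have "\<dots> \<le> card ({1..n} \<times> {1..n})"
    using assms queue_range[OF assms(1)] forced_range by (intro card_mono) auto
  finally show ?thesis by (simp add: card_cartesian_product)
qed

lemma length_le: "queue L s \<Longrightarrow> length L \<le> n * n"
proof -
  assume q: "queue L s"
  then have "length L = card (set L)" by (simp add: queue_def distinct_card)
  also have "\<dots> \<le> card ({1..n} \<times> {1..n})"
    using queue_range[OF q] by (intro card_mono) auto
  finally show ?thesis by (simp add: card_cartesian_product)
qed

lemma mult_add_inj:
  fixes a b i j K :: nat
  assumes "i < K" "j < K"
  shows "a * K + i = b * K + j \<longleftrightarrow> a = b \<and> i = j"
proof
  assume h: "a * K + i = b * K + j"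
  have "a = (a * K + i) div K" "b = (b * K + j) div K" using assms by auto
  moreover have "i = (a * K + i) mod K" "j = (b * K + j) mod K" using assms by auto
  ultimately show "a = b \<and> i = j" using h by simp
qed auto

text \<open>The hypotheses are the array contents that symbolic execution of \<open>push\<close>
  yields, a skipped guarded store being a store of the old value. Row-major addresses are injective,
  so each table changes in a single entry, and the new entry is extremal by comparison with the old
  one.\<close>

lemma queue_append:
  assumes q: "queue L s" and xy: "(x, y) \<in> forced" "(x, y) \<notin> set L"
    and tail: "s' ''tail'' 0 = Suc (length L)"
    and QU: "s' ''QU'' = (s ''QU'')(length L := x)" and QV: "s' ''QV'' = (s ''QV'')(length L := y)"
    and M: "s' ''M'' = (s ''M'')(x * (n + 1) + y := 1)"
    and res: "s' ''result'' = (s ''result'')((x - 1) * k + pr y :=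
       if pr x \<noteq> pr y \<and> \<not> (succs s x (pr y) \<noteq> 0 \<and> \<not> y < succs s x (pr y)) then y
       else succs s x (pr y))"
    and D: "s' ''D'' = (s ''D'')(y * k + pr x :=
       if pr x \<noteq> pr y \<and> preds s y (pr x) < x then x else preds s y (pr x))"
  shows "queue (L @ [(x, y)]) s'"
proof -
  have r: "x \<in> {1..n}" "y \<in> {1..n}" using forced_range xy by auto
  then have p: "pr x < k" "pr y < k" using pr_less by auto
  have S: "succs s' u j = (if u = x \<and> j = pr y then
       if pr x \<noteq> pr y \<and> \<not> (succs s x (pr y) \<noteq> 0 \<and> \<not> y < succs s x (pr y)) then y
       else succs s x (pr y) else succs s u j)" if "u \<in> {1..n}" "j < k" for u j
  proof -
    have "(u - 1) * k + j = (x - 1) * k + pr y \<longleftrightarrow> u = x \<and> j = pr y"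
      using mult_add_inj[of j k "pr y" "u - 1" "x - 1"] that p r by auto
    then show ?thesis unfolding succs_def[of s'] res by (simp add: succs_def)
  qed
  have P: "preds s' v j = (if v = y \<and> j = pr x then
       if pr x \<noteq> pr y \<and> preds s y (pr x) < x then x else preds s y (pr x) else preds s v j)"
    if "j < k" for v j
    using mult_add_inj[of j k "pr x" v y] that p by (auto simp: preds_def D)
  have M': "s' ''M'' (u * (n + 1) + v) = of_bool ((u, v) \<in> set (L @ [(x, y)]))"
    if "u \<in> {1..n}" "v \<in> {1..n}" for u v
    using mult_add_inj[of v "n + 1" y u x] that r q by (auto simp: M queue_def)
  have q1: "set L \<subseteq> forced" "distinct L"
    "\<And>i. i < length L \<Longrightarrow> s ''QU'' i = fst (L ! i) \<and> s ''QV'' i = snd (L ! i)"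
    using q by (auto simp: queue_def)
  have q2: "\<And>u j. u \<in> {1..n} \<Longrightarrow> j < k \<Longrightarrow> succs s u j \<noteq> 0 \<Longrightarrow>
        (u, succs s u j) \<in> set L \<and> pr (succs s u j) = j \<and> pr u \<noteq> j"
    "\<And>v j. v \<in> {1..n} \<Longrightarrow> j < k \<Longrightarrow> preds s v j \<noteq> 0 \<Longrightarrow>
        (preds s v j, v) \<in> set L \<and> pr (preds s v j) = j \<and> pr v \<noteq> j"
    using q unfolding queue_def by blast+
  have q3: "\<And>u v. (u, v) \<in> set L \<Longrightarrow> pr u \<noteq> pr v \<Longrightarrow>
        succs s u (pr v) \<noteq> 0 \<and> succs s u (pr v) \<le> v"
    "\<And>u v. (u, v) \<in> set L \<Longrightarrow> pr u \<noteq> pr v \<Longrightarrow> u \<le> preds s v (pr u)"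
    using q unfolding queue_def by blast+
  have c1: "(u, succs s' u j) \<in> set (L @ [(x, y)]) \<and> pr (succs s' u j) = j \<and> pr u \<noteq> j"
    if "u \<in> {1..n}" "j < k" "succs s' u j \<noteq> 0" for u j
    using q2(1)[of u j] that S[OF that(1,2)] by (auto split: if_splits)
  have c2: "(preds s' v j, v) \<in> set (L @ [(x, y)]) \<and> pr (preds s' v j) = j \<and> pr v \<noteq> j"
    if "v \<in> {1..n}" "j < k" "preds s' v j \<noteq> 0" for v j
    using q2(2)[of v j] that P[OF that(2)] by (auto split: if_splits)
  have c3: "succs s' u (pr v) \<noteq> 0 \<and> succs s' u (pr v) \<le> v"
    if "(u, v) \<in> set (L @ [(x, y)])" "pr u \<noteq> pr v" for u v
  proof -
    have uv: "u \<in> {1..n}" "v \<in> {1..n}" using that queue_range[OF q] r by auto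
    show ?thesis
      using q3(1)[of u v] that S[OF uv(1) pr_less[OF uv(2)]] r
      by (cases "(u, v) = (x, y)") auto
  qed
  have c4: "u \<le> preds s' v (pr u)"
    if "(u, v) \<in> set (L @ [(x, y)])" "pr u \<noteq> pr v" for u v
  proof -
    have uv: "u \<in> {1..n}" "v \<in> {1..n}" using that queue_range[OF q] r by auto
    show ?thesis
      using q3(2)[of u v] that P[OF pr_less[OF uv(1)], of v] r
      by (cases "(u, v) = (x, y)") auto
  qed
  show ?thesis
    unfolding queue_def
    using q1 xy tail M' c1 c2 c3 c4 by (auto simp: QU QV nth_append)
qed

end

section \<open>Correctness and running time of the phases\<close>

lemma word_capacity: "(n::nat) + k + nv + nl + 2 \<le> (n + k + nv + nl + 2) ^ 2"
  by (simp add: power2_eq_square)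

context closure_input
begin

text \<open>The square is dictated by the queue pointers, which can reach \<open>n * n\<close>; all
  other cell contents are at most linear in the input size or bounded by a constant.\<close>

definition V :: nat where
  "V = (n + k + nv + nl + 2) ^ 2"

lemma V_bounds: "n \<le> V" "k \<le> V" "n * n \<le> V" "4 \<le> V" "nv \<le> V" "nl \<le> V"
proof -
  show "n \<le> V" "k \<le> V" "nv \<le> V" "nl \<le> V" using word_capacity[of n k nv nl] by (auto simp: V_def)
  show "n * n \<le> V" unfolding V_def power2_eq_square by (intro mult_le_mono) auto
  have "2 * 2 \<le> V" unfolding V_def power2_eq_square by (intro mult_le_mono) auto
  then show "4 \<le> V" by simp
qed

definition dynamic :: "string set" where
  "dynamic = {''u'', ''v'', ''M'', ''QU'', ''QV'', ''tail'', ''result'', ''D''}"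

text \<open>Combines progress with a frame condition: only the cells of \<open>push\<close> change,
  and the old list stays a prefix, so that queue positions keep their meaning.\<close>

definition grows :: "(nat \<times> nat) list \<Rightarrow> memory \<Rightarrow> (nat \<times> nat) list \<Rightarrow> memory \<Rightarrow> bool" where
  "grows L s L' s' \<longleftrightarrow> queue L' s' \<and> (\<exists>zs. L' = L @ zs) \<and> (\<forall>z. z \<notin> dynamic \<longrightarrow> s' z = s z)"

lemma grows_refl: "queue L s \<Longrightarrow> grows L s L s"
  by (simp add: grows_def)

lemma grows_static: "grows L s L' s' \<Longrightarrow> static s \<Longrightarrow> static s'"
  unfolding grows_def static_def dynamic_def by simp

lemma grows_tables: "grows L s L' s' \<Longrightarrow> tables s \<Longrightarrow> tables s'"
  unfolding grows_def tables_def dynamic_def by simp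

lemma grows_subset: "grows L s L' s' \<Longrightarrow> set L \<subseteq> set L'"
  by (auto simp: grows_def)

lemma staticD:
  assumes "static s" "u \<in> {1..n}"
  shows "s ''proc'' (u - Suc 0) = pr u" "s ''op'' (u - Suc 0) = opc u"
    "s ''loc'' (u - Suc 0) = arg u" "s ''member'' (u - Suc 0) = of_bool (u \<in> XC)"
    "j < k \<Longrightarrow> s ''edge'' ((u - Suc 0) * k + j) = edge_code t (E (ev u) j)"
  using assms by (auto simp: static_def)

lemma static_sizes: "static s \<Longrightarrow> s ''length'' 0 = n" "static s \<Longrightarrow> s ''processes'' 0 = k"
  by (simp_all add: static_def)

lemma runs_push:
  assumes st: "static s" and q: "queue L s" and x: "s ''u'' 0 = x" and y: "s ''v'' 0 = y"
    and sound: "x = 0 \<or> y = 0 \<or> (x, y) \<in> forced"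
  shows "runs V push s 9 (\<lambda>s'. \<exists>L'. grows L s L' s' \<and> (x \<noteq> 0 \<longrightarrow> y \<noteq> 0 \<longrightarrow> (x, y) \<in> set L'))"
    (is "runs V push s 9 ?Q")
proof -
  have tl: "s ''tail'' 0 = length L" using q by (simp add: queue_def)
  show ?thesis
    unfolding push_def
  proof (rule runs_If[where B = 8], goal_cases)
    case 1
    then have nz: "x \<noteq> 0" "y \<noteq> 0" using x y by auto
    then have f: "(x, y) \<in> forced" using sound by simp
    then have r: "x \<in> {1..n}" "y \<in> {1..n}" using forced_range by auto
    have "s ''M'' (x * (n + 1) + y) = of_bool ((x, y) \<in> set L)"
      using q r unfolding queue_def by blast
    then have new: "(x, y) \<notin> set L"
      using 1 x y static_sizes[OF st] by (auto split: if_splits)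
    have len: "Suc (length L) \<le> V" using length_less[OF q f new] V_bounds by simp
    have bnd: "x \<le> V" "y \<le> V" "1 \<le> V" using r V_bounds by auto
    have px: "s ''proc'' (x - Suc 0) = pr x" "s ''proc'' (y - Suc 0) = pr y"
      using staticD(1)[OF st] r by auto
    note sz = static_sizes[OF st]
    show ?case
      apply (rule runs_Seq[where ?B1.0 = 1 and ?B2.0 = 7])
       apply (rule runs_Store)
         apply (use bnd in simp)
        apply (rule runs_Seq[where ?B1.0 = 1 and ?B2.0 = 6])
         apply (rule runs_Store)
           apply (use bnd x in simp)
          apply (rule runs_Seq[where ?B1.0 = 1 and ?B2.0 = 5])
           apply (rule runs_Store)
             apply (use bnd y in simp)
            apply (rule runs_Seq[where ?B1.0 = 1 and ?B2.0 = 4])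
             apply (rule runs_Store)
               apply (use len tl in simp)
              apply (rule runs_Seq[where ?B1.0 = 2 and ?B2.0 = 2])
               apply (rule runs_When_Store)
                 apply (use bnd y in simp)
                apply (rule runs_When_Store)
                  apply (use bnd x in simp)
                 apply (rule exI[of _ "L @ [(x, y)]"])
                 apply (unfold grows_def)
                 apply (intro conjI)
                    apply (rule queue_append[OF q f new])
                         apply (simp_all add: x y tl sz px succs_def preds_def dynamic_def)
      done
  next
    case 2
    have "?Q s"
    proof (cases "x \<noteq> 0 \<and> y \<noteq> 0")
      case True
      then have r: "x \<in> {1..n}" "y \<in> {1..n}" using sound forced_range by auto
      have "s ''M'' (x * (n + 1) + y) = of_bool ((x, y) \<in> set L)"
        using q r unfolding queue_def by blast
      then have "(x, y) \<in> set L"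
        using 2 True x y static_sizes[OF st] by (auto split: if_splits)
      then show ?thesis using grows_refl q by blast
    qed (use grows_refl q in blast)
    then show ?case by (intro runs_Skip) auto
  qed auto
qed

text \<open>The second expression is evaluated after \<open>u\<close> has been overwritten, hence
  the modified memory in the hypothesis on \<open>b\<close>. The budget 11 is two assignments plus
  the 9 steps of \<open>push\<close>.\<close>

lemma runs_push_pair:
  assumes st: "static s" and q: "queue L s" and a: "aval a s = x"
    and b: "aval b (s(''u'' := (s ''u'')(0 := x))) = y"
    and sound: "x = 0 \<or> y = 0 \<or> (x, y) \<in> forced"
    and le: "x \<le> n" "y \<le> n" and B: "11 \<le> B"
    and Q: "\<And>L' s'. grows L s L' s' \<Longrightarrow> (x \<noteq> 0 \<Longrightarrow> y \<noteq> 0 \<Longrightarrow> (x, y) \<in> set L') \<Longrightarrow> Q s'"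
  shows "runs V (push_pair a b) s B Q"
proof -
  let ?s1 = "s(''u'' := (s ''u'')(0 := x))"
  let ?s2 = "?s1(''v'' := (?s1 ''v'')(0 := y))"
  have st2: "static ?s2" using st by (simp add: static_def)
  have q2: "queue L ?s2" using q by (simp add: queue_def succs_def preds_def)
  have "grows L s L' s'" if "grows L ?s2 L' s'" for L' s'
    using that by (auto simp: grows_def dynamic_def)
  then have "runs V push ?s2 9 Q"
    by (intro runs_mono[OF runs_push[OF st2 q2 _ _ sound] le_refl]) (auto intro!: Q)
  then have "runs V (Assign ''v'' b ;; push) ?s1 10 Q"
    by (rule runs_Store_Seq[where B = 9, rotated 4]) (use b le V_bounds in auto)
  then have "runs V (push_pair a b) s 11 Q"
    unfolding push_pair_def
    by (rule runs_Store_Seq[where B = 10, rotated 4]) (use a le V_bounds in auto)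
  then show ?thesis using B by (rule runs_mono)
qed

section \<open>Filling the tables in one scan of the trace\<close>

definition scanned :: "nat \<Rightarrow> memory \<Rightarrow> bool" where
  "scanned i s \<longleftrightarrow>
     (\<forall>p. s ''last'' p = latest (\<lambda>u. u \<in> XC \<and> pr u = p) i) \<and>
     (\<forall>x. s ''lw'' x = latest (\<lambda>w. opc w = 0 \<and> arg w = x) i) \<and>
     (\<forall>x. s ''la'' x = latest (\<lambda>a. opc a = 2 \<and> arg a = x) i) \<and>
     (\<forall>u \<in> {1..i}. s ''prev'' u = chain_prev u \<and> s ''obs'' u = observed u \<and> s ''acquire_of'' u = acquire_of u) \<and>
     (\<forall>u\<ge>1. s ''next'' u = latest (\<lambda>v. v \<in> XC \<and> chain_prev v = u) i) \<and>
     (\<forall>u\<ge>1. s ''release_of'' u = latest (\<lambda>r. r \<in> XC \<and> opc r = 3 \<and> acquire_of r = u) i) \<and>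
     (\<forall>w. \<forall>m<k. s ''last_reader'' (w * k + m) =
        latest (\<lambda>r. r \<in> XC \<and> opc r = 1 \<and> pr r = m \<and> observed r = w) i)"

definition fresh :: "memory \<Rightarrow> bool" where
  "fresh s \<longleftrightarrow> s ''defined'' 0 = 1 \<and>
     (\<forall>z \<in> {''head'', ''tail'', ''QU'', ''QV'', ''M'', ''result'', ''D''}. \<forall>i. s z i = 0)"

text \<open>The invariant is the specification of the tables with the search bound lowered to the
  number of scanned events. The body costs 15: three plain stores and six guarded ones at 2
  each.\<close>

lemma runs_scan:
  assumes st: "static s" and fr: "fresh s"
    and zero: "\<And>z i. z \<in> {''last'', ''lw'', ''la'', ''next'', ''release_of'', ''last_reader''} \<Longrightarrow> s z i = 0"
  shows "runs V scan s (n * 17 + 2) (\<lambda>s. static s \<and> fresh s \<and> tables s)"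
proof -
  let ?I = "\<lambda>i s. s ''i'' 0 = i \<and> static s \<and> fresh s \<and> scanned i s"
  have "runs V scan s (n * 17 + 2) (?I n)"
    unfolding scan_def Let_def
  proof (rule runs_For[where I = ?I and N = n and B = 15], goal_cases)
    case (1 i s)
    then show ?case using static_sizes by simp
  next
    case (2 i s)
    then have st: "static s" and fr: "fresh s" and i: "s ''i'' 0 = i" "i < n" by auto
    have c: "s ''last'' p = latest (\<lambda>u. u \<in> XC \<and> pr u = p) i"
      "s ''lw'' p = latest (\<lambda>w. opc w = 0 \<and> arg w = p) i"
      "s ''la'' p = latest (\<lambda>a. opc a = 2 \<and> arg a = p) i"
      "u \<in> {1..i} \<Longrightarrow> s ''prev'' u = chain_prev u \<and> s ''obs'' u = observed u \<and> s ''acquire_of'' u = acquire_of u"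
      "u \<ge> 1 \<Longrightarrow> s ''next'' u = latest (\<lambda>v. v \<in> XC \<and> chain_prev v = u) i"
      "u \<ge> 1 \<Longrightarrow> s ''release_of'' u = latest (\<lambda>r. r \<in> XC \<and> opc r = 3 \<and> acquire_of r = u) i"
      "m < k \<Longrightarrow> s ''last_reader'' (u * k + m) =
        latest (\<lambda>r. r \<in> XC \<and> opc r = 1 \<and> pr r = m \<and> observed r = u) i" for p u m
      using 2 unfolding scanned_def by blast+
    let ?u = "Suc i"
    have u: "?u \<in> {1..n}" using i by simp
    have e: "s ''proc'' i = pr ?u" "s ''op'' i = opc ?u" "s ''loc'' i = arg ?u"
      "s ''member'' i = of_bool (?u \<in> XC)"
      using staticD(1-4)[OF st u] by simp_all
    have pu: "pr ?u < k" using pr_less u by blast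
    \<comment> \<open>These entries concern events strictly before the current one, so they are read
      from the arrays before the current event is entered. This is why the program updates
      \<open>last\<close>, \<open>lw\<close> and \<open>la\<close> only after their use.\<close>
    have t: "chain_prev ?u = s ''last'' (pr ?u)" "observed ?u = s ''lw'' (arg ?u)" "acquire_of ?u = s ''la'' (arg ?u)"
      by (simp_all add: chain_prev_def observed_def acquire_of_def c)
    have uV: "?u \<le> V" using i V_bounds by simp
    have lV: "s ''last'' p \<le> V" "s ''lw'' p \<le> V" "s ''la'' p \<le> V" for p
      using 2 by (simp_all add: cells_le_def)
    define s' where "s' = s(
      ''prev'' := (s ''prev'')(?u := chain_prev ?u),
      ''obs'' := (s ''obs'')(?u := observed ?u),
      ''acquire_of'' := (s ''acquire_of'')(?u := acquire_of ?u),
      ''next'' := (s ''next'')(chain_prev ?u := if ?u \<in> XC then ?u else s ''next'' (chain_prev ?u)),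
      ''last'' := (s ''last'')(pr ?u := if ?u \<in> XC then ?u else s ''last'' (pr ?u)),
      ''last_reader'' := (s ''last_reader'')(observed ?u * k + pr ?u := if ?u \<in> XC \<and> opc ?u = 1 then ?u
         else s ''last_reader'' (observed ?u * k + pr ?u)),
      ''release_of'' := (s ''release_of'')(acquire_of ?u := if ?u \<in> XC \<and> opc ?u = 3 then ?u else s ''release_of'' (acquire_of ?u)),
      ''lw'' := (s ''lw'')(arg ?u := if opc ?u = 0 then ?u else s ''lw'' (arg ?u)),
      ''la'' := (s ''la'')(arg ?u := if opc ?u = 2 then ?u else s ''la'' (arg ?u)))"
    have sc: "scanned ?u s'"
      unfolding scanned_def
    proof (intro conjI allI ballI impI, goal_cases)
      case (4 v)
      then show ?case using c(4)[of v] by (cases "v = ?u") (auto simp: s'_def)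
    next
      case (5 v)
      then show ?case using c(4)[of v] by (cases "v = ?u") (auto simp: s'_def)
    next
      case (6 v)
      then show ?case using c(4)[of v] by (cases "v = ?u") (auto simp: s'_def)
    next
      case (9 w m)
      have "w * k + m = observed ?u * k + pr ?u \<longleftrightarrow> w = observed ?u \<and> m = pr ?u"
        using 9 pu mult_add_inj by blast
      then show ?case using c(7)[OF 9, of w] by (auto simp: s'_def)
    qed (auto simp: s'_def c(1-3,5-6))
    have fin: "s' ''i'' 0 = i"
      "static (s'(''i'' := (s' ''i'')(0 := ?u)))" "fresh (s'(''i'' := (s' ''i'')(0 := ?u)))"
      "scanned ?u (s'(''i'' := (s' ''i'')(0 := ?u)))"
      using st fr sc i by (simp_all add: s'_def static_def fresh_def scanned_def)
    note sz = static_sizes[OF st]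
    show ?case
      apply (rule runs_Store_Seq[where j = ?u and v = "chain_prev ?u" and g = "s ''prev''" and B = 14])
           apply (use lV in \<open>simp_all add: i e t\<close>)[4]
       apply (rule runs_Store_Seq[where j = ?u and v = "observed ?u" and g = "s ''obs''" and B = 13])
            apply (use lV in \<open>simp_all add: i e t\<close>)[4]
        apply (rule runs_Store_Seq[where j = ?u and v = "acquire_of ?u" and g = "s ''acquire_of''" and B = 12])
             apply (use lV in \<open>simp_all add: i e t\<close>)[4]
         apply (rule runs_When_Store_Seq[where j = "chain_prev ?u" and v = ?u and g = "s ''next''"
                and c = "?u \<in> XC" and B = 10])
               apply (use uV in \<open>simp_all add: i e t\<close>)[5]
          apply (rule runs_When_Store_Seq[where j = "pr ?u" and v = ?u and g = "s ''last''"
                 and c = "?u \<in> XC" and B = 8])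
                apply (use uV in \<open>simp_all add: i e t\<close>)[5]
           apply (rule runs_When_Store_Seq[where j = "observed ?u * k + pr ?u" and v = ?u
                  and g = "s ''last_reader''" and c = "?u \<in> XC \<and> opc ?u = 1" and B = 6])
                 apply (use uV in \<open>simp_all add: i e t sz\<close>)[5]
            apply (rule runs_When_Store_Seq[where j = "acquire_of ?u" and v = ?u and g = "s ''release_of''"
                   and c = "?u \<in> XC \<and> opc ?u = 3" and B = 4])
                  apply (use uV in \<open>simp_all add: i e t\<close>)[5]
             apply (rule runs_When_Store_Seq[where j = "arg ?u" and v = ?u and g = "s ''lw''"
                    and c = "opc ?u = 0" and B = 2])
                   apply (use uV in \<open>simp_all add: i e t\<close>)[5]
              apply (rule runs_When_Store_eq[where j = "arg ?u" and v = ?u and g = "s ''la''"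
                     and c = "opc ?u = 2"])
                    apply (use uV in \<open>simp_all add: i e t\<close>)[5]
      unfolding s'_def[symmetric] using fin by (simp_all add: fun_upd_def)
  next
    case 3
    then show ?case using st fr zero
      by (auto simp: static_def fresh_def scanned_def)
  qed (use V_bounds in auto)
  then show ?thesis
  proof (rule runs_mono)
    fix s assume "?I n s"
    then show "static s \<and> fresh s \<and> tables s"
      by (auto simp: scanned_def tables_def chain_next_def release_of_def last_reader_def)
  qed auto
qed

section \<open>Seeding the queue\<close>

lemma position_ev: "v \<in> {1..n} \<Longrightarrow> position t (ev v) = v - 1"
  unfolding position_def ev_def
  by (rule the_equality) (use distinct in \<open>auto simp: nth_eq_iff_index_eq\<close>)

lemma edge_code_Some: "v \<in> {1..n} \<Longrightarrow> edge_code t (Some (ev v)) = v"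
  using position_ev by (auto simp: edge_code_def)

lemma edge_Some:
  assumes u: "u \<in> XC" and f: "E (ev u) j = Some f"
  shows "\<exists>v. f = ev v \<and> edge_code t (Some f) = v \<and> (u, v) \<in> forced"
proof -
  have "f \<in> X" using repr f unfolding represents_def by blast
  then obtain v where v: "v \<in> XC" "f = ev v" by (rule X_surj)
  have "(ev u, f) \<in> chain_edges t X \<union> stored_edges E"
    using f by (auto simp: stored_edges_def)
  then have "(ev u, f) \<in> P"
    using repr u \<open>f \<in> X\<close> unfolding represents_def XC_def by auto
  then show ?thesis using forced_P[OF u v(1)] v edge_code_Some XC_range by auto
qed

definition counters :: "string set" where
  "counters = {''i'', ''m'', ''e'', ''f'', ''head'', ''defined''}"

text \<open>Separates the bookkeeping variables from everything that the invariants mention, so that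
  updating a loop counter leaves the invariants intact.\<close>

lemma counter_upd:
  assumes "z \<in> counters"
  shows "static (s(z := g)) \<longleftrightarrow> static s" "tables (s(z := g)) \<longleftrightarrow> tables s"
    "queue L (s(z := g)) \<longleftrightarrow> queue L s"
proof -
  have "z \<noteq> x" if "x \<in> {''length'', ''processes'', ''proc'', ''op'', ''loc'', ''member'', ''edge'',
    ''prev'', ''next'', ''obs'', ''acquire_of'', ''release_of'', ''last_reader'', ''tail'', ''QU'', ''QV'', ''M'', ''result'', ''D''}" for x
    using that assms by (auto simp: counters_def)
  then have "(s(z := g)) x = s x" if "x \<in> {''length'', ''processes'', ''proc'', ''op'', ''loc'', ''member'', ''edge'',
    ''prev'', ''next'', ''obs'', ''acquire_of'', ''release_of'', ''last_reader'', ''tail'', ''QU'', ''QV'', ''M'', ''result'', ''D''}" for x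
    using that by (metis fun_upd_other)
  then show "static (s(z := g)) \<longleftrightarrow> static s" "tables (s(z := g)) \<longleftrightarrow> tables s"
    "queue L (s(z := g)) \<longleftrightarrow> queue L s"
    by (simp_all add: static_def tables_def queue_def succs_def preds_def del: fun_upd_apply)
qed

text \<open>Diagonal pairs and stored edges suffice as seeds: the chain rules turn (u, u) into the
  program order of its chain, and saturation with antisymmetry supplies the rest of
  \<open>P\<close>.\<close>

definition seeded :: "nat \<Rightarrow> nat rel \<Rightarrow> bool" where
  "seeded i M \<longleftrightarrow> (\<forall>u \<in> XC. u \<le> i \<longrightarrow> (u, u) \<in> M \<and>
     (\<forall>j<k. \<forall>f. E (ev u) j = Some f \<longrightarrow> (\<exists>v. f = ev v \<and> (u, v) \<in> M)))"

lemma seeded_mono: "seeded i M \<Longrightarrow> M \<subseteq> M' \<Longrightarrow> seeded i M'"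
  unfolding seeded_def by blast

lemma queue_Nil: "fresh s \<Longrightarrow> queue [] s"
  by (simp add: fresh_def queue_def succs_def preds_def)

lemma runs_start:
  assumes st: "static s" and fr: "fresh s" and tb: "tables s"
  shows "runs V start s (n * (k * 13 + 16) + 2) (\<lambda>s. static s \<and> tables s \<and>
     s ''defined'' 0 = 1 \<and> s ''head'' 0 = 0 \<and> (\<exists>L. queue L s \<and> seeded n (set L)))"
proof -
  let ?K = "\<lambda>s. static s \<and> tables s \<and> s ''defined'' 0 = 1 \<and> s ''head'' 0 = 0"
  let ?I = "\<lambda>i s. s ''i'' 0 = i \<and> ?K s \<and> (\<exists>L. queue L s \<and> seeded i (set L))"
  have keep: "?K s'" if "grows L s L' s'" "?K s" for L s L' s'
  proof -
    have "s' ''defined'' 0 = s ''defined'' 0" "s' ''head'' 0 = s ''head'' 0"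
      using that(1) by (simp_all add: grows_def dynamic_def)
    then show ?thesis using that grows_static[OF that(1)] grows_tables[OF that(1)] by simp
  qed
  have keep_vars: "s' ''i'' 0 = s ''i'' 0" "s' ''m'' 0 = s ''m'' 0" if "grows L s L' s'" for L s L' s'
    using that by (simp_all add: grows_def dynamic_def)
  have "runs V start s (n * (k * 13 + 16) + 2) (?I n)"
    unfolding start_def
  proof (rule runs_For[where I = ?I and N = n and B = "k * 13 + 14"], goal_cases)
    case (1 i s)
    then show ?case using static_sizes by simp
  next
    case (2 i s)
    then obtain L where i: "s ''i'' 0 = i" "i < n" and K: "?K s" and q: "queue L s"
      and sd: "seeded i (set L)" by auto
    let ?u = "Suc i"
    have u: "?u \<in> {1..n}" using i by simp
    have mem: "s ''member'' i = of_bool (?u \<in> XC)" using staticD(4)[of s ?u] K u by simp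
    show ?case
    proof (rule runs_If[where B = "k * 13 + 13"], goal_cases)
      case 1
      then have uX: "?u \<in> XC" using mem i by (cases "?u \<in> XC") auto
      let ?J = "\<lambda>m s. s ''m'' 0 = m \<and> s ''i'' 0 = i \<and> ?K s \<and>
        (\<exists>L'. queue L' s \<and> set L \<subseteq> set L' \<and> (?u, ?u) \<in> set L' \<and>
          (\<forall>j<m. \<forall>f. E (ev ?u) j = Some f \<longrightarrow> (\<exists>v. f = ev v \<and> (?u, v) \<in> set L')))"
      have inner: "runs V (For ''m'' (var ''processes'')
           (push_pair (Plus (var ''i'') (Const 1)) (Cell ''edge'' (row (var ''i'') (var ''m'')))))
         s1 (k * 13 + 2) (?J k)"
        if s1: "s1 ''i'' 0 = i" "?K s1" "queue L1 s1" "set L \<subseteq> set L1" "(?u, ?u) \<in> set L1" for s1 L1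
      proof (rule runs_For[where I = ?J and N = k and B = 11], goal_cases)
        case (1 m s)
        then have "s ''m'' 0 = m" "static s" by blast+
        then show ?case using static_sizes(2)[of s] by simp
      next
        case (2 m s)
        then obtain L' where J: "s ''m'' 0 = m" "s ''i'' 0 = i" "?K s" "queue L' s" "set L \<subseteq> set L'"
          "(?u, ?u) \<in> set L'"
          "\<forall>j<m. \<forall>f. E (ev ?u) j = Some f \<longrightarrow> (\<exists>v. f = ev v \<and> (?u, v) \<in> set L')" by blast
        let ?c = "edge_code t (E (ev ?u) m)"
        have e: "s ''edge'' (i * k + m) = ?c" using staticD(5)[of s ?u m] J u 2 by simp
        \<comment> \<open>Code 0 is an absent edge; any other code comes from a stored edge, which
          belongs to \<open>P\<close> and is therefore forced.\<close>
        have f: "?c = 0 \<or> (?u, ?c) \<in> forced"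
          using edge_Some[OF uX, of m] by (cases "E (ev ?u) m") (auto simp: edge_code_def)
        then have "?c \<le> n" using forced_range by fastforce
        show ?case
        proof (rule runs_push_pair[where x = ?u and y = ?c and L = L'], goal_cases)
          case (9 L'' s')
          have "\<exists>v. f = ev v \<and> (?u, v) \<in> set L''" if jf: "j < Suc m" "E (ev ?u) j = Some f" for j f
          proof (cases "j = m")
            case True
            then obtain v where v: "f = ev v" "?c = v" "(?u, v) \<in> forced"
              using edge_Some[OF uX jf(2)] jf(2) by auto
            then have "v \<noteq> 0" using forced_range by fastforce
            then have "(?u, v) \<in> set L''" using 9(2) v(2) by blast
            then show ?thesis using v(1) by blast
          next
            case False
            then have "j < m" using jf(1) by simp
            then show ?thesis using J(7) jf(2) grows_subset[OF 9(1)] by blast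
          qed
          moreover have "queue L'' s'" using 9 by (simp add: grows_def)
          moreover have "set L \<subseteq> set L''" "(?u, ?u) \<in> set L''"
            using grows_subset[OF 9(1)] J by blast+
          moreover have "?K s'" using keep[OF 9(1)] J by blast
          ultimately show ?case using keep_vars[OF 9(1)] J
            by (auto simp: counter_upd counters_def)
        qed (use J u i f e \<open>?c \<le> n\<close> static_sizes[of s] in auto)
      next
        case 3
        then show ?case using that by (auto simp: counter_upd counters_def)
      qed (use V_bounds in auto)
      show ?case
      proof (rule runs_Seq[where ?B1.0 = 11 and ?B2.0 = "k * 13 + 2"], goal_cases)
        case 1
        show ?case
        proof (rule runs_push_pair[where x = ?u and y = ?u and L = L], goal_cases)
          case (9 L1 s1)
          have "(?u, ?u) \<in> set L1" using 9 by simp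
          then have "runs V (For ''m'' (var ''processes'')
             (push_pair (Plus (var ''i'') (Const 1)) (Cell ''edge'' (row (var ''i'') (var ''m'')))))
             s1 (k * 13 + 2) (?J k)"
            using inner[of s1 L1] keep[OF 9(1)] keep_vars[OF 9(1)] K i grows_subset[OF 9(1)] 9
            by (auto simp: grows_def)
          then show ?case
          proof (rule runs_mono)
            fix s' assume "?J k s'"
            then obtain L' where L': "s' ''i'' 0 = i" "?K s'" "queue L' s'" "set L \<subseteq> set L'"
              "(?u, ?u) \<in> set L'"
              "\<forall>j<k. \<forall>f. E (ev ?u) j = Some f \<longrightarrow> (\<exists>v. f = ev v \<and> (?u, v) \<in> set L')" by blast
            have "seeded ?u (set L')"
              using seeded_mono[OF sd L'(4)] L'(5,6) by (auto simp: seeded_def le_Suc_eq)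
            then show "s' ''i'' 0 = i \<and> ?I ?u (s'(''i'' := (s' ''i'')(0 := ?u)))"
              using L' by (auto simp: counter_upd counters_def)
          qed auto
        qed (use K q u i forced_refl[OF uX] in auto)
      qed auto
    next
      case 2
      then have "?u \<notin> XC" using mem i by auto
      then have "seeded ?u (set L)" using sd by (auto simp: seeded_def le_Suc_eq)
      then show ?case using K q i by (intro runs_Skip) (auto simp: counter_upd counters_def)
    qed auto
  next
    case 3
    have "seeded 0 (set [])" by (auto simp: seeded_def XC_def)
    then show ?case using queue_Nil[OF fr] st tb fr
      by (auto simp: counter_upd counters_def fresh_def)
  qed (use V_bounds in auto)
  then show ?thesis by (rule runs_mono) auto
qed

section \<open>Propagating one pair\<close>

definition handled :: "nat rel \<Rightarrow> nat \<Rightarrow> nat \<Rightarrow> bool" where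
  "handled M u v \<longleftrightarrow> (chain_prev u \<noteq> 0 \<longrightarrow> (chain_prev u, v) \<in> M) \<and> (chain_next v \<noteq> 0 \<longrightarrow> (u, chain_next v) \<in> M) \<and>
     (opc u = 0 \<longrightarrow> opc v = 1 \<longrightarrow> arg u = arg v \<longrightarrow> (u, observed v) \<in> M) \<and>
     (opc u = 2 \<longrightarrow> opc v = 3 \<longrightarrow> arg u = arg v \<longrightarrow> release_of u \<noteq> 0 \<longrightarrow> release_of u \<noteq> v \<longrightarrow> (release_of u, acquire_of v) \<in> M)"

text \<open>The consequences of the pair \<open>(u, v)\<close> that involve the chain \<open>m\<close>, relative to
  the pairs \<open>M\<close> known before.\<close>

definition handled_chain :: "nat rel \<Rightarrow> nat rel \<Rightarrow> nat \<Rightarrow> nat \<Rightarrow> nat \<Rightarrow> bool" where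
  "handled_chain M M' m u v \<longleftrightarrow>
     (\<forall>w. (v, w) \<in> M \<longrightarrow> pr w = m \<longrightarrow> pr v \<noteq> m \<longrightarrow> (\<exists>w'\<le>w. pr w' = m \<and> (u, w') \<in> M')) \<and>
     (\<forall>w. (w, u) \<in> M \<longrightarrow> pr w = m \<longrightarrow> pr u \<noteq> m \<longrightarrow> (\<exists>w'\<ge>w. pr w' = m \<and> (w', v) \<in> M')) \<and>
     (opc u = 0 \<longrightarrow> opc v = 0 \<longrightarrow> arg u = arg v \<longrightarrow> u \<noteq> v \<longrightarrow> last_reader u m \<noteq> 0 \<longrightarrow> (last_reader u m, v) \<in> M')"

lemma handled_mono:
  assumes "handled M u v" "M \<subseteq> M'"
  shows "handled M' u v"
  using assms(1) subsetD[OF assms(2)] unfolding handled_def by simp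

lemma handled_chain_mono:
  assumes "handled_chain M0 M m u v" "M \<subseteq> M'"
  shows "handled_chain M0 M' m u v"
  unfolding handled_chain_def
proof (intro conjI allI impI, goal_cases)
  case (1 w)
  then show ?case using assms unfolding handled_chain_def by blast
next
  case (2 w)
  then show ?case using assms unfolding handled_chain_def by blast
next
  case 3
  then show ?case using assms unfolding handled_chain_def by blast
qed

text \<open>The rule part of \<open>saturated\<close>, split for use as a loop invariant: premises
  come from the dequeued pairs \<open>A\<close>, conclusions from all known pairs \<open>M\<close>.
  When the queue is empty the two sets coincide.\<close>

definition closed_on :: "nat rel \<Rightarrow> nat rel \<Rightarrow> bool" where
  "closed_on A M \<longleftrightarrow>
     (\<forall>u v. (u, v) \<in> A \<longrightarrow> handled M u v) \<and>
     (\<forall>u v w. (u, v) \<in> A \<longrightarrow> (v, w) \<in> A \<longrightarrow> pr u \<noteq> pr v \<longrightarrow> pr v \<noteq> pr w \<longrightarrow>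
        (\<exists>w'\<le>w. pr w' = pr w \<and> (u, w') \<in> M) \<or> (\<exists>u'\<ge>u. pr u' = pr u \<and> (u', w) \<in> M)) \<and>
     (\<forall>u v m. (u, v) \<in> A \<longrightarrow> opc u = 0 \<longrightarrow> opc v = 0 \<longrightarrow> arg u = arg v \<longrightarrow> u \<noteq> v \<longrightarrow>
        m < k \<longrightarrow> last_reader u m \<noteq> 0 \<longrightarrow> (last_reader u m, v) \<in> M)"

lemma closed_on_mono:
  assumes "closed_on A M" "M \<subseteq> M'"
  shows "closed_on A M'"
  unfolding closed_on_def
proof (intro conjI allI impI, goal_cases)
  case (1 u v)
  then show ?case using assms handled_mono unfolding closed_on_def by blast
next
  case (2 u v w)
  then have "(\<exists>w'\<le>w. pr w' = pr w \<and> (u, w') \<in> M) \<or> (\<exists>u'\<ge>u. pr u' = pr u \<and> (u', w) \<in> M)"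
    using assms(1) unfolding closed_on_def by blast
  then show ?case using assms(2) by blast
next
  case (3 u v m)
  then show ?case using assms unfolding closed_on_def by blast
qed

text \<open>\<open>M\<close> is the set of pairs known when processing of (u, v) begins. It contains
  every dequeued partner, so a composition using the new pair is covered. Pairs discovered meanwhile
  are combined when they are dequeued themselves.\<close>

lemma closed_on_insert:
  assumes A: "closed_on A M" "A \<subseteq> M" and M: "M \<subseteq> M'" "M \<subseteq> forced" and uv: "(u, v) \<in> M"
    and h: "handled M' u v" "\<And>m. m < k \<Longrightarrow> handled_chain M M' m u v"
  shows "closed_on (insert (u, v) A) M'"
proof -
  have A': "closed_on A M'" using closed_on_mono A M by blast
  have prk: "pr x < k \<and> pr y < k" if "(x, y) \<in> M" for x y
    using that M(2) forced_range pr_less by blast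
  have c: "(\<exists>w'\<le>w. pr w' = pr w \<and> (u', w') \<in> M') \<or> (\<exists>u''\<ge>u'. pr u'' = pr u' \<and> (u'', w) \<in> M')"
    if asm: "(u', v') \<in> insert (u, v) A" "(v', w) \<in> insert (u, v) A"
      "pr u' \<noteq> pr v'" "pr v' \<noteq> pr w" for u' v' w
  proof -
    have X: "(u', v') \<in> M" "(v', w) \<in> M" using asm A uv by auto
    \<comment> \<open>If the new pair comes first in the composition, the earliest successor of
      \<open>v\<close> supplies the first alternative; if it comes second, the latest predecessor of
      \<open>u\<close> supplies the other one.\<close>
    consider "u' = u" "v' = v" | "v' = u" "w = v" | "(u', v') \<in> A" "(v', w) \<in> A"
      using asm(1,2) by blast
    then show ?thesis
    proof cases
      case 1
      then show ?thesis using h(2)[of "pr w"] X asm prk[OF X(2)]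
        unfolding handled_chain_def by metis
    next
      case 2
      then show ?thesis using h(2)[of "pr u'"] X asm prk[OF X(1)]
        unfolding handled_chain_def by metis
    next
      case 3
      then show ?thesis using A' asm unfolding closed_on_def by blast
    qed
  qed
  show ?thesis
    unfolding closed_on_def
  proof (intro conjI, goal_cases)
    case 1
    then show ?case using A' h(1) unfolding closed_on_def by blast
  next
    case 2
    then show ?case using c by blast
  next
    case 3
    then show ?case using A' h(2) unfolding closed_on_def handled_chain_def by blast
  qed
qed

lemma saturatedI:
  assumes "M \<subseteq> forced" "seeded n M" "closed_on M M"
  shows "saturated M"
proof -
  have h: "handled M u v" if "(u, v) \<in> M" for u v
    using assms(3) that unfolding closed_on_def by blast
  show ?thesis
    unfolding saturated_def
  proof (intro conjI, goal_cases)
    case 1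
    show ?case using assms(1) forced_XC by auto
  next
    case 2
    show ?case using assms(2) by (simp add: seeded_def XC_def)
  next
    case 3
    show ?case using assms(2) unfolding seeded_def XC_def by simp
  next
    case 4
    show ?case using h unfolding handled_def by presburger
  next
    case 5
    show ?case using h unfolding handled_def by presburger
  next
    case 6
    show ?case using assms(3) unfolding closed_on_def by presburger
  next
    case 7
    show ?case using h unfolding handled_def by presburger
  next
    case 8
    show ?case using assms(3) unfolding closed_on_def by presburger
  next
    case 9
    show ?case using h unfolding handled_def by presburger
  qed
qed

text \<open>The state while the pair \<open>(e, f)\<close> is processed: \<open>L0\<close> is the list at the beginning,
  \<open>h\<close> the advanced head and \<open>d\<close> the output flag.\<close>

definition processing ::
  "(nat \<times> nat) list \<Rightarrow> nat \<Rightarrow> nat \<Rightarrow> nat \<Rightarrow> nat \<Rightarrow> (nat \<times> nat) list \<Rightarrow> memory \<Rightarrow> bool" where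
  "processing L0 e f h d L s \<longleftrightarrow> static s \<and> tables s \<and> queue L s \<and> (\<exists>zs. L = L0 @ zs) \<and>
     (e, f) \<in> set L0 \<and> s ''e'' 0 = e \<and> s ''f'' 0 = f \<and> s ''head'' 0 = h \<and> s ''defined'' 0 = d"

lemma processing_range:
  assumes "processing L0 e f h d L s"
  shows "(e, f) \<in> set L" "(e, f) \<in> forced" "e \<in> {1..n}" "f \<in> {1..n}"
proof -
  show 1: "(e, f) \<in> set L" using assms by (auto simp: processing_def)
  then show 2: "(e, f) \<in> forced" using assms by (auto simp: processing_def queue_def)
  then show "e \<in> {1..n}" "f \<in> {1..n}" using forced_range by auto
qed

lemma processing_grows:
  assumes "processing L0 e f h d L s" "grows L s L' s'"
  shows "processing L0 e f h d L' s'" "set L \<subseteq> set L'" "s' ''m'' 0 = s ''m'' 0"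
proof -
  have "s' z = s z" if "z \<in> {''e'', ''f'', ''head'', ''defined'', ''m''}" for z
  proof -
    have "z \<notin> dynamic" using that by (auto simp: dynamic_def)
    then show ?thesis using assms(2) by (simp add: grows_def)
  qed
  then have v: "s' ''e'' = s ''e''" "s' ''f'' = s ''f''" "s' ''head'' = s ''head''"
    "s' ''defined'' = s ''defined''" "s' ''m'' = s ''m''" by simp_all
  show "s' ''m'' 0 = s ''m'' 0" using v by simp
  show "set L \<subseteq> set L'" using grows_subset assms(2) by blast
  have "static s'" "tables s'"
    using grows_static grows_tables assms unfolding processing_def by blast+
  moreover have "queue L' s'" "\<exists>zs. L' = L @ zs" using assms(2) by (auto simp: grows_def)
  ultimately show "processing L0 e f h d L' s'"
    using assms(1) v by (auto simp: processing_def)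
qed

lemma runs_processing:
  assumes p: "processing L0 e f h d L s" and a: "aval a s = x"
    and b: "aval b (s(''u'' := (s ''u'')(0 := x))) = y"
    and sound: "x = 0 \<or> y = 0 \<or> (x, y) \<in> forced" and le: "x \<le> n" "y \<le> n" and B: "11 \<le> B"
    and Q: "\<And>L' s'. processing L0 e f h d L' s' \<Longrightarrow> set L \<subseteq> set L' \<Longrightarrow> s' ''m'' 0 = s ''m'' 0 \<Longrightarrow>
      (x \<noteq> 0 \<Longrightarrow> y \<noteq> 0 \<Longrightarrow> (x, y) \<in> set L') \<Longrightarrow> Q s'"
  shows "runs V (push_pair a b) s B Q"
proof (rule runs_push_pair[OF _ _ a b sound le B])
  show "static s" "queue L s" using p by (simp_all add: processing_def)
next
  fix L' s' assume g: "grows L s L' s'" and "x \<noteq> 0 \<Longrightarrow> y \<noteq> 0 \<Longrightarrow> (x, y) \<in> set L'"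
  then show "Q s'" by (intro Q[OF processing_grows[OF p g]])
qed

text \<open>Used for the size obligations of \<open>push_pair\<close>, which arise also for entries
  that turn out to be 0.\<close>

lemma latest_bounds: "chain_prev u \<le> u" "chain_next u \<le> n" "observed u \<le> u" "last_reader u m \<le> n" "acquire_of u \<le> u" "release_of u \<le> n"
  unfolding chain_prev_def chain_next_def observed_def last_reader_def acquire_of_def release_of_def
  by (rule latest_le | rule le_trans[OF latest_le diff_le_self])+

lemma tablesD:
  assumes "tables s" "u \<in> {1..n}"
  shows "s ''prev'' u = chain_prev u" "s ''next'' u = chain_next u" "s ''obs'' u = observed u" "s ''acquire_of'' u = acquire_of u"
    "s ''release_of'' u = release_of u" "m < k \<Longrightarrow> s ''last_reader'' (u * k + m) = last_reader u m"
  using assms unfolding tables_def by blast+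

lemma queue_succs:
  assumes "queue L s" "v \<in> {1..n}" "m < k"
  shows "succs s v m \<noteq> 0 \<Longrightarrow> (v, succs s v m) \<in> set L \<and> pr (succs s v m) = m \<and> pr v \<noteq> m"
    and "(v, w) \<in> set L \<Longrightarrow> pr w = m \<Longrightarrow> pr v \<noteq> m \<Longrightarrow> succs s v m \<noteq> 0 \<and> succs s v m \<le> w"
    and "preds s v m \<noteq> 0 \<Longrightarrow> (preds s v m, v) \<in> set L \<and> pr (preds s v m) = m \<and> pr v \<noteq> m"
    and "(w, v) \<in> set L \<Longrightarrow> pr w = m \<Longrightarrow> pr v \<noteq> m \<Longrightarrow> w \<le> preds s v m"
proof -
  have q: "\<forall>u \<in> {1..n}. \<forall>j<k. succs s u j \<noteq> 0 \<longrightarrow>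
        (u, succs s u j) \<in> set L \<and> pr (succs s u j) = j \<and> pr u \<noteq> j"
    "\<forall>u v. (u, v) \<in> set L \<longrightarrow> pr u \<noteq> pr v \<longrightarrow>
        succs s u (pr v) \<noteq> 0 \<and> succs s u (pr v) \<le> v"
    "\<forall>v \<in> {1..n}. \<forall>j<k. preds s v j \<noteq> 0 \<longrightarrow>
        (preds s v j, v) \<in> set L \<and> pr (preds s v j) = j \<and> pr v \<noteq> j"
    "\<forall>u v. (u, v) \<in> set L \<longrightarrow> pr u \<noteq> pr v \<longrightarrow> u \<le> preds s v (pr u)"
    using assms(1) unfolding queue_def by - (elim conjE, assumption)+
  show "succs s v m \<noteq> 0 \<Longrightarrow> (v, succs s v m) \<in> set L \<and> pr (succs s v m) = m \<and> pr v \<noteq> m"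
    using q(1) assms(2,3) by blast
  show "(v, w) \<in> set L \<Longrightarrow> pr w = m \<Longrightarrow> pr v \<noteq> m \<Longrightarrow> succs s v m \<noteq> 0 \<and> succs s v m \<le> w"
    using q(2) by metis
  show "preds s v m \<noteq> 0 \<Longrightarrow> (preds s v m, v) \<in> set L \<and> pr (preds s v m) = m \<and> pr v \<noteq> m"
    using q(3) assms(2,3) by blast
  show "(w, v) \<in> set L \<Longrightarrow> pr w = m \<Longrightarrow> pr v \<noteq> m \<Longrightarrow> w \<le> preds s v m"
    using q(4) by metis
qed

lemma queue_forced: "queue L s \<Longrightarrow> set L \<subseteq> forced"
  by (simp add: queue_def)

lemma bval_writes:
  assumes "processing L0 e f h d L s"
  shows "bval writes s \<longleftrightarrow> opc e = 0 \<and> opc f = 0 \<and> arg e = arg f \<and> e \<noteq> f"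
  using assms staticD(2,3)[of s e] staticD(2,3)[of s f] processing_range(3,4)[OF assms]
  by (simp add: writes_def processing_def)

lemma processing_m: "processing L0 e f h d L (s(''m'' := g)) \<longleftrightarrow> processing L0 e f h d L s"
  by (simp add: processing_def counter_upd counters_def)

text \<open>\<open>result\<close> and \<open>D\<close> are read at different moments while the list
  grows. Both reads see at least the pairs of \<open>L0\<close>, and further pairs only make the
  entries more extremal. The budget 34 is 11 for each plain insertion and 12 for the guarded
  one.\<close>

lemma runs_chain:
  assumes p: "processing L0 e f h d L s" and m: "s ''m'' 0 = m" "m < k"
    and Q: "\<And>L' s'. processing L0 e f h d L' s' \<Longrightarrow> set L \<subseteq> set L' \<Longrightarrow> s' ''m'' 0 = m \<Longrightarrow>
      handled_chain (set L0) (set L') m e f \<Longrightarrow> Q s'"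
  shows "runs V (push_pair (var ''e'') (Cell ''result'' (row (Minus (var ''f'') (Const 1)) (var ''m''))) ;;
      push_pair (Cell ''D'' (row (var ''e'') (var ''m''))) (var ''f'') ;;
      When writes (push_pair (Cell ''last_reader'' (row (var ''e'') (var ''m''))) (var ''f''))) s 34 Q"
proof (rule runs_Seq[where ?B1.0 = 11 and ?B2.0 = 23])
  note r = processing_range[OF p]
  have s: "s ''e'' 0 = e" "s ''f'' 0 = f" "s ''processes'' 0 = k" "queue L s" "static s"
    using p by (auto simp: processing_def static_def)
  define y where "y = succs s f m"
  have y: "y = 0 \<or> (f, y) \<in> set L"
    using queue_succs(1)[OF s(4) r(4) m(2)] by (auto simp: y_def)
  show "runs V (push_pair (var ''e'') (Cell ''result'' (row (Minus (var ''f'') (Const 1)) (var ''m'')))) s 11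
     (\<lambda>s. runs V (push_pair (Cell ''D'' (row (var ''e'') (var ''m''))) (var ''f'') ;;
      When writes (push_pair (Cell ''last_reader'' (row (var ''e'') (var ''m''))) (var ''f''))) s 23 Q)"
  proof (rule runs_processing[OF p, where x = e and y = y])
    show "aval (var ''e'') s = e" using s by simp
    show "aval (Cell ''result'' (row (Minus (var ''f'') (Const 1)) (var ''m'')))
      (s(''u'' := (s ''u'')(0 := e))) = y" using s m by (simp add: y_def succs_def)
    have "y \<noteq> 0 \<Longrightarrow> (f, y) \<in> forced" using y queue_forced[OF s(4)] by blast
    then show "e = 0 \<or> y = 0 \<or> (e, y) \<in> forced" using forced_trans r(2) by blast
    show "e \<le> n" using r(3) by simp
    show "y \<le> n" using y queue_range[OF s(4)] by fastforce
  next
    fix L1 s1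
    assume p1: "processing L0 e f h d L1 s1" and L1: "set L \<subseteq> set L1" and m1: "s1 ''m'' 0 = s ''m'' 0"
      and y1: "e \<noteq> 0 \<Longrightarrow> y \<noteq> 0 \<Longrightarrow> (e, y) \<in> set L1"
    have s1: "s1 ''e'' 0 = e" "s1 ''f'' 0 = f" "s1 ''processes'' 0 = k" "queue L1 s1"
      using p1 by (auto simp: processing_def static_def)
    define x where "x = preds s1 e m"
    have x: "x = 0 \<or> (x, e) \<in> set L1"
      using queue_succs(3)[OF s1(4) r(3) m(2)] by (auto simp: x_def)
    show "runs V (push_pair (Cell ''D'' (row (var ''e'') (var ''m''))) (var ''f'') ;;
      When writes (push_pair (Cell ''last_reader'' (row (var ''e'') (var ''m''))) (var ''f''))) s1 23 Q"
    proof (rule runs_Seq[where ?B1.0 = 11 and ?B2.0 = 12], rule runs_processing[OF p1, where x = x and y = f])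
      show "aval (Cell ''D'' (row (var ''e'') (var ''m''))) s1 = x" using s1 m m1 by (simp add: x_def preds_def)
      show "aval (var ''f'') (s1(''u'' := (s1 ''u'')(0 := x))) = f" using s1 by simp
      have "x \<noteq> 0 \<Longrightarrow> (x, e) \<in> forced" using x queue_forced[OF s1(4)] by blast
      then show "x = 0 \<or> f = 0 \<or> (x, f) \<in> forced" using forced_trans r(2) by blast
      show "x \<le> n" using x queue_range[OF s1(4)] by fastforce
      show "f \<le> n" using r(4) by simp
    next
      fix L2 s2
      assume p2: "processing L0 e f h d L2 s2" and L2: "set L1 \<subseteq> set L2" and m2: "s2 ''m'' 0 = s1 ''m'' 0"
        and x2: "x \<noteq> 0 \<Longrightarrow> f \<noteq> 0 \<Longrightarrow> (x, f) \<in> set L2"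
      have L0: "set L0 \<subseteq> set L" using p by (auto simp: processing_def)
      \<comment> \<open>The witness is the table entry \<open>y\<close>: it is no later than any
        known successor \<open>w\<close> of \<open>f\<close> in chain \<open>m\<close>, and (e, y)
        has just been inserted.\<close>
      have right: "\<exists>w'\<le>w. pr w' = m \<and> (e, w') \<in> set L2"
        if w: "(f, w) \<in> set L0" "pr w = m" "pr f \<noteq> m" for w
      proof -
        have "y \<noteq> 0" "y \<le> w" using queue_succs(2)[OF s(4) r(4) m(2)] w L0 by (auto simp: y_def)
        moreover from this have "pr y = m" using queue_succs(1)[OF s(4) r(4) m(2)] by (simp add: y_def)
        ultimately show ?thesis using y1 r(3) L2 by (intro exI[of _ y]) auto
      qed
      \<comment> \<open>Dually, \<open>x\<close> is no earlier than any known predecessor of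
        \<open>e\<close> in chain \<open>m\<close>.\<close>
      have left: "\<exists>w'\<ge>w. pr w' = m \<and> (w', f) \<in> set L2"
        if w: "(w, e) \<in> set L0" "pr w = m" "pr e \<noteq> m" for w
      proof -
        have "(w, e) \<in> set L1" using w L0 L1 by blast
        then have "w \<le> x" "w \<noteq> 0"
          using queue_succs(4)[OF s1(4) r(3) m(2), of w] w queue_range[OF s1(4), of w e]
          by (auto simp: x_def)
        moreover from this have "pr x = m" using queue_succs(3)[OF s1(4) r(3) m(2)] by (simp add: x_def)
        ultimately show ?thesis using x2 r(4) by (intro exI[of _ x]) auto
      qed
      have hc: "handled_chain (set L0) (set L3) m e f"
        if "set L2 \<subseteq> set L3" "opc e = 0 \<Longrightarrow> opc f = 0 \<Longrightarrow> arg e = arg f \<Longrightarrow> e \<noteq> f \<Longrightarrow> last_reader e m \<noteq> 0 \<Longrightarrow>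
          (last_reader e m, f) \<in> set L3" for L3
        unfolding handled_chain_def
      proof (intro conjI allI impI, goal_cases)
        case (1 w)
        then show ?case using right[of w] that(1) by blast
      next
        case (2 w)
        then show ?case using left[of w] that(1) by blast
      next
        case 3
        then show ?case using that(2) by blast
      qed
      have s2: "s2 ''e'' 0 = e" "s2 ''f'' 0 = f" "s2 ''processes'' 0 = k" "tables s2" "s2 ''m'' 0 = m"
        using p2 m m1 m2 by (auto simp: processing_def static_def)
      show "runs V (When writes (push_pair (Cell ''last_reader'' (row (var ''e'') (var ''m''))) (var ''f''))) s2 12 Q"
      proof (rule runs_If[where B = 11], goal_cases)
        case 1
        then have w: "opc e = 0" "opc f = 0" "arg e = arg f" "e \<noteq> f"
          using bval_writes[OF p2] by blast+
        show ?case
        proof (rule runs_processing[OF p2, where x = "last_reader e m" and y = f])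
          show "aval (Cell ''last_reader'' (row (var ''e'') (var ''m''))) s2 = last_reader e m"
            using s2 tablesD(6)[OF s2(4) r(3) m(2)] by simp
          show "aval (var ''f'') (s2(''u'' := (s2 ''u'')(0 := last_reader e m))) = f" using s2 by simp
          show "last_reader e m = 0 \<or> f = 0 \<or> (last_reader e m, f) \<in> forced" using forced_last_reader[OF r(2) w] by blast
          show "last_reader e m \<le> n" "f \<le> n" using latest_bounds r(4) by auto
          show "Q s3" if "processing L0 e f h d L3 s3" "set L2 \<subseteq> set L3" "s3 ''m'' 0 = s2 ''m'' 0"
            "last_reader e m \<noteq> 0 \<Longrightarrow> f \<noteq> 0 \<Longrightarrow> (last_reader e m, f) \<in> set L3" for L3 s3
          proof (rule Q[OF that(1)])
            show "set L \<subseteq> set L3" using L1 L2 that by blast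
            show "s3 ''m'' 0 = m" using that s2 by simp
            show "handled_chain (set L0) (set L3) m e f" using hc[OF that(2)] that(4) r(4) by auto
          qed
        qed simp
      next
        case 2
        show ?case
        proof (rule runs_Skip, rule Q[OF p2])
          show "set L \<subseteq> set L2" using L1 L2 by blast
          show "s2 ''m'' 0 = m" using s2 by simp
          show "handled_chain (set L0) (set L2) m e f"
            by (rule hc) (use 2 bval_writes[OF p2] in auto)
        qed simp
      qed simp
    qed simp_all
  qed simp
qed simp

lemma runs_chains:
  assumes p: "processing L0 e f h d L s"
  shows "runs V chains s (k * 36 + 2) (\<lambda>s'. \<exists>L'. processing L0 e f h d L' s' \<and> set L \<subseteq> set L' \<and>
    (\<forall>m<k. handled_chain (set L0) (set L') m e f))"
proof -
  let ?I = "\<lambda>j s'. s' ''m'' 0 = j \<and> (\<exists>L'. processing L0 e f h d L' s' \<and> set L \<subseteq> set L' \<and>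
    (\<forall>m<j. handled_chain (set L0) (set L') m e f))"
  have "runs V chains s (k * 36 + 2) (?I k)"
    unfolding chains_def
  proof (rule runs_For[where I = ?I and N = k and B = 34], goal_cases)
    case (1 i s)
    then have "s ''m'' 0 = i" "static s" unfolding processing_def by blast+
    then show ?case using static_sizes(2)[of s] by simp
  next
    case (2 i s)
    then obtain L1 where L1: "s ''m'' 0 = i" "processing L0 e f h d L1 s" "set L \<subseteq> set L1"
      "\<forall>m<i. handled_chain (set L0) (set L1) m e f" by blast
    show ?case
    proof (rule runs_chain[OF L1(2,1) \<open>i < k\<close>])
      fix L' s' assume a: "processing L0 e f h d L' s'" "set L1 \<subseteq> set L'" "s' ''m'' 0 = i"
        "handled_chain (set L0) (set L') i e f"
      have "\<forall>m<Suc i. handled_chain (set L0) (set L') m e f"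
        using a(4) L1(4) handled_chain_mono[OF _ a(2)] by (auto simp: less_Suc_eq)
      then show "s' ''m'' 0 = i \<and> ?I (Suc i) (s'(''m'' := (s' ''m'')(0 := Suc i)))"
        using a L1(3) processing_m by auto
    qed
  next
    case 3
    then show ?case using p processing_m by auto
  qed (use V_bounds in auto)
  then show ?thesis by (rule runs_mono) auto
qed

lemma runs_When_processing:
  assumes p: "processing L0 e f h d L s" and c: "bval b s = c"
    and "c \<Longrightarrow> aval a s = x" "c \<Longrightarrow> aval a' (s(''u'' := (s ''u'')(0 := x))) = y"
    and "c \<Longrightarrow> x = 0 \<or> y = 0 \<or> (x, y) \<in> forced" and "c \<Longrightarrow> x \<le> n" "c \<Longrightarrow> y \<le> n"
    and "12 \<le> B"
    and Q: "\<And>L' s'. processing L0 e f h d L' s' \<Longrightarrow> set L \<subseteq> set L' \<Longrightarrow>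
      (c \<Longrightarrow> x \<noteq> 0 \<Longrightarrow> y \<noteq> 0 \<Longrightarrow> (x, y) \<in> set L') \<Longrightarrow> Q s'"
  shows "runs V (When b (push_pair a a')) s B Q"
proof (rule runs_If[where B = 11])
  assume "bval b s"
  then have "c" using c by simp
  show "runs V (push_pair a a') s 11 Q"
    by (rule runs_processing[OF p, where x = x and y = y]) (use assms \<open>c\<close> Q in auto)
next
  assume "\<not> bval b s"
  then show "runs V Skip s 11 Q" using c by (intro runs_Skip Q[OF p]) auto
qed (use assms in simp)

text \<open>The constant 53 is made up of 3 assignments, 2 for the flag, two insertions at 11, two
  guarded ones at 12, and 2 for the loop over the chains; each chain costs 34 plus the loop overhead
  of 2.\<close>

lemma runs_process:
  assumes st: "static s" and tb: "tables s" and q: "queue L s" and h: "s ''head'' 0 = h" "h < length L"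
    and d: "s ''defined'' 0 = d" and ef: "L ! h = (e, f)"
  shows "runs V process s (k * 36 + 53) (\<lambda>s'. \<exists>L'.
    processing L e f (Suc h) (if e \<noteq> f \<and> (f, e) \<in> set L then 0 else d) L' s' \<and>
    handled (set L') e f \<and> (\<forall>m<k. handled_chain (set L) (set L') m e f))"
    (is "runs V process s _ ?Q")
proof -
  have mem: "(e, f) \<in> set L" using ef h by (metis nth_mem)
  then have r: "e \<in> {1..n}" "f \<in> {1..n}" "(e, f) \<in> forced"
    using queue_range[OF q] queue_forced[OF q] by auto
  have QUV: "s ''QU'' h = e" "s ''QV'' h = f" using q h ef by (auto simp: queue_def)
  have hV: "Suc h \<le> V" using h length_le[OF q] V_bounds by simp
  have M: "s ''M'' (f * (n + 1) + e) = of_bool ((f, e) \<in> set L)"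
    using q r(1,2) by (simp add: queue_def)
  define d' where "d' = (if e \<noteq> f \<and> (f, e) \<in> set L then 0 else d)"
  define s1 where "s1 = s(''e'' := (s ''e'')(0 := e), ''f'' := (s ''f'')(0 := f),
    ''head'' := (s ''head'')(0 := Suc h), ''defined'' := (s ''defined'')(0 := if e \<noteq> f \<and> (f, e) \<in> set L then 0 else s ''defined'' 0))"
  have p1: "processing L e f (Suc h) d' L s1"
    unfolding processing_def s1_def using st tb q mem d
    by (simp add: counter_upd counters_def d'_def)
  have nz: "e \<noteq> 0" "f \<noteq> 0" using r by auto
  \<comment> \<open>Suffixes of the program are named so that they can be verified from the last one
    backwards, each under the consequences that earlier commands have already secured.\<close>
  define rest4 where "rest4 = When (And (Equal (input ''op'' (var ''e'')) (Const 2))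
         (And (Equal (input ''op'' (var ''f'')) (Const 3))
         (And (Equal (input ''loc'' (var ''e'')) (input ''loc'' (var ''f'')))
              (Neq (Cell ''release_of'' (var ''e'')) (var ''f'')))))
       (push_pair (Cell ''release_of'' (var ''e'')) (Cell ''acquire_of'' (var ''f''))) ;;
     chains"
  define rest3 where "rest3 = When (And (Equal (input ''op'' (var ''e'')) (Const 0))
         (And (Equal (input ''op'' (var ''f'')) (Const 1))
              (Equal (input ''loc'' (var ''e'')) (input ''loc'' (var ''f'')))))
       (push_pair (var ''e'') (Cell ''obs'' (var ''f''))) ;; rest4"
  have ev: "s' ''e'' 0 = e" "s' ''f'' 0 = f" "tables s'" "s' ''op'' (e - Suc 0) = opc e"
    "s' ''op'' (f - Suc 0) = opc f" "s' ''loc'' (e - Suc 0) = arg e" "s' ''loc'' (f - Suc 0) = arg f"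
    if "processing L e f (Suc h) d' L' s'" for L' s'
    using that staticD(2,3)[OF _ r(1), of s'] staticD(2,3)[OF _ r(2), of s']
    by (auto simp: processing_def)
  let ?prev = "\<lambda>M. chain_prev e \<noteq> 0 \<longrightarrow> (chain_prev e, f) \<in> M"
  let ?next = "\<lambda>M. chain_next f \<noteq> 0 \<longrightarrow> (e, chain_next f) \<in> M"
  let ?obs = "\<lambda>M. opc e = 0 \<longrightarrow> opc f = 1 \<longrightarrow> arg e = arg f \<longrightarrow> (e, observed f) \<in> M"
  have R4: "runs V rest4 s4 (k * 36 + 14) ?Q"
    if p4: "processing L e f (Suc h) d' L4 s4" and "?prev (set L4)" "?next (set L4)" "?obs (set L4)" for L4 s4
    unfolding rest4_def
  proof (rule runs_Seq[where ?B1.0 = 12 and ?B2.0 = "k * 36 + 2"],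
      rule runs_When_processing[OF p4, where x = "release_of e" and y = "acquire_of f" and
        c = "opc e = 2 \<and> opc f = 3 \<and> arg e = arg f \<and> release_of e \<noteq> f"], goal_cases)
    case 1
    show ?case using ev[OF p4] tablesD(5)[OF ev(3)[OF p4] r(1)] by simp
  next
    case 2
    show ?case using ev[OF p4] tablesD(5)[OF ev(3)[OF p4] r(1)] by simp
  next
    case 3
    show ?case using ev[OF p4] tablesD(4)[OF ev(3)[OF p4] r(2)] by simp
  next
    case 4
    then show ?case using forced_lock[OF r(3)] by blast
  next
    case 5
    show ?case by (rule latest_bounds)
  next
    case 6
    show ?case using latest_bounds(5)[of f] r by simp
  next
    case (8 L5 s5)
    \<comment> \<open>An insertion is skipped if either component is 0, so it matters here that the
      acquire of a release in \<open>X\<close> is itself in \<open>X\<close> and thus has a nonzero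
      code.\<close>
    have "release_of e \<noteq> 0 \<longrightarrow> (release_of e, acquire_of f) \<in> set L5"
      if c: "opc e = 2" "opc f = 3" "arg e = arg f" "release_of e \<noteq> f"
      using 8(3) c acquire_of_XC[of f] forced_XC r(3) by (auto simp: XC_def)
    then have h5: "handled (set L5) e f"
      unfolding handled_def using that(2-4) 8(2) by blast
    show ?case
    proof (rule runs_mono[OF runs_chains[OF 8(1)] le_refl])
      fix s' assume "\<exists>L'. processing L e f (Suc h) d' L' s' \<and> set L5 \<subseteq> set L' \<and>
        (\<forall>m<k. handled_chain (set L) (set L') m e f)"
      then show "?Q s'" using handled_mono[OF h5] unfolding d'_def by blast
    qed
  qed simp_all
  have R3: "runs V rest3 s3 (k * 36 + 26) ?Q"
    if p3: "processing L e f (Suc h) d' L3 s3" and "?prev (set L3)" "?next (set L3)" for L3 s3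
    unfolding rest3_def
  proof (rule runs_Seq[where ?B1.0 = 12 and ?B2.0 = "k * 36 + 14"],
      rule runs_When_processing[OF p3, where x = e and y = "observed f" and
        c = "opc e = 0 \<and> opc f = 1 \<and> arg e = arg f"], goal_cases)
    case 1
    show ?case using ev[OF p3] by simp
  next
    case 2
    show ?case using ev[OF p3] by simp
  next
    case 3
    show ?case using ev[OF p3] tablesD(3)[OF ev(3)[OF p3] r(2)] by simp
  next
    case 4
    then show ?case using forced_observed[OF r(3)] by blast
  next
    case 5
    show ?case using r by simp
  next
    case 6
    show ?case using latest_bounds(3)[of f] r by simp
  next
    case (8 L4 s4)
    have "?obs (set L4)"
      using 8(3) nz observed_XC[of f] forced_XC r(3) by (auto simp: XC_def)
    show ?case by (rule R4[OF 8(1)]) (use \<open>?obs (set L4)\<close> that(2,3) 8(2) in blast)+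
  qed simp_all
  have R2: "runs V (push_pair (var ''e'') (Cell ''next'' (var ''f'')) ;; rest3) s2 (k * 36 + 37) ?Q"
    if p2: "processing L e f (Suc h) d' L2 s2" and "?prev (set L2)" for L2 s2
  proof (rule runs_Seq[where ?B1.0 = 11 and ?B2.0 = "k * 36 + 26"],
      rule runs_processing[OF p2, where x = e and y = "chain_next f"], goal_cases)
    case 1
    show ?case using ev[OF p2] by simp
  next
    case 2
    show ?case using ev[OF p2] tablesD(2)[OF ev(3)[OF p2] r(2)] by simp
  next
    case 3
    have "chain_next f \<noteq> 0 \<Longrightarrow> (f, chain_next f) \<in> forced"
      using chain_next_XC[of f] nz forced_po[of f "chain_next f"] forced_XC r(3) by auto
    then show ?case using forced_trans r(3) by blast
  next
    case 4
    show ?case using r by simp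
  next
    case 5
    show ?case by (rule latest_bounds)
  next
    case (7 L3 s3)
    show ?case by (rule R3[OF 7(1)]) (use 7(2,4) that(2) nz in blast)+
  qed simp_all
  have R1: "runs V (push_pair (Cell ''prev'' (var ''e'')) (var ''f'') ;;
      push_pair (var ''e'') (Cell ''next'' (var ''f'')) ;; rest3) s1 (k * 36 + 48) ?Q"
  proof (rule runs_Seq[where ?B1.0 = 11 and ?B2.0 = "k * 36 + 37"],
      rule runs_processing[OF p1, where x = "chain_prev e" and y = f], goal_cases)
    case 1
    show ?case using ev[OF p1] tablesD(1)[OF ev(3)[OF p1] r(1)] by simp
  next
    case 2
    show ?case using ev[OF p1] by simp
  next
    case 3
    have "chain_prev e \<noteq> 0 \<Longrightarrow> (chain_prev e, e) \<in> forced"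
      using chain_prev_XC[of e] nz forced_po[of "chain_prev e" e] forced_XC r(3) by auto
    then show ?case using forced_trans r(3) by blast
  next
    case 4
    show ?case using latest_bounds(1)[of e] r by simp
  next
    case 5
    show ?case using r by simp
  next
    case (7 L2 s2)
    show ?case by (rule R2[OF 7(1)]) (use 7(4) nz in blast)
  qed simp_all
  show ?thesis
    unfolding process_def rest4_def[symmetric] rest3_def[symmetric]
    apply (rule runs_Store_Seq[where j = 0 and v = e and g = "s ''e''" and B = "k * 36 + 52"])
         apply (use r V_bounds h QUV in \<open>simp_all\<close>)[4]
     apply (rule runs_Store_Seq[where j = 0 and v = f and g = "s ''f''" and B = "k * 36 + 51"])
          apply (use r V_bounds h QUV in \<open>simp_all\<close>)[4]
      apply (rule runs_Store_Seq[where j = 0 and v = "Suc h" and g = "s ''head''" and B = "k * 36 + 50"])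
           apply (use hV h in \<open>simp_all\<close>)[4]
       apply (rule runs_When_Store_Seq[where c = "e \<noteq> f \<and> (f, e) \<in> set L" and j = 0 and v = 0
            and g = "s ''defined''" and B = "k * 36 + 48"])
             apply (use M static_sizes[OF st] in \<open>simp_all\<close>)[5]
        apply (rule R1[unfolded s1_def])
       apply simp_all
    done
qed

text \<open>The flag values carry claims of different strength: 0 exhibits a contradiction among the
  known pairs, whereas 1 only asserts antisymmetry of the dequeued prefix. The prefix is the whole
  list at the end, which is when antisymmetry is used.\<close>

definition explored :: "(nat \<times> nat) list \<Rightarrow> nat \<Rightarrow> memory \<Rightarrow> bool" where
  "explored L h s \<longleftrightarrow> static s \<and> tables s \<and> queue L s \<and> s ''head'' 0 = h \<and> h \<le> length L \<and>
     seeded n (set L) \<and> closed_on (set (take h L)) (set L) \<and>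
     (s ''defined'' 0 = 0 \<and> (\<exists>u v. u \<noteq> v \<and> (u, v) \<in> set L \<and> (v, u) \<in> set L) \<or>
      s ''defined'' 0 = 1 \<and> antisym (set (take h L)))"

lemma explored_step:
  assumes ex: "explored L h s" and h: "h < length L" "L ! h = (e, f)"
    and p: "processing L e f (Suc h) (if e \<noteq> f \<and> (f, e) \<in> set L then 0 else s ''defined'' 0) L' s'"
    and hd: "handled (set L') e f" "\<forall>m<k. handled_chain (set L) (set L') m e f"
  shows "explored L' (Suc h) s'"
proof -
  obtain zs where L': "L' = L @ zs" using p by (auto simp: processing_def)
  have tk: "set (take (Suc h) L') = insert (e, f) (set (take h L))"
    using h by (simp add: L' take_Suc_conv_app_nth)
  have sub: "set L \<subseteq> set L'" "set (take h L) \<subseteq> set L" by (auto simp: L' dest: in_set_takeD)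
  have mem: "(e, f) \<in> set L" using h by (metis nth_mem)
  have q: "queue L s" using ex by (simp add: explored_def)
  have "closed_on (insert (e, f) (set (take h L))) (set L')"
    by (rule closed_on_insert[OF _ sub(2,1) queue_forced[OF q] mem hd(1)])
      (use ex hd in \<open>auto simp: explored_def\<close>)
  moreover have "seeded n (set L')" using seeded_mono sub ex by (auto simp: explored_def)
  moreover have "Suc h \<le> length L'" using h by (simp add: L')
  moreover have "s' ''defined'' 0 = 0 \<and> (\<exists>u v. u \<noteq> v \<and> (u, v) \<in> set L' \<and> (v, u) \<in> set L') \<or>
      s' ''defined'' 0 = 1 \<and> antisym (insert (e, f) (set (take h L)))"
  proof (cases "e \<noteq> f \<and> (f, e) \<in> set L")
    case True
    then have "s' ''defined'' 0 = 0" using p by (simp add: processing_def)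
    then show ?thesis using True mem sub by blast
  next
    case False
    then have d: "s' ''defined'' 0 = s ''defined'' 0" using p by (auto simp: processing_def)
    \<comment> \<open>A new violation would need (f, e) in the prefix, hence in \<open>L\<close>,
      which the test on the matrix has just excluded.\<close>
    have "antisym (insert (e, f) (set (take h L)))" if a: "antisym (set (take h L))"
    proof (rule antisymI)
      fix u v assume "(u, v) \<in> insert (e, f) (set (take h L))" "(v, u) \<in> insert (e, f) (set (take h L))"
      then show "u = v" using a False sub(2) by (auto dest: antisymD)
    qed
    then show ?thesis using ex d sub unfolding explored_def by auto
  qed
  ultimately show ?thesis
    using p tk by (simp add: explored_def processing_def)
qed

text \<open>The head advances by one per round and stays below the length of a list of distinct
  pairs of codes, so \<open>n * n\<close> minus the head bounds the rounds left even though the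
  queue itself grows.\<close>

lemma runs_main:
  assumes "explored L 0 s"
  shows "runs V (While (Less (var ''head'') (var ''tail'')) process) s (n * n * (k * 36 + 54) + 1)
    (\<lambda>s. \<exists>L. explored L (length L) s)"
proof (rule runs_While[where B = "k * 36 + 53" and m = "n * n" and
      I = "\<lambda>m s. \<exists>L h. explored L h s \<and> m + h = n * n"])
  show "\<exists>L h. explored L h s \<and> n * n + h = n * n" using assms by auto
  show "n * n * (k * 36 + 53 + 1) + 1 \<le> n * n * (k * 36 + 54) + 1" by simp
next
  fix m s assume "\<exists>L h. explored L h s \<and> m + h = n * n" and b: "bval (Less (var ''head'') (var ''tail'')) s"
  then obtain L h where ex: "explored L h s" and mh: "m + h = n * n" by blast
  have s: "static s" "tables s" "queue L s" "s ''head'' 0 = h" using ex by (auto simp: explored_def)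
  have "s ''tail'' 0 = length L" using s(3) by (simp add: queue_def)
  then have h: "h < length L" using b s by simp
  then have m: "m > 0" using length_le[OF s(3)] mh by simp
  obtain e f where ef: "L ! h = (e, f)" by force
  have "runs V process s (k * 36 + 53) (\<lambda>s'. \<exists>L h. explored L h s' \<and> m - 1 + h = n * n)"
  proof (rule runs_mono[OF runs_process[OF s h refl ef] le_refl])
    fix s' assume "\<exists>L'. processing L e f (Suc h) (if e \<noteq> f \<and> (f, e) \<in> set L then 0 else s ''defined'' 0) L' s' \<and>
      handled (set L') e f \<and> (\<forall>m<k. handled_chain (set L) (set L') m e f)"
    then obtain L' where "explored L' (Suc h) s'" using explored_step[OF ex h ef] by blast
    then show "\<exists>L h. explored L h s' \<and> m - 1 + h = n * n" using m mh
      by (intro exI[of _ L'] exI[of _ "Suc h"]) simp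
  qed
  then show "m > 0 \<and> runs V process s (k * 36 + 53) (\<lambda>s'. \<exists>L h. explored L h s' \<and> m - 1 + h = n * n)"
    using m by blast
next
  fix m s assume "\<exists>L h. explored L h s \<and> m + h = n * n" and b: "\<not> bval (Less (var ''head'') (var ''tail'')) s"
  then obtain L h where ex: "explored L h s" by blast
  have "queue L s" using ex by (simp add: explored_def)
  then have "s ''tail'' 0 = length L" by (simp add: queue_def)
  then have "h = length L" using ex b by (simp add: explored_def)
  then show "\<exists>L. explored L (length L) s" using ex by blast
qed

abbreviation start_memory :: memory where
  "start_memory \<equiv> input_memory k nv nl t X E"

lemma edge_code_le: "edge_code t (E e j) \<le> n"
proof (cases "E e j")
  case (Some f)
  then have "f \<in> X" using repr unfolding represents_def by blast
  then obtain v where "v \<in> XC" "f = ev v" by (rule X_surj)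
  then show ?thesis using Some edge_code_Some XC_range[of v] by auto
qed (simp add: edge_code_def)

lemma start_static: "static (start_memory(''defined'' := g))"
proof -
  \<comment> \<open>The encoded edge array is cut off at \<open>n * k\<close>; this places every row
    access inside it.\<close>
  have "(u - 1) * k + j < n * k" if "u \<in> {1..n}" "j < k" for u j
  proof -
    have "(u - 1) * k + j < (u - 1) * k + k" using that by simp
    also have "\<dots> = u * k" using that by (cases u) auto
    also have "\<dots> \<le> n * k" using that by simp
    finally show ?thesis .
  qed
  then show ?thesis
    by (auto simp: static_def input_memory_def scalar_def array_def pr_def opc_def arg_def ev_def XC_def)
qed

lemma op_code_less: "op_code x < 4"
  by (cases x) auto

lemma start_cells: "cells_le V start_memory"
proof -
  have "proc (t ! i) < k" "op_arg (oper (t ! i)) \<le> V" if "i < n" for i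
  proof -
    have b: "proc (t ! i) < k \<and> (case loc (t ! i) of Variable x \<Rightarrow> x < nv | Lock l \<Rightarrow> l < nl)"
      using bounded that unfolding bounded_names_def by simp
    then show "proc (t ! i) < k" by simp
    show "op_arg (oper (t ! i)) \<le> V" using b V_bounds
      by (cases "oper (t ! i)") (auto simp: loc_def)
  qed
  then have "proc (t ! i) \<le> V" "op_arg (oper (t ! i)) \<le> V" if "i < n" for i
    using that V_bounds by (meson le_trans less_imp_le)+
  moreover have "op_code x \<le> V" for x using op_code_less[of x] V_bounds by simp
  moreover have "edge_code t (E e j) \<le> V" for e j using edge_code_le[of e j] V_bounds by simp
  moreover have "of_bool b \<le> V" for b using V_bounds by (cases b) auto
  ultimately show ?thesis
    using V_bounds by (auto simp: cells_le_def input_memory_def scalar_def array_def)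
qed

lemma runs_closure_program:
  "runs V closure_program start_memory
    (1 + (n * 17 + 2) + (n * (k * 13 + 16) + 2) + (n * n * (k * 36 + 54) + 1))
    (\<lambda>s. \<exists>L. explored L (length L) s)"
proof -
  let ?s = "start_memory(''defined'' := (start_memory ''defined'')(0 := 1))"
  let ?main = "While (Less (var ''head'') (var ''tail'')) process"
  have fr: "fresh ?s" by (simp add: fresh_def input_memory_def)
  have z: "?s z i = 0" if "z \<in> {''last'', ''lw'', ''la'', ''next'', ''release_of'', ''last_reader''}" for z i
    using that unfolding insert_iff empty_iff
    by (elim disjE FalseE) (simp_all add: input_memory_def)
  have 3: "runs V ?main s (n * n * (k * 36 + 54) + 1) (\<lambda>s. \<exists>L. explored L (length L) s)"
    if s: "static s \<and> tables s \<and> s ''defined'' 0 = 1 \<and> s ''head'' 0 = 0 \<and>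
      (\<exists>L. queue L s \<and> seeded n (set L))" for s
  proof -
    from s obtain L where "queue L s" "seeded n (set L)" by blast
    then have "explored L 0 s" using s by (simp add: explored_def closed_on_def)
    then show ?thesis by (rule runs_main)
  qed
  have 2: "runs V (start ;; ?main) s ((n * (k * 13 + 16) + 2) + (n * n * (k * 36 + 54) + 1))
      (\<lambda>s. \<exists>L. explored L (length L) s)" if s: "static s \<and> fresh s \<and> tables s" for s
    using s by (intro runs_Seq[OF runs_mono[OF runs_start le_refl 3] le_refl]) auto
  have 1: "runs V (scan ;; start ;; ?main) ?s
      ((n * 17 + 2) + ((n * (k * 13 + 16) + 2) + (n * n * (k * 36 + 54) + 1)))
      (\<lambda>s. \<exists>L. explored L (length L) s)"
    by (rule runs_Seq[OF runs_mono[OF runs_scan[OF start_static fr z] le_refl 2] le_refl])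
  show ?thesis
    unfolding closure_program_def
    by (rule runs_Store_Seq[OF _ _ refl _ _ _, where j = 0 and v = 1, OF _ _ _ 1])
      (use V_bounds in auto)
qed

text \<open>With an exhausted queue the flag decides: 0 comes with two forced pairs that no
  antisymmetric refinement can contain, 1 with a saturated antisymmetric set of forced pairs, which
  is the least closed refinement.\<close>

lemma explored_result:
  assumes ex: "explored L (length L) s"
  shows "if \<exists>Q. closed_refinement t X P Q
     then \<exists>Q E'. is_closure t X P Q \<and> represents k t X E' Q \<and> outputs_edges k t s E'
     else outputs_bottom s"
proof (cases "s ''defined'' 0 = 0")
  case True
  then obtain u v where "u \<noteq> v" "(u, v) \<in> set L" "(v, u) \<in> set L"
    using ex by (auto simp: explored_def)
  moreover have "set L \<subseteq> forced" using ex queue_forced unfolding explored_def by blast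
  ultimately have "\<not> (\<exists>Q. closed_refinement t X P Q)" using no_closed_refinement by blast
  then show ?thesis using True by (simp add: outputs_bottom_def)
next
  case False
  then have d: "s ''defined'' 0 = 1" and anti: "antisym (set L)" and q: "queue L s"
    and sd: "seeded n (set L)" and cl: "closed_on (set L) (set L)"
    using ex by (auto simp: explored_def)
  have forced: "set L \<subseteq> forced" using q by (rule queue_forced)
  have sat: "saturated (set L)" using saturatedI forced sd cl by blast
  note qs = queue_succs[OF q]
  have rng: "u \<in> {1..n}" "v \<in> {1..n}" "u \<in> XC" if "(u, v) \<in> set L" for u v
    using that queue_range[OF q] forced forced_XC by blast+
  have rep: "represents k t X (edges_of (succs s)) (decode (set L))"
  proof (rule represents_decode[OF sat anti])
    fix u j assume "u \<in> XC" "j < k" "succs s u j \<noteq> 0"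
    then show "(u, succs s u j) \<in> set L \<and> pr (succs s u j) = j \<and> pr u \<noteq> j"
      using qs(1) XC_range by blast
  next
    fix u v assume "(u, v) \<in> set L" "pr u \<noteq> pr v"
    then show "succs s u (pr v) \<noteq> 0 \<and> succs s u (pr v) \<le> v"
      using qs(2)[of u "pr v" v] rng pr_less by blast
  qed
  have "s ''result'' (i * k + j) = edge_code t (edges_of (succs s) (t ! i) j)" if "i < n" "j < k" for i j
  proof -
    have e: "t ! i = ev (Suc i)" "s ''result'' (i * k + j) = succs s (Suc i) j"
      by (simp_all add: ev_def succs_def)
    have u: "Suc i \<in> {1..n}" using that by simp
    show ?thesis
    proof (cases "succs s (Suc i) j = 0")
      case True
      \<comment> \<open>This also covers positions outside \<open>X\<close>: their rows stay 0,
        because every recorded pair lies in \<open>XC\<close>.\<close>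
      then have "edges_of (succs s) (ev (Suc i)) j = None"
        using edges_of_ev[OF sat anti, of "Suc i" "succs s" j] u XC_iff
        by (cases "Suc i \<in> XC") (auto simp: edges_of_def[OF sat anti] XC_def)
      then show ?thesis using e True by (simp add: edge_code_def)
    next
      case False
      then have m: "(Suc i, succs s (Suc i) j) \<in> set L" using qs(1) u that by blast
      then have "edges_of (succs s) (ev (Suc i)) j = Some (ev (succs s (Suc i) j))"
        using edges_of_ev[OF sat anti, of "Suc i"] rng(3) that False by simp
      then show ?thesis using e edge_code_Some[OF rng(2)[OF m]] by simp
    qed
  qed
  then have out: "outputs_edges k t s (edges_of (succs s))"
    using d by (simp add: outputs_edges_def)
  have "is_closure t X P (decode (set L))" using decode_is_closure[OF sat anti forced] .
  then show ?thesis using rep out by (auto simp: is_closure_def)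
qed

end

lemma step_bound:
  fixes n k K :: nat
  assumes "2 \<le> n" "1 \<le> k" "k \<le> K"
  shows "real (1 + (n * 17 + 2) + (n * (k * 13 + 16) + 2) + (n * n * (k * 36 + 54) + 1))
     \<le> 150 * real K ^ 1 * (real n ^ 2 * log 2 (real n))"
proof -
  let ?N = "K * (n * n)"
  have n: "n \<le> n * n" "4 \<le> n * n" using assms(1) mult_le_mono[of 2 n 2 n] by auto
  have "n * n \<le> ?N" "k * (n * n) \<le> ?N" using assms by (auto intro: mult_le_mono1)
  moreover have "n * k \<le> k * (n * n)" using n(1) by (simp add: mult.commute)
  \<comment> \<open>With 6 at most \<open>2 * (n * n)\<close>, the coefficients sum to (2 + 33 + 54)
    + (13 + 36) = 138; 150 is this value rounded up.\<close>
  ultimately have "6 + 33 * n + 13 * (n * k) + 36 * (k * (n * n)) + 54 * (n * n) \<le> 150 * ?N"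
    using n by linarith
  moreover have "1 + (n * 17 + 2) + (n * (k * 13 + 16) + 2) + (n * n * (k * 36 + 54) + 1)
      = 6 + 33 * n + 13 * (n * k) + 36 * (k * (n * n)) + 54 * (n * n)"
    by (simp add: algebra_simps)
  ultimately have "1 + (n * 17 + 2) + (n * (k * 13 + 16) + 2) + (n * n * (k * 36 + 54) + 1) \<le> 150 * ?N"
    by simp
  then have "real (1 + (n * 17 + 2) + (n * (k * 13 + 16) + 2) + (n * n * (k * 36 + 54) + 1)) \<le> real (150 * ?N)"
    by (rule of_nat_mono)
  also have "\<dots> = 150 * real K * (real n ^ 2 * 1)" by (simp add: power2_eq_square)
  \<comment> \<open>The logarithm enters merely as a factor that is at least 1 for \<open>n\<close>
    at least 2.\<close>
  also have "\<dots> \<le> 150 * real K * (real n ^ 2 * log 2 (real n))"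
    using assms(1) by (intro mult_left_mono) (auto simp: le_log_iff)
  finally show ?thesis by simp
qed

theorem theorem3p3:
  shows "\<exists>(Closure :: com) (b :: nat) (c :: nat) (d :: nat).
    \<forall>(k :: nat) (nv :: nat) (nl :: nat) (t :: event list) (X :: event set) (P :: event rel) (E :: edges).
      trace t \<and> bounded_names k nv nl t \<and> feasible t X \<and> partial_order_on X P \<and>
      respects_trace t X P \<and> represents k t X E P \<longrightarrow>
      (\<exists>T s.
         exec (word_bound b k nv nl (length t)) Closure (input_memory k nv nl t X E) T s \<and>
         (if \<exists>Q. closed_refinement t X P Q
          then \<exists>Q E'. is_closure t X P Q \<and> represents k t X E' Q \<and> outputs_edges k t s E'
          else outputs_bottom s) \<and>
         (length t \<ge> 2 \<longrightarrow>
            real T \<le> real c * real (k + nv + nl) ^ d * (real (length t) ^ 2 * log 2 (real (length t)))))"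
\<comment> \<open>The word exponent 40 is 2 * 20, since \<open>V\<close> is a square and values are
  bounded by \<open>V ^ 20\<close>. The factor 150 comes from \<open>step_bound\<close>, and the
  exponent 1 reflects running time linear in \<open>k\<close>.\<close>
proof (rule exI[of _ closure_program], rule exI[of _ 40], rule exI[of _ 150], rule exI[of _ 1],
    intro allI impI, goal_cases)
  case (1 k nv nl t X P E)
  then interpret closure_input k nv nl t X P E by unfold_locales auto
  let ?B = "1 + (n * 17 + 2) + (n * (k * 13 + 16) + 2) + (n * n * (k * 36 + 54) + 1)"
  have "2 \<le> V" using V_bounds by simp
  then obtain T s L where T: "exec (V ^ 20) closure_program start_memory T s" "T \<le> ?B"
    and ex: "explored L (length L) s"
    using runs_closure_program start_cells cdeg_closure_program unfolding runs_def by blast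
  have W: "V ^ 20 = word_bound 40 k nv nl n"
    unfolding V_def word_bound_def by (simp flip: power_mult)
  have "real T \<le> real 150 * real (k + nv + nl) ^ 1 * (real n ^ 2 * log 2 (real n))" if "2 \<le> n"
  proof -
    \<comment> \<open>The trace is nonempty, and the process number of its first event is below
      \<open>k\<close>.\<close>
    have "1 \<le> k" using pr_less[of 1] that by simp
    have "real T \<le> real ?B" using T(2) by (rule of_nat_mono)
    also have "\<dots> \<le> 150 * real (k + nv + nl) ^ 1 * (real n ^ 2 * log 2 (real n))"
      using step_bound[OF that \<open>1 \<le> k\<close>, of "k + nv + nl"] by simp
    finally show ?thesis by simp
  qed
  then show ?case using T(1) explored_result[OF ex] unfolding W by blast
qed

end
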